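(* Let $XYZ$ be a non-equilateral triangle and let $\chi$ be a polygonal coloring. Then there is a monochromatic copy $X'Y'Z'$ of the configuration $XYZ$ such that none of the points $X',Y',Z'$ belongs to the boundary of $\chi$.
   Context: A coloring is a partition $\chi=(\mathfrak{B},\mathfrak{W})$ of $\mathbb{R}^2$ into black and white points; its boundary $\mathcal{B}$ is the common boundary of $\mathfrak{B}$ and $\mathfrak{W}$. $\chi$ is polygonal if: each of $\mathfrak{B},\mathfrak{W}$ is contained in the closure of its interior; $\mathcal{B}$ is a union of straight line segments (boundary segments, possibly half-lines or lines) meeting only at their endpoints (boundary vertices), with no two segments forming a straight angle at a vertex where exactly two meet; and every bounded region meets only finitely many boundary segments. Boundary points may have either color. A triangle is any set of three points (collinear triples allowed). A copy of a set is its image under translations and rotations of the plane. A set is monochromatic if it is contained in $\mathfrak{B}$ or in $\mathfrak{W}$. *)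

theory Defs
  imports "HOL-Analysis.Analysis"
begin

type_synonym plane = "real^2"

definition coloring :: "plane set \<Rightarrow> plane set \<Rightarrow> bool" where
  "coloring B W \<longleftrightarrow> B \<union> W = UNIV \<and> B \<inter> W = {}"

text \<open>For a coloring the two frontiers agree, see \<open>coloring_boundary_commute\<close>.\<close>

definition coloring_boundary :: "plane set \<Rightarrow> plane set \<Rightarrow> plane set" where
  "coloring_boundary B W = frontier B \<inter> frontier W"

lemma coloring_boundary_commute:
  assumes "coloring B W"
  shows "frontier B = frontier W" "coloring_boundary B W = frontier B"
proof -
  have "W = - B"
    using assms by (auto simp: coloring_def)
  then show "frontier B = frontier W" "coloring_boundary B W = frontier B"
    by (simp_all add: coloring_boundary_def frontier_complement)
qed

definition half_line :: "plane \<Rightarrow> plane \<Rightarrow> plane set" where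
  "half_line a d = {a + t *\<^sub>R d | t. 0 \<le> t}"

definition full_line :: "plane \<Rightarrow> plane \<Rightarrow> plane set" where
  "full_line a d = {a + t *\<^sub>R d | t. True}"

definition straight_segment :: "plane set \<Rightarrow> bool" where
  "straight_segment S \<longleftrightarrow>
     (\<exists>a b. a \<noteq> b \<and> S = closed_segment a b) \<or>
     (\<exists>a d. d \<noteq> 0 \<and> S = half_line a d) \<or>
     (\<exists>a d. d \<noteq> 0 \<and> S = full_line a d)"

text \<open>A half-line has one endpoint, a full line none.\<close>

definition endpoint :: "plane \<Rightarrow> plane set \<Rightarrow> bool" where
  "endpoint v S \<longleftrightarrow>
     (\<exists>a. a \<noteq> v \<and> S = closed_segment v a) \<or>
     (\<exists>d. d \<noteq> 0 \<and> S = half_line v d)"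

text \<open>Used for distinct segments \<open>S\<close> and \<open>T\<close> with common endpoint \<open>v\<close>; the angle
  is then independent of the choice of \<open>p\<close> and \<open>q\<close>.\<close>

definition straight_angle_at :: "plane \<Rightarrow> plane set \<Rightarrow> plane set \<Rightarrow> bool" where
  "straight_angle_at v S T \<longleftrightarrow> (\<exists>p\<in>S - {v}. \<exists>q\<in>T - {v}. v \<in> open_segment p q)"

definition boundary_segments :: "plane set set \<Rightarrow> plane set \<Rightarrow> bool" where
  "boundary_segments \<S> C \<longleftrightarrow>
     (\<forall>S\<in>\<S>. straight_segment S) \<and>
     \<Union>\<S> = C \<and>
     (\<forall>S\<in>\<S>. \<forall>T\<in>\<S>. S \<noteq> T \<longrightarrow> (\<forall>v\<in>S \<inter> T. endpoint v S \<and> endpoint v T)) \<and>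
     (\<forall>v. \<forall>S\<in>\<S>. \<forall>T\<in>\<S>. S \<noteq> T \<and> {U\<in>\<S>. endpoint v U} = {S, T} \<longrightarrow>
        \<not> straight_angle_at v S T) \<and>
     (\<forall>R. bounded R \<longrightarrow> finite {S\<in>\<S>. S \<inter> R \<noteq> {}})"

definition polygonal_coloring :: "plane set \<Rightarrow> plane set \<Rightarrow> bool" where
  "polygonal_coloring B W \<longleftrightarrow>
     coloring B W \<and>
     B \<subseteq> closure (interior B) \<and> W \<subseteq> closure (interior W) \<and>
     (\<exists>\<S>. boundary_segments \<S> (coloring_boundary B W))"

definition is_triangle :: "plane \<Rightarrow> plane \<Rightarrow> plane \<Rightarrow> bool" where
  "is_triangle X Y Z \<longleftrightarrow> X \<noteq> Y \<and> Y \<noteq> Z \<and> Z \<noteq> X"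

definition equilateral :: "plane \<Rightarrow> plane \<Rightarrow> plane \<Rightarrow> bool" where
  "equilateral X Y Z \<longleftrightarrow> dist X Y = dist Y Z \<and> dist Y Z = dist Z X"

text \<open>The maps \<open>p \<mapsto> Q p + t\<close> with \<open>Q\<close> orthogonal of determinant 1 are exactly the
  compositions of translations and rotations about arbitrary centres; reflections are excluded.\<close>

definition copy_of :: "plane set \<Rightarrow> plane set \<Rightarrow> bool" where
  "copy_of S S' \<longleftrightarrow>
     (\<exists>(Q :: real^2^2) t. rotation_matrix Q \<and> S' = (\<lambda>p. Q *v p + t) ` S)"

definition monochromatic :: "plane set \<Rightarrow> plane set \<Rightarrow> plane set \<Rightarrow> bool" where
  "monochromatic B W S \<longleftrightarrow> S \<subseteq> B \<or> S \<subseteq> W"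

end

theory Submission
  imports Defs
begin

text \<open>
  An eight-point configuration turns a monochromatic equilateral triangle whose side is a side of
  \<open>XYZ\<close> into a monochromatic copy of \<open>XYZ\<close>. So it suffices that a polygonal colouring cannot
  avoid the equilateral triangles of two side lengths \<open>a < b\<close> at once.

  Suppose that it avoids side length \<open>r\<close>, and let \<open>\<omega> = exp (i \<pi>/3)\<close>. Around a boundary point
  \<open>A\<close> the colours at \<open>A + v\<close> and \<open>A + \<omega>v\<close>, \<open>\<bar>v\<bar> = r\<close>, differ, so the set of directions of
  colour changes is nonempty and invariant under \<open>\<omega>\<close>. If \<open>A\<close> and \<open>B\<close> lie at distance \<open>r\<close> inside
  boundary segments, these segments are parallel; otherwise both third vertices would stay on the
  boundary while \<open>A\<close> and \<open>B\<close> slide along the segments. Hence the set of directions is locally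
  constant along the boundary and every colour change \<open>v\<close> translates the whole boundary curve
  through \<open>A\<close> into the boundary. This makes every boundary curve a graph, invariant under a
  translation \<open>e\<close> of length \<open>r\<close>, whose tangents are within \<open>\<pi>/6\<close> of \<open>e\<close>.

  No translate of the curve lies strictly between it and its translate by \<open>\<omega>e\<close>: the circle of
  radius \<open>r\<close> around a point \<open>P\<close> of the curve would meet such a translate at some \<open>P + v\<close>, and then
  \<open>\<omega>(v - e)\<close> gives a strictly lower one, which contradicts local finiteness. But the periods of
  lengths \<open>a\<close> and \<open>b\<close> are parallel, so for \<open>r = b\<close> the translate by \<open>\<omega>\<close> times the period of
  length \<open>a\<close> lies strictly between.
\<close>

section \<open>Colourings near the boundary\<close>

text \<open>A single side length gives no contradiction: parallel open strips of width
  \<open>sqrt 3 / 2 * r\<close>, coloured alternately, contain no monochromatic equilateral triangle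
  of side \<open>r\<close> with vertices off the boundary lines. This example explains the bound
  \<open>sqrt 3 / 2\<close> on the heights of translates and the need to play two lengths against
  each other. The obstacle is that information about \<open>A\<close> and \<open>A + v\<close> has
  to survive vertices, tangencies and boundary points of arbitrary colour. Therefore triangles are
  sought in the open colour classes, and a direction counts only if the circle really changes colour
  there: a mere contact with the boundary can vanish when \<open>A\<close> moves along its curve, a
  colour change cannot. The periods of both lengths are parallel because, over the direction of one
  period, the curve is the graph of a bounded function, and a translation that preserves such a
  graph has no vertical component.\<close>

definition omega :: complex where "omega = Complex (1/2) (sqrt 3 / 2)"

lemma omega_simps [simp]: "Re omega = 1/2" "Im omega = sqrt 3 / 2"
  by (simp_all add: omega_def)

lemma omega_cis: "omega = cis (pi/3)"
  by (simp add: complex_eq_iff cos_60 sin_60)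

lemma norm_om [simp]: "norm omega = 1"
  by (simp add: omega_cis)

lemma omega_cnj: "omega * cnj omega = 1" "cnj omega = 1 - omega" "omega * omega = omega - 1"
  by (simp_all add: complex_eq_iff field_simps)

lemma omega_nz [simp]: "omega \<noteq> 0"
  using norm_om by force

lemma omega_cube: "omega * omega * omega = -1"
  by (simp add: complex_eq_iff)

text \<open>\<open>Bo\<close> and \<open>Wo\<close> stand for the interiors of the two classes, so
  the points of \<open>E\<close> carry no colour. \<open>star\<close> is the local form of the
  segment structure and treats vertices and inner points of segments alike.\<close>

locale plane_coloring =
  fixes Bo Wo E :: "complex set"
  assumes open_Bo: "open Bo" and open_Wo: "open Wo" and disj: "Bo \<inter> Wo = {}"
    and E_eq: "E = - (Bo \<union> Wo)"
    and E_Bo: "E \<subseteq> closure Bo" and E_Wo: "E \<subseteq> closure Wo"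
    and star: "\<And>P. P \<in> E \<Longrightarrow> \<exists>D \<delta>. finite D \<and> D \<noteq> {} \<and> \<delta> > 0 \<and> (\<forall>d\<in>D. norm d = 1) \<and>
                  (\<forall>x. norm x < \<delta> \<longrightarrow> (P + x \<in> E \<longleftrightarrow> (\<exists>d\<in>D. \<exists>t\<ge>0. x = of_real t * d)))"
begin

lemma closed_E: "closed E"
  unfolding E_eq using open_Bo open_Wo by (intro closed_Compl open_Un)

lemma connected_one_color:
  assumes "connected S" "S \<inter> E = {}"
  shows "S \<subseteq> Bo \<or> S \<subseteq> Wo"
proof -
  have "S \<subseteq> Bo \<union> Wo" using assms(2) E_eq by auto
  then have "Bo \<inter> S = {} \<or> Wo \<inter> S = {}"
    using assms(1) open_Bo open_Wo disj by (auto dest: connectedD)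
  then show ?thesis using \<open>S \<subseteq> Bo \<union> Wo\<close> by auto
qed

text \<open>Defined from \<open>E\<close> alone, so that the set \<open>D\<close> whose existence
  \<open>star\<close> asserts becomes a function of the point; \<open>ray_dirs_star\<close>
  identifies the two.\<close>

definition ray_dirs :: "complex \<Rightarrow> complex set" where
  "ray_dirs P = {d. norm d = 1 \<and> (\<exists>\<delta>>0. \<forall>t. 0 < t \<and> t < \<delta> \<longrightarrow> P + of_real t * d \<in> E)}"

lemma unit_ray_unique:
  assumes "norm (d::complex) = 1" "norm (d'::complex) = 1" "of_real t * d = of_real s * d'" "t > 0" "s \<ge> 0"
  shows "d = d' \<and> t = s"
proof -
  have "norm (of_real t * d) = norm (of_real s * d')" using assms(3) by simp
  then have "\<bar>t\<bar> = \<bar>s\<bar>" using assms(1,2) by (simp add: norm_mult)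
  then have "t = s" using assms(4,5) by simp
  then show ?thesis using assms by auto
qed

lemma ray_dirs_star:
  assumes "P \<in> E"
  shows "finite (ray_dirs P)" "ray_dirs P \<noteq> {}"
    "\<exists>\<delta>>0. \<forall>x. norm x < \<delta> \<longrightarrow> (P + x \<in> E \<longleftrightarrow> (\<exists>d\<in>ray_dirs P. \<exists>t\<ge>0. x = of_real t * d))"
proof -
  obtain D \<delta> where D: "finite D" "D \<noteq> {}" "\<delta> > 0" "\<forall>d\<in>D. norm d = 1"
    and E: "\<And>x. norm x < \<delta> \<Longrightarrow> (P + x \<in> E \<longleftrightarrow> (\<exists>d\<in>D. \<exists>t\<ge>0. x = of_real t * d))"
    using star[OF assms] by metis
  have "ray_dirs P = D"
  proof (intro set_eqI iffI)
    fix d assume "d \<in> ray_dirs P"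
    then obtain e where d: "norm d = 1" "e > 0" "\<And>t. 0 < t \<Longrightarrow> t < e \<Longrightarrow> P + of_real t * d \<in> E"
      unfolding ray_dirs_def by auto
    define t where "t = min e \<delta> / 2"
    have t: "0 < t" "t < e" "t < \<delta>" using d D by (auto simp: t_def)
    have "norm (of_real t * d) < \<delta>" using t d by (simp add: norm_mult)
    then obtain d' s where "d' \<in> D" "s \<ge> 0" "of_real t * d = of_real s * d'"
      using E d(3)[OF t(1,2)] by blast
    then show "d \<in> D" using unit_ray_unique D(4) d(1) t(1) by metis
  next
    fix d assume "d \<in> D"
    then have "P + of_real t * d \<in> E" if "0 < t" "t < \<delta>" for t
    proof -
      have "norm (of_real t * d) < \<delta>" using that D(4) \<open>d \<in> D\<close> by (simp add: norm_mult)
      then show ?thesis using E \<open>d \<in> D\<close> that(1) less_imp_le by blast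
    qed
    then show "d \<in> ray_dirs P" unfolding ray_dirs_def using D \<open>d \<in> D\<close> by blast
  qed
  then show "finite (ray_dirs P)" "ray_dirs P \<noteq> {}"
    "\<exists>\<delta>>0. \<forall>x. norm x < \<delta> \<longrightarrow> (P + x \<in> E \<longleftrightarrow> (\<exists>d\<in>ray_dirs P. \<exists>t\<ge>0. x = of_real t * d))"
    using D E by auto
qed

lemma ray_dirs_norm: "d \<in> ray_dirs P \<Longrightarrow> norm d = 1"
  by (simp add: ray_dirs_def)

text \<open>A point inside a boundary segment, with \<open>m\<close> the unit normal towards black.
  The sign of \<open>m\<close> matters: two points with opposite normals cannot be moved into the
  same colour by one small translation.\<close>

definition regular :: "complex \<Rightarrow> complex \<Rightarrow> bool" where
  "regular A m \<longleftrightarrow> norm m = 1 \<and> (\<exists>\<delta>>0. \<forall>x. norm x < \<delta> \<longrightarrow>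
     (x \<bullet> m > 0 \<longrightarrow> A + x \<in> Bo) \<and> (x \<bullet> m < 0 \<longrightarrow> A + x \<in> Wo) \<and> (x \<bullet> m = 0 \<longrightarrow> A + x \<in> E))"

lemma regular_E: "regular A m \<Longrightarrow> A \<in> E"
  unfolding regular_def by (metis add.right_neutral inner_zero_left norm_zero)

lemma regular_slide:
  assumes "regular A m"
  shows "\<exists>\<delta>>0. \<forall>x. norm x < \<delta> \<and> x \<bullet> m = 0 \<longrightarrow> regular (A + x) m"
proof -
  obtain \<delta> where \<delta>: "\<delta> > 0" "norm m = 1" and R: "\<And>x. norm x < \<delta> \<Longrightarrow>
     (x \<bullet> m > 0 \<longrightarrow> A + x \<in> Bo) \<and> (x \<bullet> m < 0 \<longrightarrow> A + x \<in> Wo) \<and> (x \<bullet> m = 0 \<longrightarrow> A + x \<in> E)"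
    using assms unfolding regular_def by auto
  have "regular (A + x) m" if "norm x < \<delta>/2" "x \<bullet> m = 0" for x :: complex
    unfolding regular_def
  proof (intro conjI exI[of _ "\<delta>/2"] allI impI)
    fix y :: complex assume y: "norm (y::complex) < \<delta>/2"
    have "norm (x + y) < \<delta>" using that y norm_triangle_ineq[of x y] by linarith
    note * = R[OF this, unfolded inner_add_left that(2)]
    show "y \<bullet> m > 0 \<Longrightarrow> A + x + y \<in> Bo" "y \<bullet> m < 0 \<Longrightarrow> A + x + y \<in> Wo"
      "y \<bullet> m = 0 \<Longrightarrow> A + x + y \<in> E" using * by (auto simp: add.assoc)
  qed (use \<delta> in auto)
  then show ?thesis using \<delta>(1) by (intro exI[of _ "\<delta>/2"]) auto
qed

lemma closed_unit_ray: "closed {z. \<exists>t\<ge>0. z = of_real t * (d::complex)}" if "norm d = 1"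
proof -
  have "{z. \<exists>t\<ge>0. z = of_real t * d} = {z. Im (z * cnj d) = 0} \<inter> {z. Re (z * cnj d) \<ge> 0}"
  proof (intro set_eqI iffI)
    fix z assume "z \<in> {z. \<exists>t\<ge>0. z = of_real t * d}"
    then obtain t where "t \<ge> 0" "z = of_real t * d" by auto
    moreover have "d * cnj d = 1" using that by (simp add: complex_norm_square[symmetric])
    ultimately have "z * cnj d = of_real t" by (simp add: mult.assoc)
    then have "Im (z * cnj d) = 0" "Re (z * cnj d) \<ge> 0"
      using \<open>t \<ge> 0\<close> by (metis Im_complex_of_real, metis Re_complex_of_real)
    then show "z \<in> {z. Im (z * cnj d) = 0} \<inter> {z. Re (z * cnj d) \<ge> 0}" by blast
  next
    fix z assume z: "z \<in> {z. Im (z * cnj d) = 0} \<inter> {z. Re (z * cnj d) \<ge> 0}"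
    have "d * cnj d = 1" using that by (simp add: complex_norm_square[symmetric])
    then have "z = (z * cnj d) * d" by (simp add: mult.assoc mult.commute)
    moreover have "z * cnj d = of_real (Re (z * cnj d))" using z by (simp add: complex_eq_iff)
    ultimately have "z = of_real (Re (z * cnj d)) * d" by metis
    then show "z \<in> {z. \<exists>t\<ge>0. z = of_real t * d}" using z by blast
  qed
  moreover have "closed {z. Im (z * cnj d) = 0}" "closed {z. Re (z * cnj d) \<ge> 0}"
    by (intro closed_Collect_eq closed_Collect_le continuous_intros)+
  ultimately show ?thesis by auto
qed

text \<open>Off the vertices the two sides of the boundary have different colours, since every boundary
  point is a limit of both open colour classes.\<close>

lemma regular_if_line:
  assumes "norm m = 1" "\<delta> > 0" and line: "\<And>x. norm x < \<delta> \<Longrightarrow> (A + x \<in> E \<longleftrightarrow> x \<bullet> m = 0)"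
  shows "regular A m \<or> regular A (- m)"
proof -
  define H where "H s = (\<lambda>x. A + x) ` {x. norm x < \<delta> \<and> s * (x \<bullet> m) > 0}" for s :: real
  have col: "H s \<subseteq> Bo \<or> H s \<subseteq> Wo" for s
  proof (rule connected_one_color)
    have "{x. norm x < \<delta> \<and> s * (x \<bullet> m) > 0} = ball 0 \<delta> \<inter> {x. (s *\<^sub>R m) \<bullet> x > 0}"
      by (auto simp: inner_commute[of _ m])
    then have "convex {x. norm x < \<delta> \<and> s * (x \<bullet> m) > 0}"
      by (simp only: convex_Int convex_ball convex_halfspace_gt)
    then show "connected (H s)"
      unfolding H_def by (intro connected_continuous_image convex_connected continuous_intros)
    show "H s \<inter> E = {}" using line by (auto simp: H_def)
  qed
  have A: "A \<in> E" using line[of 0] assms(2) by simp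
  have not_both: False if "H 1 \<subseteq> C" "H (-1) \<subseteq> C" "A \<in> closure C'" "open C'" "C \<inter> C' = {}"
    for C C'
  proof -
    obtain y where y: "y \<in> C'" "dist y A < \<delta>"
      using \<open>A \<in> closure C'\<close> assms(2) unfolding closure_approachable by blast
    have "open (C' \<inter> ball A \<delta>)" using that by auto
    then obtain e where e: "e > 0" "cball y e \<subseteq> C' \<inter> ball A \<delta>"
      using y open_contains_cball[of "C' \<inter> ball A \<delta>"]
      by (metis IntI dist_commute mem_ball)
    \<comment> \<open>\<open>y\<close> may have \<open>(y - A) \<bullet> m = 0\<close>; pushing it
      by \<open>e\<close> away from the line, within the open set, puts it into one of the two half
      discs.\<close>
    define s where "s = (if (y - A) \<bullet> m \<ge> 0 then e else - e)"
    define z where "z = y + s *\<^sub>R m"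
    have "z \<in> cball y e" using assms(1) e by (auto simp: z_def s_def dist_norm)
    then have z: "z \<in> C'" "norm (z - A) < \<delta>" using e by (auto simp: dist_norm norm_minus_commute)
    have "m \<bullet> m = 1" using assms(1) by (simp add: dot_square_norm)
    then have "(z - A) \<bullet> m = (y - A) \<bullet> m + s"
      by (simp add: z_def algebra_simps inner_add_left inner_diff_left)
    then have "(z - A) \<bullet> m \<noteq> 0" using e by (auto simp: s_def)
    moreover have "z \<in> H s" if "s * ((z - A) \<bullet> m) > 0" for s
      unfolding H_def using that z by (intro image_eqI[of _ _ "z - A"]) auto
    ultimately have "z \<in> H 1 \<or> z \<in> H (-1)"
      by (metis linorder_neqE_linordered_idom mult_1 mult_minus1 neg_0_less_iff_less)
    then show False using that z by auto
  qed
  have "(H 1 \<subseteq> Bo \<and> H (-1) \<subseteq> Wo) \<or> (H 1 \<subseteq> Wo \<and> H (-1) \<subseteq> Bo)"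
    using col[of 1] col[of "-1"] not_both[of Bo Wo] not_both[of Wo Bo] A E_Bo E_Wo open_Bo open_Wo disj
    by blast
  then show ?thesis
  proof
    assume *: "H 1 \<subseteq> Bo \<and> H (-1) \<subseteq> Wo"
    have "regular A m" unfolding regular_def
      using assms * by (auto simp: H_def intro!: exI[of _ \<delta>])
    then show ?thesis ..
  next
    assume *: "H 1 \<subseteq> Wo \<and> H (-1) \<subseteq> Bo"
    have "regular A (-m)" unfolding regular_def
      using assms * by (auto simp: H_def intro!: exI[of _ \<delta>])
    then show ?thesis ..
  qed
qed

text \<open>The other rays at \<open>P\<close> form a closed set that misses
  \<open>P + of_real t * d\<close>, so near this point \<open>E\<close> is a straight line and
  \<open>regular_if_line\<close> applies.\<close>

lemma regular_ray:
  assumes "P \<in> E" "d \<in> ray_dirs P"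
  shows "\<exists>\<delta>>0. \<forall>t. 0 < t \<and> t < \<delta> \<longrightarrow> (\<exists>m. regular (P + of_real t * d) m \<and> d \<bullet> m = 0)"
proof -
  obtain \<delta> where \<delta>: "\<delta> > 0" and E: "\<And>x. norm x < \<delta> \<Longrightarrow> (P + x \<in> E \<longleftrightarrow> (\<exists>d\<in>ray_dirs P. \<exists>t\<ge>0. x = of_real t * d))"
    using ray_dirs_star(3)[OF assms(1)] by blast
  have nd: "norm d = 1" using assms ray_dirs_norm by auto
  have dd: "d \<bullet> d = 1" using nd by (simp add: dot_square_norm)
  define m where "m = \<i> * d"
  have m: "norm m = 1" "d \<bullet> m = 0" using nd by (auto simp: m_def norm_mult inner_complex_def)
  have "\<exists>m. regular (P + of_real t * d) m \<and> d \<bullet> m = 0" if t: "0 < t" "t < \<delta>" for t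
  proof -
    define R where "R = (\<Union>d'\<in>ray_dirs P - {d}. {z. \<exists>t\<ge>0. z = of_real t * d'})"
    have "closed R" unfolding R_def
      using ray_dirs_star(1)[OF assms(1)] closed_unit_ray ray_dirs_norm by (intro closed_UN) auto
    moreover have "of_real t * d \<notin> R"
      unfolding R_def using unit_ray_unique[OF nd _ _ t(1)] ray_dirs_norm by fastforce
    ultimately obtain e where e: "e > 0" "ball (of_real t * d) e \<inter> R = {}"
      by (metis Compl_iff disjoint_eq_subset_Compl openE open_Compl)
    \<comment> \<open>\<open>e\<close> keeps clear of the other rays, \<open>t\<close> prevents
      reaching back beyond \<open>P\<close>, and \<open>\<delta> - t\<close> stays inside the star
      of \<open>P\<close>.\<close>
    define \<delta>' where "\<delta>' = min e (min t (\<delta> - t))"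
    have line: "P + of_real t * d + x \<in> E \<longleftrightarrow> x \<bullet> m = 0" if x: "norm x < \<delta>'" for x
    proof -
      have n: "norm (of_real t * d + x) < \<delta>"
        using x t nd norm_triangle_ineq[of "of_real t * d" x] by (simp add: \<delta>'_def norm_mult)
      have "of_real t * d + x \<in> ball (of_real t * d) e" using x by (simp add: \<delta>'_def dist_norm)
      then have notR: "of_real t * d + x \<notin> R" using e by auto
      show ?thesis
      proof
        assume "P + of_real t * d + x \<in> E"
        then obtain d' s where d': "d' \<in> ray_dirs P" "s \<ge> 0" "of_real t * d + x = of_real s * d'"
          using E[OF n] by (auto simp: add.assoc)
        then have "d' = d" using notR by (auto simp: R_def)
        then have "x = of_real (s - t) * d" using d' by (simp add: algebra_simps)
        then have "x = (s - t) *\<^sub>R d" by (simp add: scaleR_conv_of_real)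
        then show "x \<bullet> m = 0" using m by simp
      next
        assume "x \<bullet> m = 0"
        define s where "s = x \<bullet> d"
        have a: "(Re d)\<^sup>2 + (Im d)\<^sup>2 = 1" using nd by (metis cmod_power2 one_power2)
        have b: "Im x * Re d = Re x * Im d" using \<open>x \<bullet> m = 0\<close> by (simp add: m_def inner_complex_def)
        have "Re x * ((Re d)\<^sup>2 + (Im d)\<^sup>2) = s * Re d"
          unfolding s_def inner_complex_def using b by algebra
        moreover have "Im x * ((Re d)\<^sup>2 + (Im d)\<^sup>2) = s * Im d"
          unfolding s_def inner_complex_def using b by algebra
        ultimately have xs: "x = of_real s * d"
          unfolding a by (simp add: complex_eq_iff)
        then have "\<bar>s\<bar> < t" using x nd by (simp add: \<delta>'_def norm_mult)
        then have "s + t \<ge> 0" by auto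
        moreover have "of_real t * d + x = of_real (s + t) * d" by (simp add: xs algebra_simps)
        ultimately show "P + of_real t * d + x \<in> E" using E[OF n] assms(2) by (metis add.assoc)
      qed
    qed
    have "\<delta>' > 0" using t e by (simp add: \<delta>'_def)
    from regular_if_line[OF m(1) this line] show ?thesis using m(2)
      by (metis inner_minus_right neg_equal_0_iff_equal)
  qed
  then show ?thesis using \<delta> by blast
qed

end

section \<open>Chords and arcs of circles\<close>

lemma chord_eq:
  fixes v z :: complex
  shows "norm (v + z) = norm v \<longleftrightarrow> 2 * (v \<bullet> z) + z \<bullet> z = 0"
proof -
  have "norm (v + z) = norm v \<longleftrightarrow> (v + z) \<bullet> (v + z) = v \<bullet> v"
    by (simp add: norm_eq_sqrt_inner)
  then show ?thesis by (simp add: inner_add_left inner_add_right inner_commute algebra_simps)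
qed

text \<open>A secant meets a circle in two points: the parameter \<open>\<mu>\<close> solves a
  quadratic equation with roots 0 and 1.\<close>

lemma chord_scale:
  fixes v z :: complex
  assumes "norm (v + z) = norm v" "norm (v + of_real \<mu> * z) = norm v" "z \<noteq> 0"
  shows "\<mu> = 0 \<or> \<mu> = 1"
proof -
  have 1: "2 * (v \<bullet> z) = - (z \<bullet> z)" using assms(1) chord_eq by smt
  have "2 * (v \<bullet> (\<mu> *\<^sub>R z)) + (\<mu> *\<^sub>R z) \<bullet> (\<mu> *\<^sub>R z) = 0"
    using assms(2) chord_eq[of v "\<mu> *\<^sub>R z"] by (simp add: scaleR_conv_of_real)
  then have "\<mu> * (2 * (v \<bullet> z)) + \<mu> * (\<mu> * (z \<bullet> z)) = 0" by simp
  then have "\<mu> * (\<mu> - 1) * (z \<bullet> z) = 0" unfolding 1 by (simp add: algebra_simps)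
  then show ?thesis using assms(3) by simp
qed

lemma circle_near:
  fixes v :: complex
  assumes "\<epsilon> > 0"
  shows "\<exists>\<phi>0>0. \<phi>0 < pi \<and> (\<forall>\<phi>. \<bar>\<phi>\<bar> < \<phi>0 \<longrightarrow> dist (v * cis \<phi>) v < \<epsilon>)"
proof -
  have "((\<lambda>\<phi>. v * cis \<phi>) \<longlongrightarrow> v * cis 0) (at 0)"
    by (intro tendsto_intros)
  then have "\<forall>\<^sub>F \<phi> in at 0. dist (v * cis \<phi>) v < \<epsilon>" using assms tendstoD by fastforce
  then obtain d where d: "d > 0" "\<And>\<phi>. \<phi> \<noteq> 0 \<Longrightarrow> dist \<phi> 0 < d \<Longrightarrow> dist (v * cis \<phi>) v < \<epsilon>"
    unfolding eventually_at by auto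
  have "dist (v * cis \<phi>) v < \<epsilon>" if "\<bar>\<phi>\<bar> < d" for \<phi> :: real
    using d(2)[of \<phi>] that assms by (cases "\<phi> = 0") auto
  moreover have "min d (pi/2) > 0" "min d (pi/2) < pi" using d(1) pi_gt_zero
    by (simp, linarith)
  ultimately show ?thesis by (intro exI[of _ "min d (pi/2)"]) auto
qed

lemma unit_perp:
  fixes d d' m :: complex
  assumes "norm d = 1" "norm d' = 1" "norm m = 1" "d \<bullet> m = 0" "d' \<bullet> m = 0"
  shows "d' = d \<or> d' = - d"
proof -
  have *: "x = \<i> * m \<or> x = - \<i> * m" if "norm x = 1" "x \<bullet> m = 0" for x :: complex
  proof -
    define s where "s = Re m * Im x - Im m * Re x"
    have m: "(Re m)\<^sup>2 + (Im m)\<^sup>2 = 1" using assms(3) by (metis cmod_power2 one_power2)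
    have x: "Re x * Re m + Im x * Im m = 0" using that(2) by (simp add: inner_complex_def)
    have "Re x * ((Re m)\<^sup>2 + (Im m)\<^sup>2) = - s * Im m" unfolding s_def using x by algebra
    moreover have "Im x * ((Re m)\<^sup>2 + (Im m)\<^sup>2) = s * Re m" unfolding s_def using x by algebra
    ultimately have xs: "x = of_real s * (\<i> * m)" unfolding m by (simp add: complex_eq_iff)
    then have "norm x = \<bar>s\<bar>" using assms(3) by (simp add: norm_mult)
    then have "s = 1 \<or> s = - 1" using that(1) by auto
    then show ?thesis using xs by auto
  qed
  show ?thesis using *[OF assms(1,4)] *[OF assms(2,5)] by auto
qed

context plane_coloring
begin

lemma star_reg:
  assumes "P \<in> E"
  shows "\<exists>\<delta>>0. (\<forall>x. norm x < \<delta> \<longrightarrow> P + x \<in> E \<longrightarrow> x = 0 \<or> (\<exists>d\<in>ray_dirs P. \<exists>t>0. x = of_real t * d)) \<and>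
     (\<forall>d\<in>ray_dirs P. \<forall>t. 0 < t \<and> t < \<delta> \<longrightarrow> (\<exists>m. regular (P + of_real t * d) m \<and> d \<bullet> m = 0))"
proof -
  have "\<forall>d\<in>ray_dirs P. \<exists>\<delta>>0. \<forall>t. 0 < t \<and> t < \<delta> \<longrightarrow> (\<exists>m. regular (P + of_real t * d) m \<and> d \<bullet> m = 0)"
    using regular_ray[OF assms] by blast
  then obtain f where f: "\<And>d. d \<in> ray_dirs P \<Longrightarrow> f d > 0"
    "\<And>d t. d \<in> ray_dirs P \<Longrightarrow> 0 < t \<Longrightarrow> t < f d \<Longrightarrow> \<exists>m. regular (P + of_real t * d) m \<and> d \<bullet> m = 0"
    by metis
  obtain \<delta> where \<delta>: "\<delta> > 0" and E: "\<And>x. norm x < \<delta> \<Longrightarrow> (P + x \<in> E \<longleftrightarrow> (\<exists>d\<in>ray_dirs P. \<exists>t\<ge>0. x = of_real t * d))"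
    using ray_dirs_star(3)[OF assms] by blast
  define \<epsilon> where "\<epsilon> = Min (insert \<delta> (f ` ray_dirs P))"
  have fin: "finite (insert \<delta> (f ` ray_dirs P))" using ray_dirs_star(1)[OF assms] by simp
  have "\<epsilon> > 0" unfolding \<epsilon>_def using fin f(1) \<delta> by (subst Min_gr_iff) auto
  have "\<epsilon> \<le> \<delta>" "\<And>d. d \<in> ray_dirs P \<Longrightarrow> \<epsilon> \<le> f d" unfolding \<epsilon>_def using fin by (auto intro: Min_le)
  show ?thesis
  proof (intro exI[of _ \<epsilon>] conjI allI impI ballI)
    fix x assume x: "norm x < \<epsilon>" "P + x \<in> E"
    then obtain d t where "d \<in> ray_dirs P" "t \<ge> 0" "x = of_real t * d" using E \<open>\<epsilon> \<le> \<delta>\<close> by fastforce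
    then show "x = 0 \<or> (\<exists>d\<in>ray_dirs P. \<exists>t>0. x = of_real t * d)"
      by (cases "t = 0") (auto intro!: bexI[of _ d] exI[of _ t])
  next
    fix d t assume "d \<in> ray_dirs P" "0 < t \<and> t < \<epsilon>"
    then show "\<exists>m. regular (P + of_real t * d) m \<and> d \<bullet> m = 0"
      using f(2) \<open>\<And>d. d \<in> ray_dirs P \<Longrightarrow> \<epsilon> \<le> f d\<close> by fastforce
  qed fact
qed

text \<open>A linear map that sends three points of a circle to points of one line is singular; near
  \<open>C\<close> the boundary has only finitely many rays, so one of them is hit often enough.\<close>

lemma singular_if_circle_in_E:
  fixes L :: "complex \<Rightarrow> complex" and v :: complex
  assumes L: "linear L" and "v \<noteq> 0" "\<delta> > 0"
    and circ: "\<And>z. norm z < \<delta> \<Longrightarrow> norm (v + z) = norm v \<Longrightarrow> C + L z \<in> E"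
  shows "\<exists>y. y \<noteq> 0 \<and> L y = 0"
proof -
  have L0: "L 0 = 0" using L by (rule linear_0)
  have "C \<in> E" using circ[of 0] assms(3) L0 by simp
  obtain \<eta> where \<eta>: "\<eta> > 0" and E: "\<And>x. norm x < \<eta> \<Longrightarrow> (C + x \<in> E \<longleftrightarrow> (\<exists>d\<in>ray_dirs C. \<exists>t\<ge>0. x = of_real t * d))"
    using ray_dirs_star(3)[OF \<open>C \<in> E\<close>] by blast
  obtain K where K: "K > 0" "\<And>x. norm (L x) \<le> norm x * K"
    using L linear_conv_bounded_linear bounded_linear.pos_bounded by blast
  define \<epsilon> where "\<epsilon> = min \<delta> (\<eta> / K)"
  have "\<epsilon> > 0" using assms \<eta> K by (simp add: \<epsilon>_def)
  then obtain \<phi>0 where \<phi>0: "\<phi>0 > 0" "\<phi>0 < pi" "\<And>\<phi>. \<bar>\<phi>\<bar> < \<phi>0 \<Longrightarrow> dist (v * cis \<phi>) v < \<epsilon>"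
    using circle_near by blast
  define Z where "Z = (\<lambda>\<phi>. v * cis \<phi> - v) ` {0<..<\<phi>0}"
  have inj: "inj_on (\<lambda>\<phi>. v * cis \<phi> - v) {0<..<\<phi>0}"
  proof (rule inj_onI)
    fix x y assume xy: "x \<in> {0<..<\<phi>0}" "y \<in> {0<..<\<phi>0}" "v * cis x - v = v * cis y - v"
    then have "cis x = cis y" using assms(2) by simp
    then have "cos x = cos y" by (simp add: complex_eq_iff)
    moreover have "0 \<le> x" "x \<le> pi" "0 \<le> y" "y \<le> pi" using xy \<phi>0(2) by auto
    ultimately show "x = y" using cos_inj_pi by blast
  qed
  have "infinite Z" unfolding Z_def by (simp only: finite_image_iff[OF inj] infinite_Ioo[OF \<phi>0(1)] not_False_eq_True)
  have Z: "z \<noteq> 0 \<and> norm z < \<epsilon> \<and> norm (v + z) = norm v" if zZ: "z \<in> Z" for z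
  proof -
    obtain \<phi> where \<phi>: "0 < \<phi>" "\<phi> < \<phi>0" "z = v * cis \<phi> - v"
      using zZ unfolding Z_def image_iff by (metis greaterThanLessThan_iff)
    have "cos \<phi> \<noteq> 1" using \<phi> \<phi>0 cos_inj_pi[of \<phi> 0] by auto
    then have "cis \<phi> \<noteq> 1" by (auto simp: complex_eq_iff)
    then show ?thesis using \<phi> \<phi>0(3)[of \<phi>] assms(2) by (simp add: dist_norm norm_mult)
  qed
  have "\<exists>d t. d \<in> ray_dirs C \<and> t \<ge> 0 \<and> L z = of_real t * d" if "z \<in> Z" for z
  proof -
    have "norm (L z) < \<eta>"
    proof -
      have "norm z < \<eta> / K" using Z[OF that] by (simp add: \<epsilon>_def)
      then have "norm z * K < \<eta>" using K by (simp add: field_simps)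
      then show ?thesis using K(2)[of z] by linarith
    qed
    moreover have "C + L z \<in> E" using circ Z[OF that] by (simp add: \<epsilon>_def)
    ultimately show ?thesis using E by blast
  qed
  then obtain f t where ft: "\<And>z. z \<in> Z \<Longrightarrow> f z \<in> ray_dirs C" "\<And>z. z \<in> Z \<Longrightarrow> t z \<ge> 0"
    "\<And>z. z \<in> Z \<Longrightarrow> L z = of_real (t z) * f z" by metis
  have "finite (f ` Z)"
    by (rule finite_subset[OF _ ray_dirs_star(1)[OF \<open>C \<in> E\<close>]]) (use ft(1) in auto)
  \<comment> \<open>Infinitely many points of the arc are sent to one of the finitely many rays. Two
    of them suffice, because \<open>L 0 = 0\<close> is the origin of that ray.\<close>
  then obtain z0 where inf: "infinite {z\<in>Z. f z = f z0}"
    using pigeonhole_infinite[OF \<open>infinite Z\<close>] by blast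
  then obtain z2 where z2: "z2 \<in> {z\<in>Z. f z = f z0}" using infinite_imp_nonempty by blast
  have "infinite ({z\<in>Z. f z = f z0} - {z2})" using inf by simp
  then obtain z3 where z3: "z3 \<in> {z\<in>Z. f z = f z0} - {z2}" using infinite_imp_nonempty by blast
  have z: "z2 \<in> Z" "z3 \<in> Z" "z2 \<noteq> z3" "f z2 = f z3" using z2 z3 by auto
  show ?thesis
  proof (cases "L z2 = 0")
    case True
    then show ?thesis using Z z by blast
  next
    case False
    then have t2: "t z2 \<noteq> 0" using ft(3)[OF z(1)] by auto
    define \<mu> where "\<mu> = t z3 / t z2"
    have "L z3 = \<mu> *\<^sub>R L z2"
      using t2 z by (simp add: ft(3) \<mu>_def scaleR_conv_of_real)
    then have "L (z3 - \<mu> *\<^sub>R z2) = 0" using L by (simp add: linear_diff linear_scale)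
    \<comment> \<open>Otherwise \<open>v\<close>, \<open>v + z2\<close> and \<open>v + z3\<close>
      would be three distinct collinear points of one circle.\<close>
    moreover have "z3 - \<mu> *\<^sub>R z2 \<noteq> 0"
    proof
      assume "z3 - \<mu> *\<^sub>R z2 = 0"
      then have z3: "z3 = of_real \<mu> * z2" by (simp add: scaleR_conv_of_real)
      then have "\<mu> = 0 \<or> \<mu> = 1" using Z z chord_scale[of v z2 \<mu>] by metis
      then show False using z3 Z[OF z(2)] z(3) by auto
    qed
    ultimately show ?thesis by blast
  qed
qed

end

section \<open>Colourings without monochromatic equilateral triangles of side
  \<open>r\<close>\<close>

locale plane_coloring_radius = plane_coloring +
  fixes r :: real
  assumes r_pos: "r > 0"
    and no_Bo: "\<And>p u. norm u = r \<Longrightarrow> \<not> (p \<in> Bo \<and> p + u \<in> Bo \<and> p + omega * u \<in> Bo)"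
    and no_Wo: "\<And>p u. norm u = r \<Longrightarrow> \<not> (p \<in> Wo \<and> p + u \<in> Wo \<and> p + omega * u \<in> Wo)"
begin

lemma no_triangle:
  assumes "norm (Q - P) = r" "R = P + omega * (Q - P)"
  shows "\<not> (P \<in> Bo \<and> Q \<in> Bo \<and> R \<in> Bo)" "\<not> (P \<in> Wo \<and> Q \<in> Wo \<and> R \<in> Wo)"
  using no_Bo[OF assms(1), of P] no_Wo[OF assms(1), of P] assms(2) by auto

text \<open>Off the boundary the third vertex would keep its colour while the whole triangle is
  translated towards the black (or the white) side of both segments.\<close>

lemma common_translate:
  assumes "regular A m1" "regular B m2" "m1 + m2 \<noteq> 0" "C \<notin> E"
  shows "\<exists>x. (A + x \<in> Bo \<and> B + x \<in> Bo \<and> C + x \<in> Bo) \<or> (A + x \<in> Wo \<and> B + x \<in> Wo \<and> C + x \<in> Wo)"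
proof -
  obtain \<delta>1 where \<delta>1: "\<delta>1 > 0" "norm m1 = 1" and R1: "\<And>x. norm x < \<delta>1 \<Longrightarrow>
     (x \<bullet> m1 > 0 \<longrightarrow> A + x \<in> Bo) \<and> (x \<bullet> m1 < 0 \<longrightarrow> A + x \<in> Wo) \<and> (x \<bullet> m1 = 0 \<longrightarrow> A + x \<in> E)"
    using assms(1) unfolding regular_def by auto
  obtain \<delta>2 where \<delta>2: "\<delta>2 > 0" "norm m2 = 1" and R2: "\<And>x. norm x < \<delta>2 \<Longrightarrow>
     (x \<bullet> m2 > 0 \<longrightarrow> B + x \<in> Bo) \<and> (x \<bullet> m2 < 0 \<longrightarrow> B + x \<in> Wo) \<and> (x \<bullet> m2 = 0 \<longrightarrow> B + x \<in> E)"
    using assms(2) unfolding regular_def by auto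
  obtain X where X: "X = Bo \<or> X = Wo" "C \<in> X" using assms(4) E_eq by auto
  then obtain \<delta>3 where \<delta>3: "\<delta>3 > 0" "ball C \<delta>3 \<subseteq> X" using open_Bo open_Wo openE by metis
  \<comment> \<open>The bisector of two unit normals has positive inner product with both, unless
    they are opposite. Moving along it makes \<open>A\<close> and \<open>B\<close> black, moving
    against it makes them white; the colour of \<open>C\<close> selects the sense.\<close>
  define m where "m = m1 + m2"
  have pos: "m \<bullet> m1 > 0" "m \<bullet> m2 > 0"
  proof -
    have "m1 \<bullet> m1 = 1" "m2 \<bullet> m2 = 1" using \<delta>1 \<delta>2 by (simp_all add: dot_square_norm)
    then have "m \<bullet> m = 2 * (m \<bullet> m1)" "m \<bullet> m = 2 * (m \<bullet> m2)"
      by (simp_all add: m_def inner_add_left inner_add_right inner_commute)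
    moreover have "m \<bullet> m > 0" using assms(3) by (simp add: m_def)
    ultimately show "m \<bullet> m1 > 0" "m \<bullet> m2 > 0" by linarith+
  qed
  define s where "s = min \<delta>1 (min \<delta>2 \<delta>3) / (2 * norm m)"
  have "norm m > 0" using assms(3) by (simp add: m_def)
  then have s: "s > 0" "s * norm m < \<delta>1" "s * norm m < \<delta>2" "s * norm m < \<delta>3"
    using \<delta>1 \<delta>2 \<delta>3 by (auto simp: s_def)
  define x where "x = s *\<^sub>R m"
  have n: "norm x = s * norm m" using s by (simp add: x_def)
  have p: "x \<bullet> m1 > 0" "x \<bullet> m2 > 0" using pos s by (auto simp: x_def)
  have "C + x \<in> X" "C - x \<in> X" using \<delta>3 s n by (auto simp: dist_norm)
  then show ?thesis
    using R1[of x] R2[of x] R1[of "- x"] R2[of "- x"] n p s X(1)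
    by (metis add.commute diff_conv_add_uminus inner_minus_left neg_less_0_iff_less norm_minus_cancel uminus_add_conv_diff)
qed

lemma third_point:
  assumes "regular A m1" "regular B m2" "norm (B - A) = r" "m1 + m2 \<noteq> 0"
  shows "A + omega * (B - A) \<in> E" "A + cnj omega * (B - A) \<in> E"
proof -
  show "A + omega * (B - A) \<in> E"
  proof (rule ccontr)
    assume "A + omega * (B - A) \<notin> E"
    from common_translate[OF assms(1,2,4) this] obtain x where
      x: "(A + x \<in> Bo \<and> B + x \<in> Bo \<and> A + omega * (B - A) + x \<in> Bo) \<or> (A + x \<in> Wo \<and> B + x \<in> Wo \<and> A + omega * (B - A) + x \<in> Wo)"
      by blast
    show False
      using no_triangle[of "B + x" "A + x" "A + omega * (B - A) + x"] assms(3) x by (auto simp: algebra_simps)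
  qed
  show "A + cnj omega * (B - A) \<in> E"
  proof (rule ccontr)
    assume "A + cnj omega * (B - A) \<notin> E"
    from common_translate[OF assms(1,2,4) this] obtain x where
      x: "(A + x \<in> Bo \<and> B + x \<in> Bo \<and> A + cnj omega * (B - A) + x \<in> Bo) \<or> (A + x \<in> Wo \<and> B + x \<in> Wo \<and> A + cnj omega * (B - A) + x \<in> Wo)"
      by blast
    \<comment> \<open>For the other orientation \<open>B\<close> arises from the third vertex by the
      rotation \<open>omega\<close> about \<open>A\<close>, so the forbidden triangle is used with
      two vertices exchanged.\<close>
    have "B + x = A + x + omega * (A + cnj omega * (B - A) + x - (A + x))"
      using omega_cnj(1) by (simp add: algebra_simps)
    moreover have "norm (A + cnj omega * (B - A) + x - (A + x)) = r"
      using assms(3) by (simp add: norm_mult)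
    ultimately show False
      using no_triangle[of "A + cnj omega * (B - A) + x" "A + x" "B + x"] x by blast
  qed
qed

text \<open>If the two segments were not parallel, the third vertex would move along a straight line
  while the first two slide along their segments. For both orientations of the triangle this forces
  the segments to meet at angle \<open>\<pi>/3\<close> and at angle \<open>2\<pi>/3\<close>.\<close>

lemma parallel:
  assumes "regular A m1" "regular B m2" "norm (B - A) = r"
  shows "m1 = m2 \<or> m1 = - m2"
proof -
  have n: "norm m1 = 1" "norm m2 = 1" using assms by (auto simp: regular_def)
  define d1 where "d1 = \<i> * m1"
  define \<kappa> where "\<kappa> = d1 \<bullet> m2"
  have nd: "norm d1 = 1" "d1 \<bullet> m1 = 0" using n by (auto simp: d1_def norm_mult inner_complex_def)
  define v where "v = B - A"
  have "v \<noteq> 0" using assms(3) r_pos by (auto simp: v_def)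
  have "\<kappa> = 0"
  proof (rule ccontr)
    assume k: "\<kappa> \<noteq> 0"
    then have "m1 + m2 \<noteq> 0" using nd unfolding \<kappa>_def
      by (metis add.commute add_eq_0_iff inner_minus_right neg_equal_0_iff_equal)
    \<comment> \<open>When the side vector changes from \<open>v\<close> to \<open>v + z\<close>,
      the point \<open>A\<close> has to slide by \<open>\<alpha> z\<close> along \<open>d1\<close>
      for \<open>B\<close> to stay on its own line:
      \<open>(\<alpha> z *\<^sub>R d1 + z) \<bullet> m2 = 0\<close>. As \<open>\<alpha>\<close> is
      linear, so is the displacement of the third vertex.\<close>
    define \<alpha> where "\<alpha> z = - (z \<bullet> m2) / \<kappa>" for z :: complex
    have "\<alpha> (x + y) = \<alpha> x + \<alpha> y" "\<alpha> (c *\<^sub>R x) = c * \<alpha> x" for x y c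
      by (simp_all add: \<alpha>_def inner_add_left add_divide_distrib diff_divide_distrib)
    then have \<alpha>lin: "linear (\<lambda>z. of_real (\<alpha> z) * d1)"
      by (intro linearI) (simp_all add: algebra_simps scaleR_conv_of_real)
    obtain \<delta>1 where \<delta>1: "\<delta>1 > 0" "\<And>x. norm x < \<delta>1 \<Longrightarrow> x \<bullet> m1 = 0 \<Longrightarrow> regular (A + x) m1"
      using regular_slide[OF assms(1)] by blast
    obtain \<delta>2 where \<delta>2: "\<delta>2 > 0" "\<And>x. norm x < \<delta>2 \<Longrightarrow> x \<bullet> m2 = 0 \<Longrightarrow> regular (B + x) m2"
      using regular_slide[OF assms(2)] by blast
    define K where "K = 1 / \<bar>\<kappa>\<bar> + 1"
    have "K > 0" unfolding K_def by (intro add_nonneg_pos) auto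
    have \<alpha>b: "\<bar>\<alpha> z\<bar> + norm z \<le> norm z * K" for z
    proof -
      have "\<bar>z \<bullet> m2\<bar> \<le> norm z" using Cauchy_Schwarz_ineq2[of z m2] n by simp
      then have "\<bar>\<alpha> z\<bar> \<le> norm z / \<bar>\<kappa>\<bar>" unfolding \<alpha>_def by (simp add: divide_right_mono)
      then show ?thesis by (simp add: K_def algebra_simps)
    qed
    define \<delta> where "\<delta> = min \<delta>1 \<delta>2 / K"
    have "\<delta> > 0" using \<delta>1 \<delta>2 \<open>K > 0\<close> by (simp add: \<delta>_def)
    have third: "A + omega * v + (of_real (\<alpha> z) * d1 + omega * z) \<in> E \<and>
        A + cnj omega * v + (of_real (\<alpha> z) * d1 + cnj omega * z) \<in> E"
      if z: "norm z < \<delta>" "norm (v + z) = norm v" for z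
    proof -
      have "norm z * K < min \<delta>1 \<delta>2" using z \<open>K > 0\<close> by (simp add: \<delta>_def field_simps)
      with \<alpha>b[of z] have s: "\<bar>\<alpha> z\<bar> + norm z < \<delta>1" "\<bar>\<alpha> z\<bar> + norm z < \<delta>2" by linarith+
      define x where "x = of_real (\<alpha> z) * d1"
      have nx: "norm x = \<bar>\<alpha> z\<bar>" using nd by (simp add: x_def norm_mult)
      have x': "x = \<alpha> z *\<^sub>R d1" by (simp add: x_def scaleR_conv_of_real)
      have "regular (A + x) m1"
      proof (rule \<delta>1(2))
        show "norm x < \<delta>1" using s(1) nx norm_ge_zero[of z] by linarith
        show "x \<bullet> m1 = 0" using nd x' by simp
      qed
      moreover have "regular (B + (x + z)) m2"
      proof (rule \<delta>2(2))
        show "norm (x + z) < \<delta>2" using norm_triangle_ineq[of x z] nx s by linarith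
        show "(x + z) \<bullet> m2 = 0" unfolding x' using k by (simp add: inner_add_left inner_diff_left \<alpha>_def \<kappa>_def)
      qed
      moreover have *: "B + (x + z) - (A + x) = v + z" by (simp add: v_def)
      moreover have "norm (v + z) = r" using z assms(3) by (simp add: v_def)
      ultimately have "A + x + omega * (v + z) \<in> E" "A + x + cnj omega * (v + z) \<in> E"
        using third_point[of "A + x" m1 "B + (x + z)" m2] \<open>m1 + m2 \<noteq> 0\<close> by metis+
      then show ?thesis by (simp add: x_def algebra_simps)
    qed
    \<comment> \<open>A kernel vector \<open>y\<close> is a multiple of \<open>c * d1\<close>, and
      the definition of \<open>\<alpha>\<close> then gives
      \<open>(c * d1) \<bullet> m2 = \<kappa>\<close>. Since \<open>c + cnj c = 1\<close>, nothing
      is left for \<open>cnj c * d1\<close>. With \<open>c\<close> equal to \<open>omega\<close> and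
      to \<open>cnj omega\<close>, both parts of \<open>d1\<close> become orthogonal to
      \<open>m2\<close>.\<close>
    have sing: "(cnj c * d1) \<bullet> m2 = 0"
      if c: "c * cnj c = 1" "c + cnj c = 1" "\<And>z. norm z < \<delta> \<Longrightarrow> norm (v + z) = norm v \<Longrightarrow> A + cnj c * v + (of_real (\<alpha> z) * d1 + cnj c * z) \<in> E" for c
    proof -
      have "linear (\<lambda>z. of_real (\<alpha> z) * d1 + cnj c * z)"
        by (intro linear_compose_add \<alpha>lin) (auto intro!: linearI simp: algebra_simps)
      from singular_if_circle_in_E[OF this \<open>v \<noteq> 0\<close> \<open>\<delta> > 0\<close> c(3)]
      obtain y where y: "y \<noteq> 0" "of_real (\<alpha> y) * d1 + cnj c * y = 0" by blast
      have "c * (of_real (\<alpha> y) * d1 + cnj c * y) = of_real (\<alpha> y) * (c * d1) + (c * cnj c) * y"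
        by (simp add: algebra_simps)
      then have "y = - (\<alpha> y *\<^sub>R (c * d1))" using y c(1) by (simp add: scaleR_conv_of_real add_eq_0_iff2)
      then have "y \<bullet> m2 = - \<alpha> y * ((c * d1) \<bullet> m2)" "\<alpha> y \<noteq> 0" using y(1)
        by (metis inner_minus_left inner_scaleR_left mult_minus_left, auto)
      then have "(c * d1) \<bullet> m2 = \<kappa>" using k by (simp add: \<alpha>_def field_simps)
      moreover have "d1 = c * d1 + cnj c * d1" using c(2) by (metis distrib_right mult_1)
      ultimately show ?thesis by (metis \<kappa>_def add_cancel_right_right inner_add_left)
    qed
    have "(cnj omega * d1) \<bullet> m2 = 0" 
      using third omega_cnj(1) by (intro sing) (auto simp: complex_eq_iff)
    moreover have "(omega * d1) \<bullet> m2 = 0" 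
      using third omega_cnj(1) sing[of "cnj omega"] by (auto simp: complex_eq_iff mult.commute)
    moreover have "d1 = omega * d1 + cnj omega * d1" by (simp add: omega_cnj algebra_simps)
    ultimately have "d1 \<bullet> m2 = 0" by (metis add_0 inner_add_left)
    then show False using k by (simp add: \<kappa>_def)
  qed
  then show ?thesis
    using unit_perp[of m1 m2 d1] n nd by (auto simp: \<kappa>_def inner_commute)
qed

end

section \<open>Colour changes on circles\<close>

context plane_coloring_radius
begin

text \<open>Two boundary rays through \<open>A0\<close> and \<open>A0 + v\<close> can carry other pairs at distance \<open>r\<close> only
  if they are parallel, and then the pair has to move by a translation.\<close>

lemma local_unique:
  assumes "A0 \<in> E" "norm v = r"
  shows "\<exists>\<epsilon>>0. \<forall>A v'. A \<in> E \<and> dist A A0 < \<epsilon> \<and> norm v' = r \<and> dist v' v < \<epsilon> \<and> A + v' \<in> E \<longrightarrow> v' = v"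
proof (cases "A0 + v \<in> E")
  case False
  have "open (- E)" using closed_E by auto
  then obtain e where e: "e > 0" "ball (A0 + v) e \<subseteq> - E" using False by (meson ComplI openE)
  show ?thesis
  proof (intro exI[of _ "e/2"] conjI allI impI)
    fix A v' assume *: "A \<in> E \<and> dist A A0 < e/2 \<and> norm v' = r \<and> dist v' v < e/2 \<and> A + v' \<in> E"
    have "dist (A0 + v) (A + v') \<le> dist A A0 + dist v' v"
      by (metis dist_add_cancel dist_add_cancel2 dist_commute dist_triangle2 add.commute dist_triangle)
    then have "A + v' \<in> ball (A0 + v) e" using * by auto
    then show "v' = v" using e * by auto
  qed (use e in auto)
next
  case True
  define U where "U = A0 + v"
  have "U \<in> E" using True by (simp add: U_def)
  obtain \<delta>0 where \<delta>0: "\<delta>0 > 0"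
    and S0: "\<And>x. norm x < \<delta>0 \<Longrightarrow> A0 + x \<in> E \<Longrightarrow> x = 0 \<or> (\<exists>d\<in>ray_dirs A0. \<exists>t>0. x = of_real t * d)"
    and R0: "\<And>d t. d \<in> ray_dirs A0 \<Longrightarrow> 0 < t \<Longrightarrow> t < \<delta>0 \<Longrightarrow> \<exists>m. regular (A0 + of_real t * d) m \<and> d \<bullet> m = 0"
    using star_reg[OF assms(1)] by blast
  obtain \<delta>1 where \<delta>1: "\<delta>1 > 0"
    and S1: "\<And>x. norm x < \<delta>1 \<Longrightarrow> U + x \<in> E \<Longrightarrow> x = 0 \<or> (\<exists>d\<in>ray_dirs U. \<exists>t>0. x = of_real t * d)"
    and R1: "\<And>d t. d \<in> ray_dirs U \<Longrightarrow> 0 < t \<Longrightarrow> t < \<delta>1 \<Longrightarrow> \<exists>m. regular (U + of_real t * d) m \<and> d \<bullet> m = 0"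
    using star_reg[OF \<open>U \<in> E\<close>] by blast
  define D where "D = ray_dirs A0 \<union> ray_dirs U"
  have finD: "finite D" unfolding D_def using ray_dirs_star(1)[OF assms(1)] ray_dirs_star(1)[OF \<open>U \<in> E\<close>] by simp
  have nD: "norm d = 1" if "d \<in> D" for d using that ray_dirs_norm by (auto simp: D_def)
  \<comment> \<open>A line through \<open>v\<close> in direction \<open>d\<close> meets the circle
    again at distance \<open>2 * \<bar>v \<bullet> d\<bar>\<close>, or is tangent; below these
    thresholds \<open>v\<close> is the only common point. The half of \<open>\<delta>1\<close>
    allows for the displacement at \<open>U\<close>, which combines that of \<open>A\<close> and
    that of \<open>v'\<close>.\<close>
  define shifts where "shifts = {\<delta>0, \<delta>1 / 2} \<union> (\<lambda>d. \<bar>v \<bullet> d\<bar>) ` {d \<in> D. v \<bullet> d \<noteq> 0}"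
  define \<epsilon> where "\<epsilon> = Min shifts"
  have finM: "finite shifts" using finD by (simp add: shifts_def)
  have "\<epsilon> > 0" unfolding \<epsilon>_def using finM \<delta>0 \<delta>1 by (subst Min_gr_iff) (auto simp: shifts_def)
  have le: "\<And>x. x \<in> shifts \<Longrightarrow> \<epsilon> \<le> x" unfolding \<epsilon>_def using finM by (auto intro: Min_le)
  have small: "\<epsilon> \<le> \<delta>0" "2 * \<epsilon> \<le> \<delta>1" "\<And>d. d \<in> D \<Longrightarrow> v \<bullet> d \<noteq> 0 \<Longrightarrow> \<epsilon> \<le> \<bar>v \<bullet> d\<bar>"
    using le[of \<delta>0] le[of "\<delta>1/2"] le by (auto simp: shifts_def)
  have key: "v' = v" if "norm v' = r" "dist v' v < \<epsilon>" "d \<in> D" "v' = v + of_real \<kappa> * d" for v' d \<kappa>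
  proof -
    have k: "\<bar>\<kappa>\<bar> < \<epsilon>" using that nD by (simp add: dist_norm norm_mult)
    have dd: "d \<bullet> d = 1" using nD[OF that(3)] by (simp add: dot_square_norm)
    have "norm (v + \<kappa> *\<^sub>R d) = norm v" using that assms(2) by (simp add: scaleR_conv_of_real)
    then have "\<kappa> * (2 * (v \<bullet> d) + \<kappa>) = 0" using dd unfolding chord_eq by (simp add: algebra_simps)
    then have "\<kappa> = 0 \<or> \<kappa> = - 2 * (v \<bullet> d)" by auto
    moreover have "\<kappa> = 0" if "\<kappa> = - 2 * (v \<bullet> d)"
      using small(3)[OF \<open>d \<in> D\<close>] k that \<open>\<epsilon> > 0\<close> by (cases "v \<bullet> d = 0") auto
    ultimately show ?thesis using that by auto
  qed
  show ?thesis
  proof (intro exI[of _ \<epsilon>] conjI allI impI)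
    fix A v' assume *: "A \<in> E \<and> dist A A0 < \<epsilon> \<and> norm v' = r \<and> dist v' v < \<epsilon> \<and> A + v' \<in> E"
    define x y where "x = A - A0" and "y = A + v' - U"
    have xy: "A = A0 + x" "A + v' = U + y" "v' = v + y - x" by (simp_all add: x_def y_def U_def)
    have nx: "norm x < \<epsilon>" using * by (simp add: x_def dist_norm)
    have "y = x + (v' - v)" by (simp add: x_def y_def U_def)
    then have ny: "norm y < 2 * \<epsilon>" using * nx norm_triangle_ineq[of x "v' - v"] by (simp add: dist_norm)
    have x: "x = 0 \<or> (\<exists>d\<in>ray_dirs A0. \<exists>t>0. x = of_real t * d)" using S0[of x] nx small(1) * xy(1) by auto
    have y: "y = 0 \<or> (\<exists>d\<in>ray_dirs U. \<exists>t>0. y = of_real t * d)" using S1[of y] ny small(2) * xy(2) by auto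
    show "v' = v"
    proof (cases "x = 0")
      case True
      show ?thesis
      proof (cases "y = 0")
        case False
        then obtain d t where "d \<in> ray_dirs U" "y = of_real t * d" using y by blast
        then show ?thesis using key[of v' d t] * xy(3) \<open>x = 0\<close> by (auto simp: D_def)
      qed (use xy True in simp)
    next
      case False
      then obtain d t where d: "d \<in> ray_dirs A0" "t > 0" "x = of_real t * d" using x by blast
      show ?thesis
      proof (cases "y = 0")
        case True
        then show ?thesis using key[of v' d "-t"] * xy(3) d by (auto simp: D_def)
      next
        case False
        then obtain d' t' where d': "d' \<in> ray_dirs U" "t' > 0" "y = of_real t' * d'" using y by blast
        have "t < \<delta>0" "t' < \<delta>1" using nx ny small d d' ray_dirs_norm by (auto simp: norm_mult)
        then obtain m m' where m: "regular A m" "d \<bullet> m = 0" "regular (A + v') m'" "d' \<bullet> m' = 0"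
          using R0[OF d(1,2)] R1[OF d'(1,2)] d(3) d'(3) xy(1,2) by metis
        \<comment> \<open>Both ends lie inside rays here, so \<open>parallel\<close> makes the two
          ray directions equal or opposite, and the change of \<open>v\<close> is again a multiple
          of one direction.\<close>
        have "m = m' \<or> m = - m'" using parallel[OF m(1,3)] * by simp
        then have "d' \<bullet> m = 0" using m(4) by auto
        moreover have "norm m = 1" using m(1) by (simp add: regular_def)
        ultimately have "d' = d \<or> d' = - d" using unit_perp[of d d' m] m(2) d(1) d'(1) ray_dirs_norm by blast
        then have "\<exists>\<kappa>. v' = v + of_real \<kappa> * d"
        proof
          assume "d' = d"
          then show ?thesis using xy(3) d(3) d'(3) by (intro exI[of _ "t' - t"]) (simp add: algebra_simps)
        next
          assume "d' = - d"
          then show ?thesis using xy(3) d(3) d'(3) by (intro exI[of _ "- t' - t"]) (simp add: algebra_simps)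
        qed
        then show ?thesis using key[of v' d] * d(1) by (auto simp: D_def)
      qed
    qed
  qed fact
qed

text \<open>The colour changes on the circle of radius \<open>r\<close> about \<open>A\<close>, as
  opposed to all its intersections with the boundary: a contact with the same colour on both sides
  is left out.\<close>

definition crossings :: "complex \<Rightarrow> complex set" where
  "crossings A = {v. norm v = r \<and> v \<in> closure {u. norm u = r \<and> A + u \<in> Bo} \<and> v \<in> closure {u. norm u = r \<and> A + u \<in> Wo}}"

lemma crossings_norm: "v \<in> crossings A \<Longrightarrow> norm v = r"
  by (simp add: crossings_def)

lemma crossings_nz: "v \<in> crossings A \<Longrightarrow> v \<noteq> 0"
  using crossings_norm r_pos by force

lemma crossings_E: "A + v \<in> E" if "v \<in> crossings A"
proof (rule ccontr)
  assume "A + v \<notin> E"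
  have *: False if C: "A + v \<in> C" "open C" "C \<inter> C' = {}" "v \<in> closure {u. norm u = r \<and> A + u \<in> C'}" for C C'
  proof -
    obtain e where e: "e > 0" "ball (A + v) e \<subseteq> C" using openE[OF C(2,1)] .
    obtain u where "A + u \<in> C'" "dist u v < e" using C(4) e(1) unfolding closure_approachable by blast
    moreover have "dist (A + v) (A + u) = dist u v" by (simp add: dist_commute)
    ultimately have "A + u \<in> C" using e(2) by (metis mem_ball subsetD)
    then show False using C \<open>A + u \<in> C'\<close> by auto
  qed
  show False using *[of Bo Wo] *[of Wo Bo] that \<open>A + v \<notin> E\<close> open_Bo open_Wo disj E_eq by (auto simp: crossings_def)
qed

definition circle_arc :: "complex \<Rightarrow> real \<Rightarrow> real \<Rightarrow> complex set" where
  "circle_arc v s \<phi>0 = (\<lambda>\<phi>. v * cis (s * \<phi>)) ` {0<..<\<phi>0}"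

lemma near_on_circle:
  assumes "norm v = r" "\<phi>0 > 0"
  shows "\<exists>\<epsilon>>0. \<forall>u. norm u = r \<and> dist u v < \<epsilon> \<longrightarrow> u = v \<or> u \<in> circle_arc v 1 \<phi>0 \<or> u \<in> circle_arc v (-1) \<phi>0"
proof -
  have vz: "v \<noteq> 0" using assms r_pos by auto
  have "isCont Arg 1" by (simp add: continuous_at_Arg complex_nonpos_Reals_iff)
  then have "\<exists>d>0. \<forall>z. dist z 1 < d \<longrightarrow> dist (Arg z) (Arg 1) < \<phi>0"
    using assms(2) unfolding continuous_at_eps_delta by blast
  then obtain d where d: "d > 0" "\<And>z. dist z 1 < d \<Longrightarrow> \<bar>Arg z\<bar> < \<phi>0" by (auto simp: dist_real_def)
  show ?thesis
  proof (intro exI[of _ "d * r"] conjI allI impI)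
    fix u assume u: "norm u = r \<and> dist u v < d * r"
    have "u / v - 1 = (u - v) / v" using vz by (simp add: diff_divide_distrib)
    then have "dist (u / v) 1 = dist u v / r" using assms(1) by (simp add: dist_norm norm_divide)
    then have "dist (u / v) 1 < d" using u r_pos by (simp only: pos_divide_less_eq)
    then have a: "\<bar>Arg (u/v)\<bar> < \<phi>0" by (rule d(2))
    have "norm (u / v) = 1" using u assms r_pos by (simp add: norm_divide)
    then have "u / v = cis (Arg (u / v))" using rcis_cmod_Arg[of "u/v"] by (simp add: rcis_def)
    then have uv: "u = v * cis (Arg (u / v))" using vz by (simp add: field_simps)
    consider "Arg (u/v) = 0" | "Arg (u/v) > 0" | "Arg (u/v) < 0" by linarith
    then show "u = v \<or> u \<in> circle_arc v 1 \<phi>0 \<or> u \<in> circle_arc v (-1) \<phi>0"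
    proof cases
      case 1 then show ?thesis using uv by simp
    next
      case 2
      then have "u \<in> circle_arc v 1 \<phi>0" unfolding circle_arc_def using a uv by (intro image_eqI[of _ _ "Arg (u/v)"]) auto
      then show ?thesis by simp
    next
      case 3
      then have "u \<in> circle_arc v (-1) \<phi>0" unfolding circle_arc_def using a uv by (intro image_eqI[of _ _ "- Arg (u/v)"]) auto
      then show ?thesis by simp
    qed
  qed (use d r_pos in simp)
qed

lemma circle_arc_accumulates:
  assumes "\<epsilon> > 0" "\<phi>0 > 0" "norm v = r" "\<bar>s\<bar> = 1"
  shows "\<exists>u \<in> circle_arc v s \<phi>0. dist u v < \<epsilon>"
proof -
  obtain \<phi>1 where p: "\<phi>1 > 0" "\<And>\<phi>. \<bar>\<phi>\<bar> < \<phi>1 \<Longrightarrow> dist (v * cis \<phi>) v < \<epsilon>" using circle_near[OF assms(1), of v] by auto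
  define \<phi> where "\<phi> = min \<phi>0 \<phi>1 / 2"
  have "0 < \<phi>" "\<phi> < \<phi>0" "\<phi> < \<phi>1" using p(1) assms(2) by (auto simp: \<phi>_def)
  moreover have "\<bar>s * \<phi>\<bar> < \<phi>1" using assms(4) \<open>0 < \<phi>\<close> \<open>\<phi> < \<phi>1\<close> by (simp add: abs_mult)
  ultimately show ?thesis using p(2)[of "s * \<phi>"] unfolding circle_arc_def by auto
qed

lemma circle_arc_norm: "norm v = r \<Longrightarrow> u \<in> circle_arc v s \<phi>0 \<Longrightarrow> norm u = r"
  by (auto simp: circle_arc_def norm_mult)

lemma connected_circle_arc: "connected (circle_arc v s \<phi>0)"
  unfolding circle_arc_def by (intro connected_continuous_image continuous_intros) auto

text \<open>Rays cut by a ball about their common origin stay starlike. This provides arbitrarily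
  small connected neighbourhoods in \<open>E\<close>, along which colours propagate.\<close>

lemma star_near_connected:
  assumes "P \<in> E"
  shows "\<exists>\<delta>>0. \<forall>\<epsilon>>0. \<epsilon> \<le> \<delta> \<longrightarrow> starlike (E \<inter> ball P \<epsilon>)"
proof -
  obtain \<delta> where \<delta>: "\<delta> > 0" and E: "\<And>x. norm x < \<delta> \<Longrightarrow> (P + x \<in> E \<longleftrightarrow> (\<exists>d\<in>ray_dirs P. \<exists>t\<ge>0. x = of_real t * d))"
    using ray_dirs_star(3)[OF assms] by blast
  have "starlike (E \<inter> ball P \<epsilon>)" if \<epsilon>: "\<epsilon> > 0" "\<epsilon> \<le> \<delta>" for \<epsilon>
    unfolding starlike_def
  proof (intro bexI[of _ P] ballI)
    fix x assume x: "x \<in> E \<inter> ball P \<epsilon>"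
    have n: "norm (x - P) < \<epsilon>" using x by (simp add: dist_norm norm_minus_commute)
    have "norm (x - P) < \<delta>" using n \<epsilon>(2) by linarith
    then obtain d t where d: "d \<in> ray_dirs P" "t \<ge> 0" "x - P = of_real t * d" using E[of "x - P"] x by auto
    show "closed_segment P x \<subseteq> E \<inter> ball P \<epsilon>"
    proof
      fix y assume "y \<in> closed_segment P x"
      then obtain u where u: "0 \<le> u" "u \<le> 1" "y = P + u *\<^sub>R (x - P)"
        by (auto simp: closed_segment_def algebra_simps)
      have y: "y = P + of_real (u * t) * d" using u(3) d(3) by (simp add: scaleR_conv_of_real)
      have "norm (u *\<^sub>R (x - P)) \<le> norm (x - P)" using u by (simp add: mult_left_le_one_le)
      then have "norm (u *\<^sub>R (x - P)) < \<epsilon>" using n by linarith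
      moreover have "u *\<^sub>R (x - P) = of_real (u * t) * d" using d(3) by (simp add: scaleR_conv_of_real)
      ultimately have "norm (of_real (u * t) * d) < \<epsilon>" by metis
      then have "y \<in> ball P \<epsilon>" using y by (simp add: dist_norm del: of_real_mult)
      note * = \<open>norm (of_real (u * t) * d) < \<epsilon>\<close> this
      have "norm (of_real (u * t) * d) < \<delta>" using * \<epsilon>(2) by linarith
      then show "y \<in> E \<inter> ball P \<epsilon>" using E[of "of_real (u * t) * d"] d u y *
        by (metis IntI mult_nonneg_nonneg)
    qed
  qed (use assms that in auto)
  then show ?thesis using \<delta> by blast
qed

text \<open>The two arcs and \<open>v\<close> itself fill a neighbourhood of \<open>v\<close> on the
  circle, and each arc accumulates at \<open>v\<close>; so the closures in \<open>crossings\<close>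
  see exactly the colours of the arcs.\<close>

lemma crossings_by_arcs:
  assumes v: "norm v = r" and \<phi>0: "\<phi>0 > 0"
    and c: "(\<lambda>u. A + u) ` circle_arc v 1 \<phi>0 \<subseteq> C" "(\<lambda>u. A + u) ` circle_arc v (-1) \<phi>0 \<subseteq> C'"
    and CC: "C = Bo \<or> C = Wo" "C' = Bo \<or> C' = Wo"
  shows "v \<in> crossings A \<longleftrightarrow> C \<noteq> C'"
proof
  assume "C \<noteq> C'"
  have cl: "v \<in> closure {u. norm u = r \<and> A + u \<in> X}" if X: "(\<lambda>u. A + u) ` circle_arc v s \<phi>0 \<subseteq> X" "\<bar>s\<bar> = 1" for X s
    unfolding closure_approachable
  proof (intro allI impI)
    fix e :: real assume "e > 0"
    then obtain u where "u \<in> circle_arc v s \<phi>0" "dist u v < e" using circle_arc_accumulates[OF _ \<phi>0 v X(2)] by blast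
    then show "\<exists>y\<in>{u. norm u = r \<and> A + u \<in> X}. dist y v < e" using X(1) circle_arc_norm[OF v] by blast
  qed
  show "v \<in> crossings A" unfolding crossings_def using cl[OF c(1)] cl[OF c(2)] CC \<open>C \<noteq> C'\<close> v by auto
next
  assume th: "v \<in> crossings A"
  show "C \<noteq> C'"
  proof
    assume "C = C'"
    obtain \<epsilon> where e: "\<epsilon> > 0" "\<And>u. norm u = r \<Longrightarrow> dist u v < \<epsilon> \<Longrightarrow> u = v \<or> u \<in> circle_arc v 1 \<phi>0 \<or> u \<in> circle_arc v (-1) \<phi>0"
      using near_on_circle[OF v \<phi>0] by blast
    obtain X where X: "X = Bo \<or> X = Wo" "X \<inter> C = {}" using CC disj by blast
    have "v \<in> closure {u. norm u = r \<and> A + u \<in> X}" using th X by (auto simp: crossings_def)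
    then obtain u where "norm u = r" "A + u \<in> X" "dist u v < \<epsilon>" using e(1) unfolding closure_approachable by blast
    moreover have "A + v \<in> E" using th by (rule crossings_E)
    ultimately show False using e(2)[of u] c X \<open>C = C'\<close> E_eq by blast
  qed
qed

text \<open>\<open>local_unique\<close> keeps the sums \<open>A + u\<close>, with \<open>A\<close>
  in a starlike piece of \<open>E\<close> and \<open>u\<close> on an arc beside \<open>v\<close>,
  off the boundary. For each arc these sums form a connected set, so its colour is the same for all
  such \<open>A\<close>, and the two colours decide about \<open>v\<close>.\<close>

lemma crossings_locally_constant:
  assumes "A0 \<in> E" "norm v = r"
  shows "\<exists>\<epsilon>>0. \<forall>A\<in>E. dist A A0 < \<epsilon> \<longrightarrow> (v \<in> crossings A \<longleftrightarrow> v \<in> crossings A0)"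
proof -
  obtain \<epsilon> where \<epsilon>: "\<epsilon> > 0"
    "\<And>A v'. A \<in> E \<Longrightarrow> dist A A0 < \<epsilon> \<Longrightarrow> norm v' = r \<Longrightarrow> dist v' v < \<epsilon> \<Longrightarrow> A + v' \<in> E \<Longrightarrow> v' = v"
    using local_unique[OF assms] by blast
  obtain \<delta> where \<delta>: "\<delta> > 0" "\<And>\<epsilon>. \<epsilon> > 0 \<Longrightarrow> \<epsilon> \<le> \<delta> \<Longrightarrow> starlike (E \<inter> ball A0 \<epsilon>)"
    using star_near_connected[OF assms(1)] by blast
  obtain \<phi>0 where \<phi>0: "\<phi>0 > 0" "\<phi>0 < pi" "\<And>\<phi>. \<bar>\<phi>\<bar> < \<phi>0 \<Longrightarrow> dist (v * cis \<phi>) v < \<epsilon>"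
    using circle_near[OF \<epsilon>(1), of v] by blast
  define \<eta> where "\<eta> = min \<epsilon> \<delta>"
  have \<eta>: "\<eta> > 0" "\<eta> \<le> \<epsilon>" "\<eta> \<le> \<delta>" using \<epsilon> \<delta> by (auto simp: \<eta>_def)
  have vz: "v \<noteq> 0" using assms(2) r_pos by auto
  have col: "\<exists>C. (C = Bo \<or> C = Wo) \<and> (\<forall>A\<in>E. dist A A0 < \<eta> \<longrightarrow> (\<lambda>u. A + u) ` circle_arc v s \<phi>0 \<subseteq> C)"
    if s: "\<bar>s\<bar> = 1" for s
  proof -
    define Y where "Y = (\<lambda>(A, u). A + u) ` ((E \<inter> ball A0 \<eta>) \<times> circle_arc v s \<phi>0)"
    have "connected Y" unfolding Y_def
      by (intro connected_continuous_image connected_Times connected_circle_arc starlike_imp_connected \<delta>(2) \<eta>)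
        (auto intro!: continuous_intros simp: case_prod_unfold)
    moreover have "Y \<inter> E = {}"
    proof (rule ccontr)
      assume "Y \<inter> E \<noteq> {}"
      then obtain A u where Au: "A \<in> E" "dist A A0 < \<eta>" "u \<in> circle_arc v s \<phi>0" "A + u \<in> E"
        by (auto simp: Y_def dist_commute)
      then obtain \<phi> where \<phi>: "0 < \<phi>" "\<phi> < \<phi>0" "u = v * cis (s * \<phi>)" by (auto simp: circle_arc_def)
      have "\<bar>s * \<phi>\<bar> = \<phi>" using s \<phi> by (simp add: abs_mult)
      then have "dist u v < \<epsilon>" using \<phi>0(3)[of "s * \<phi>"] \<phi> by simp
      then have "u = v" using \<epsilon>(2)[of A u] Au \<eta> circle_arc_norm[OF assms(2)] by auto
      then have "cis (s * \<phi>) = 1" using \<phi> vz by simp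
      then have "cos \<bar>s * \<phi>\<bar> = 1" by (simp add: complex_eq_iff)
      then have "cos \<phi> = cos 0" using \<open>\<bar>s * \<phi>\<bar> = \<phi>\<close> by simp
      then show False using \<phi> \<phi>0(2) cos_inj_pi[of \<phi> 0] by auto
    qed
    ultimately have "Y \<subseteq> Bo \<or> Y \<subseteq> Wo" by (rule connected_one_color)
    then show ?thesis
    proof
      assume "Y \<subseteq> Bo"
      then show ?thesis unfolding Y_def by (intro exI[of _ Bo]) (force simp: dist_commute)
    next
      assume "Y \<subseteq> Wo"
      then show ?thesis unfolding Y_def by (intro exI[of _ Wo]) (force simp: dist_commute)
    qed
  qed
  obtain C where C: "C = Bo \<or> C = Wo" "\<And>A. A\<in>E \<Longrightarrow> dist A A0 < \<eta> \<Longrightarrow> (\<lambda>u. A + u) ` circle_arc v 1 \<phi>0 \<subseteq> C"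
    using col[of 1, simplified] by metis
  obtain C' where C': "C' = Bo \<or> C' = Wo" "\<And>A. A\<in>E \<Longrightarrow> dist A A0 < \<eta> \<Longrightarrow> (\<lambda>u. A + u) ` circle_arc v (-1) \<phi>0 \<subseteq> C'"
    using col[of "-1", simplified] by metis
  have "v \<in> crossings A \<longleftrightarrow> C \<noteq> C'" if "A \<in> E" "dist A A0 < \<eta>" for A
    by (rule crossings_by_arcs[OF assms(2) \<phi>0(1) C(2)[OF that] C'(2)[OF that] C(1) C'(1)])
  then show ?thesis using \<eta>(1) assms(1) by (intro exI[of _ \<eta>]) auto
qed

lemma crossings_connected:
  assumes "connected S" "S \<subseteq> E" "P \<in> S" "Q \<in> S" "v \<in> crossings P"
  shows "v \<in> crossings Q"
proof (rule connected_induction_simple[where S = S and P = "\<lambda>A. v \<in> crossings A", OF assms(1,3,4,5)])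
  fix A assume "A \<in> S"
  then obtain \<epsilon> where e: "\<epsilon> > 0" "\<And>B. B \<in> E \<Longrightarrow> dist B A < \<epsilon> \<Longrightarrow> v \<in> crossings B \<longleftrightarrow> v \<in> crossings A"
    using crossings_locally_constant crossings_norm[OF assms(5)] assms(2) by blast
  have "v \<in> crossings x \<longleftrightarrow> v \<in> crossings A" if "x \<in> S \<inter> ball A \<epsilon>" for x
    using e(2)[of x] that assms(2) by (auto simp: dist_commute)
  moreover have "openin (top_of_set S) (S \<inter> ball A \<epsilon>)" by (rule openin_open_Int) simp
  moreover have "A \<in> S \<inter> ball A \<epsilon>" using \<open>A \<in> S\<close> e(1) by simp
  ultimately show "\<exists>T. openin (top_of_set S) T \<and> A \<in> T \<and> (\<forall>x\<in>T. \<forall>y\<in>T. v \<in> crossings x \<longrightarrow> v \<in> crossings y)"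
    by metis
qed

end

text \<open>In the plane \<open>d\<close> is \<open>\<i> * m\<close> up to sign. This links two
  forms of transversality: \<open>\<i> * v\<close> is the tangent of the circle at \<open>v\<close>,
  while \<open>m\<close> is the normal and \<open>d\<close> the direction of the segment.\<close>

lemma perp_inner:
  fixes v d m :: complex
  assumes "norm d = 1" "norm m = 1" "d \<bullet> m = 0"
  shows "(\<i> * v) \<bullet> m = 0 \<longleftrightarrow> d \<bullet> v = 0"
proof -
  have "norm (\<i> * m) = 1" "(\<i> * m) \<bullet> m = 0" using assms by (auto simp: norm_mult inner_complex_def)
  then have "d = \<i> * m \<or> d = - (\<i> * m)" using unit_perp[of "\<i> * m" d m] assms by auto
  then show ?thesis by (auto simp: inner_complex_def algebra_simps)
qed

lemma IVT_sgn:
  fixes f :: "real \<Rightarrow> real"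
  assumes "a \<le> b" "continuous_on {a..b} f" "f a * f b \<le> 0"
  shows "\<exists>t. a \<le> t \<and> t \<le> b \<and> f t = 0"
proof (cases "f a \<le> 0")
  case True
  then have "f b \<ge> 0 \<or> f a = 0" using assms(3) by (auto simp: mult_le_0_iff)
  then show ?thesis using IVT'[of f a 0 b] True assms(1,2) by auto
next
  case False
  then have "f b \<le> 0" using assms(3) by (auto simp: mult_le_0_iff)
  then show ?thesis using IVT2'[of f b 0 a] False assms(1,2) by auto
qed

context plane_coloring
begin

text \<open>A disc slit along a single ray is connected and would have one colour. The other colour
  would be confined to the ray, although it is open and accumulates at \<open>P\<close>.\<close>

lemma ray_dirs_two:
  assumes "P \<in> E" "d \<in> ray_dirs P"
  shows "\<exists>d'\<in>ray_dirs P. d' \<noteq> d"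
proof (rule ccontr)
  assume "\<not> ?thesis"
  then have D: "ray_dirs P = {d}" using assms(2) by blast
  have nd: "norm d = 1" using assms(2) by (rule ray_dirs_norm)
  obtain \<delta> where \<delta>: "\<delta> > 0" and E0: "\<And>x. norm x < \<delta> \<Longrightarrow> (P + x \<in> E \<longleftrightarrow> (\<exists>d'\<in>ray_dirs P. \<exists>t\<ge>0. x = of_real t * d'))"
    using ray_dirs_star(3)[OF assms(1)] by blast
  have E: "P + x \<in> E \<longleftrightarrow> (\<exists>t\<ge>0. x = of_real t * d)" if "norm x < \<delta>" for x
    using E0[OF that] by (simp add: D)
  define S where "S = {y. norm (y - P) < \<delta> \<and> \<not> (\<exists>t\<ge>0. y - P = of_real t * d)}"
  have dz: "d \<noteq> 0" using nd by auto
  \<comment> \<open>A point opposite to the ray: the slit disc is starlike about it.\<close>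
  define a where "a = P - of_real (\<delta>/2) * d"
  have aS: "a \<in> S"
  proof -
    have "norm (a - P) = \<delta>/2" using nd \<delta> by (simp add: a_def norm_mult)
    moreover have False if "t \<ge> 0" "a - P = of_real t * d" for t
    proof -
      have "of_real (t + \<delta>/2) * d = (a - P) + of_real (\<delta>/2) * d" by (simp add: that(2) distrib_right)
      also have "\<dots> = 0" by (simp add: a_def)
      finally have "of_real (t + \<delta>/2) * d = 0" .
      then have "t + \<delta>/2 = 0" using dz by (metis mult_eq_0_iff of_real_eq_0_iff)
      then show False using that(1) \<delta> by simp
    qed
    ultimately show ?thesis using \<delta> unfolding S_def by auto
  qed
  have "starlike S"
    unfolding starlike_def
  proof (intro bexI[OF _ aS] ballI subsetI)
    fix x y assume x: "x \<in> S" and "y \<in> closed_segment a x"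
    then obtain u where u: "0 \<le> u" "u \<le> 1" "y = (1 - u) *\<^sub>R a + u *\<^sub>R x"
      by (auto simp: closed_segment_def)
    have "y \<in> ball P \<delta>"
      using \<open>y \<in> closed_segment a x\<close> convex_ball[of P \<delta>] aS x closed_segment_subset[of a "ball P \<delta>" x]
      by (auto simp: S_def dist_norm norm_minus_commute)
    moreover have False if t: "t \<ge> 0" "y - P = of_real t * d" for t
    proof -
      have eq: "u *\<^sub>R (x - P) = of_real (t + (1 - u) * (\<delta> / 2)) * d"
        using t(2) by (simp add: u(3) a_def scaleR_conv_of_real algebra_simps)
      have nn: "t + (1 - u) * (\<delta> / 2) \<ge> 0" using t u \<delta> by simp
      show False
      proof (cases "u = 0")
        case True
        then have "t + (1 - u) * (\<delta> / 2) = 0" using eq dz by (metis mult_eq_0_iff of_real_eq_0_iff scale_zero_left)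
        then show False using True t \<delta> by simp
      next
        case False
        have "x - P = inverse u *\<^sub>R (u *\<^sub>R (x - P))" using False by simp
        also have "\<dots> = of_real (inverse u * (t + (1 - u) * (\<delta> / 2))) * d"
          unfolding eq by (simp add: scaleR_conv_of_real)
        finally have "x - P = of_real (inverse u * (t + (1 - u) * (\<delta> / 2))) * d" .
        moreover have "inverse u * (t + (1 - u) * (\<delta> / 2)) \<ge> 0" using nn u by simp
        ultimately show False using x unfolding S_def by blast
      qed
    qed
    ultimately show "y \<in> S" by (auto simp: S_def dist_norm norm_minus_commute)
  qed
  then have "connected S" by (rule starlike_imp_connected)
  moreover have "y \<notin> E" if "y \<in> S" for y using E[of "y - P"] that by (auto simp: S_def)
  ultimately have "S \<subseteq> Bo \<or> S \<subseteq> Wo" using connected_one_color[of S] by auto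
  then obtain C X where C: "S \<subseteq> C" "C \<inter> X = {}" "open X" "P \<in> closure X"
    using disj open_Bo open_Wo E_Bo E_Wo assms(1) by (metis inf_commute subsetD)
  obtain y where y: "y \<in> X" "dist y P < \<delta>" using C(4) \<delta> unfolding closure_approachable by blast
  have "open (X \<inter> ball P \<delta>)" using C by auto
  moreover have "y \<in> X \<inter> ball P \<delta>" using y by (simp add: dist_commute)
  ultimately obtain e where e: "e > 0" "cball y e \<subseteq> X \<inter> ball P \<delta>"
    using open_contains_cball by blast
  define z where "z = y + of_real e * (\<i> * d)"
  have "z \<in> cball y e" using nd e by (simp add: z_def dist_norm norm_mult)
  then have z: "z \<in> X" "norm (z - P) < \<delta>" using e by (auto simp: dist_norm norm_minus_commute)
  have "y \<in> X" "norm (y - P) < \<delta>" using y by (auto simp: dist_norm)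
  then have "y \<notin> S" "z \<notin> S" using z C by auto
  then obtain t t' where "y - P = of_real t * d" "z - P = of_real t' * d"
    using z y unfolding S_def by (auto simp: dist_norm)
  then have "of_real e * (\<i> * d) = of_real (t' - t) * d" by (simp add: z_def algebra_simps)
  then have "of_real e * \<i> = (of_real (t' - t) :: complex)" using dz by simp
  then have "e = 0" by (simp add: complex_eq_iff)
  then show False using e by simp
qed

end

context plane_coloring_radius
begin

text \<open>\<open>A\<close> is a limit of points of either colour. The small translation that takes
  it to such a point does not change the colours of two vertices in open classes.\<close>

lemma antisym:
  assumes "A \<in> E" "norm u = r"
  shows "\<not> (A + u \<in> Bo \<and> A + omega * u \<in> Bo)" "\<not> (A + u \<in> Wo \<and> A + omega * u \<in> Wo)"
proof -
  have *: "\<exists>x. A + x \<in> X \<and> A + u + x \<in> X \<and> A + omega * u + x \<in> X"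
    if X: "open X" "A \<in> closure X" "A + u \<in> X" "A + omega * u \<in> X" for X
  proof -
    obtain e1 where e1: "e1 > 0" "ball (A + u) e1 \<subseteq> X" using openE[OF X(1,3)] .
    obtain e2 where e2: "e2 > 0" "ball (A + omega * u) e2 \<subseteq> X" using openE[OF X(1,4)] .
    obtain y where y: "y \<in> X" "dist y A < min e1 e2" using X(2) e1(1) e2(1) unfolding closure_approachable
      by (metis min_less_iff_conj)
    have "A + u + (y - A) \<in> ball (A + u) e1" "A + omega * u + (y - A) \<in> ball (A + omega * u) e2"
      using y by (auto simp: dist_norm norm_minus_commute)
    then show ?thesis using e1 e2 y(1) by (intro exI[of _ "y - A"]) auto
  qed
  have A: "A \<in> closure Bo" "A \<in> closure Wo" using assms(1) E_Bo E_Wo by auto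
  have eq: "A + u + x = A + x + u" "A + omega * u + x = A + x + omega * u" for x by simp_all
  show "\<not> (A + u \<in> Bo \<and> A + omega * u \<in> Bo)"
    using *[OF open_Bo A(1)] no_Bo[OF assms(2)] unfolding eq by blast
  show "\<not> (A + u \<in> Wo \<and> A + omega * u \<in> Wo)"
    using *[OF open_Wo A(2)] no_Wo[OF assms(2)] unfolding eq by blast
qed

lemma circle_punctured:
  fixes v :: complex
  assumes "norm v = r" "\<epsilon> > 0"
  shows "\<exists>u. norm u = r \<and> u \<noteq> v \<and> dist u v < \<epsilon>"
proof -
  obtain \<phi>0 where p: "\<phi>0 > 0" "\<phi>0 < pi" "\<And>\<phi>. \<bar>\<phi>\<bar> < \<phi>0 \<Longrightarrow> dist (v * cis \<phi>) v < \<epsilon>"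
    using circle_near[OF assms(2)] by blast
  have "cos (\<phi>0/2) \<noteq> 1" using p cos_inj_pi[of "\<phi>0/2" 0] by auto
  then have "cis (\<phi>0/2) \<noteq> 1" by (auto simp: complex_eq_iff)
  then have "v * cis (\<phi>0/2) \<noteq> v" using assms r_pos by auto
  moreover have "norm (v * cis (\<phi>0/2)) = r" using assms by (simp add: norm_mult)
  moreover have "dist (v * cis (\<phi>0/2)) v < \<epsilon>" using p by simp
  ultimately show ?thesis by blast
qed

text \<open>By local uniqueness with the centre fixed, the boundary points on the circle about
  \<open>A\<close> are isolated.\<close>

lemma generic_on_circle:
  assumes "A \<in> E" "norm v = r" "\<epsilon> > 0"
  shows "\<exists>u. norm u = r \<and> dist u v < \<epsilon> \<and> A + u \<notin> E"
proof -
  obtain e where e: "e > 0" "\<And>v'. norm v' = r \<Longrightarrow> dist v' v < e \<Longrightarrow> A + v' \<in> E \<Longrightarrow> v' = v"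
    using local_unique[OF assms(1,2)] assms(1) by (metis dist_self)
  obtain u where "norm u = r" "u \<noteq> v" "dist u v < min e \<epsilon>"
    using circle_punctured[OF assms(2), of "min e \<epsilon>"] e assms by auto
  then show ?thesis using e(2)[of u] by auto
qed

definition SB :: "complex \<Rightarrow> complex set" where "SB A = {u. norm u = r \<and> A + u \<in> Bo}"
definition SW :: "complex \<Rightarrow> complex set" where "SW A = {u. norm u = r \<and> A + u \<in> Wo}"

text \<open>\<open>antisym\<close> allows the rotated point to be on the boundary. Nearby points of
  the circle off the boundary come from points of the same open class, so they have the opposite
  colour; hence the closures.\<close>

lemma omega_flips:
  assumes "A \<in> E"
  shows "(*) omega ` SB A \<subseteq> closure (SW A)" "(*) omega ` SW A \<subseteq> closure (SB A)"
proof -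
  have *: "omega * u \<in> closure {u. norm u = r \<and> A + u \<in> X'}"
    if X: "open X" "norm u = r" "A + u \<in> X" and flip: "\<And>u. norm u = r \<Longrightarrow> A + u \<in> X \<Longrightarrow> A + omega * u \<in> X' \<union> E" for X X' u
    unfolding closure_approachable
  proof (intro allI impI)
    fix e :: real assume "e > 0"
    obtain e1 where e1: "e1 > 0" "ball (A + u) e1 \<subseteq> X" using openE[OF X(1,3)] .
    have "norm (omega * u) = r" using X by (simp add: norm_mult)
    then obtain w where w: "norm w = r" "dist w (omega * u) < min e e1" "A + w \<notin> E"
      using generic_on_circle[OF assms, of "omega * u" "min e e1"] e1 \<open>e > 0\<close> by auto
    define u' where "u' = cnj omega * w"
    have "omega * u' = omega * cnj omega * w" by (simp add: u'_def)
    then have w': "w = omega * u'" by (simp add: omega_cnj(1))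
    have "dist w (omega * u) = dist u' u" unfolding w' dist_norm right_diff_distrib[symmetric] norm_mult by simp
    then have "A + u' \<in> ball (A + u) e1" using w by (simp add: dist_commute)
    then have "A + u' \<in> X" using e1 by auto
    moreover have "norm u' = r" using w by (simp add: u'_def norm_mult)
    ultimately have "A + w \<in> X'" using flip[of u'] w w' by auto
    then show "\<exists>y\<in>{u. norm u = r \<and> A + u \<in> X'}. dist y (omega * u) < e" using w by auto
  qed
  show "(*) omega ` SB A \<subseteq> closure (SW A)"
  proof
    fix y assume "y \<in> (*) omega ` SB A"
    then obtain u where u: "norm u = r" "A + u \<in> Bo" "y = omega * u" by (auto simp: SB_def)
    show "y \<in> closure (SW A)" unfolding SW_def u(3)
      by (rule *[OF open_Bo u(1,2)]) (use antisym[OF assms] E_eq in auto)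
  qed
  show "(*) omega ` SW A \<subseteq> closure (SB A)"
  proof
    fix y assume "y \<in> (*) omega ` SW A"
    then obtain u where u: "norm u = r" "A + u \<in> Wo" "y = omega * u" by (auto simp: SW_def)
    show "y \<in> closure (SB A)" unfolding SB_def u(3)
      by (rule *[OF open_Wo u(1,2)]) (use antisym[OF assms] E_eq in auto)
  qed
qed

lemma crossings_alt: "v \<in> crossings A \<longleftrightarrow> norm v = r \<and> v \<in> closure (SB A) \<and> v \<in> closure (SW A)"
  by (simp add: crossings_def SB_def SW_def)

lemma crossings_om: "omega * v \<in> crossings A" if "A \<in> E" "v \<in> crossings A"
proof -
  have "(*) omega ` closure (SB A) \<subseteq> closure (SW A)" "(*) omega ` closure (SW A) \<subseteq> closure (SB A)"
    by (intro image_closure_subset continuous_intros omega_flips[OF that(1)] closed_closure)+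
  then show ?thesis using that(2) by (auto simp: crossings_alt norm_mult)
qed

lemma crossings_minus: "- v \<in> crossings A" if "A \<in> E" "v \<in> crossings A"
proof -
  have "omega * (omega * (omega * v)) \<in> crossings A" using that by (intro crossings_om)
  moreover have "omega * (omega * (omega * v)) = omega * omega * omega * v" by (simp only: mult.assoc)
  ultimately show ?thesis by (simp add: omega_cube)
qed

lemma crossings_cnj: "cnj omega * v \<in> crossings A" if "A \<in> E" "v \<in> crossings A"
proof -
  have "- (omega * (omega * v)) \<in> crossings A" using that by (intro crossings_om crossings_minus)
  moreover have "- (omega * (omega * v)) = cnj omega * v"
    unfolding mult.assoc[symmetric] omega_cnj by (simp add: algebra_simps)
  ultimately show ?thesis by simp
qed

text \<open>The closures of \<open>SB A\<close> and \<open>SW A\<close> cover the circle. If they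
  were disjoint, connectedness would make one empty, and the rotation by \<open>omega\<close> would
  make the other empty too.\<close>

lemma crossings_nonempty: "crossings A \<noteq> {}" if A: "A \<in> E"
proof
  assume emp: "crossings A = {}"
  have "sphere (0::complex) r \<subseteq> closure (SB A) \<union> closure (SW A)"
  proof
    fix v :: complex assume "v \<in> sphere 0 r"
    then have v: "norm v = r" by simp
    have "v \<in> closure (SB A \<union> SW A)"
      unfolding closure_approachable
    proof (intro allI impI)
      fix e :: real assume "e > 0"
      then obtain u where "norm u = r" "dist u v < e" "A + u \<notin> E" using generic_on_circle[OF A v] by blast
      then show "\<exists>y\<in>SB A \<union> SW A. dist y v < e" using E_eq by (auto simp: SB_def SW_def)
    qed
    then show "v \<in> closure (SB A) \<union> closure (SW A)" by (simp add: closure_Un)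
  qed
  moreover have "closure (SB A) \<inter> closure (SW A) \<inter> sphere 0 r = {}" using emp by (auto simp: crossings_alt)
  moreover have "connected (sphere (0::complex) r)" by (rule connected_sphere) simp
  ultimately have "closure (SB A) \<inter> sphere 0 r = {} \<or> closure (SW A) \<inter> sphere 0 r = {}"
    unfolding connected_closed by blast
  moreover have "SB A \<subseteq> closure (SB A) \<inter> sphere 0 r" "SW A \<subseteq> closure (SW A) \<inter> sphere 0 r"
    using closure_subset[of "SB A"] closure_subset[of "SW A"] by (auto simp: SB_def SW_def)
  ultimately have "SB A = {} \<or> SW A = {}" by auto
  moreover have "SB A = {} \<longleftrightarrow> SW A = {}"
    using omega_flips[OF A] closure_empty by (metis image_is_empty subset_empty)
  ultimately have "SB A = {}" "SW A = {}" by auto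
  moreover have "norm (of_real r :: complex) = r" using r_pos by simp
  ultimately show False using generic_on_circle[OF A, of "of_real r" 1] E_eq by (auto simp: SB_def SW_def)
qed

text \<open>\<open>f\<close> measures the signed distance from the segment along the circle, and its
  derivative at 0 is \<open>(\<i> * v) \<bullet> m\<close>. If that vanishes, the circle is tangent
  and stays on one side of the line near \<open>v\<close>.\<close>

lemma crossings_transversal:
  assumes "norm v = r" "regular (A + v) m"
  shows "v \<in> crossings A \<longleftrightarrow> (\<i> * v) \<bullet> m \<noteq> 0"
proof -
  define k l where "k = (\<i> * v) \<bullet> m" and "l = v \<bullet> m"
  define f where "f \<phi> = (v * cis \<phi> - v) \<bullet> m" for \<phi>
  have f: "f \<phi> = (cos \<phi> - 1) * l + sin \<phi> * k" for \<phi>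
    by (simp add: f_def k_def l_def inner_complex_def algebra_simps)
  obtain \<delta> where \<delta>: "\<delta> > 0" "norm m = 1" and R: "\<And>x. norm x < \<delta> \<Longrightarrow>
     (x \<bullet> m > 0 \<longrightarrow> A + v + x \<in> Bo) \<and> (x \<bullet> m < 0 \<longrightarrow> A + v + x \<in> Wo)"
    using assms(2) unfolding regular_def by auto
  obtain \<phi>0 where \<phi>0: "\<phi>0 > 0" "\<phi>0 < pi" "\<And>\<phi>. \<bar>\<phi>\<bar> < \<phi>0 \<Longrightarrow> dist (v * cis \<phi>) v < \<delta>"
    using circle_near[OF \<delta>(1)] by blast
  have col: "A + v * cis \<phi> \<in> (if f \<phi> > 0 then Bo else Wo)" if "\<bar>\<phi>\<bar> < \<phi>0" "f \<phi> \<noteq> 0" for \<phi>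
    using R[of "v * cis \<phi> - v"] \<phi>0(3)[OF that(1)] that(2) by (auto simp: f_def dist_norm)
  \<comment> \<open>\<open>\<sigma>\<close> and \<open>\<tau>\<close> represent the signs of
    \<open>f\<close> just after and just before \<open>v\<close>.\<close>
  have arcs: "v \<in> crossings A \<longleftrightarrow> (if \<sigma> > 0 then Bo else Wo) \<noteq> (if \<tau> > 0 then Bo else Wo)"
    if *: "0 < \<phi>1" "\<phi>1 \<le> \<phi>0" "\<And>\<phi>. 0 < \<phi> \<Longrightarrow> \<phi> < \<phi>1 \<Longrightarrow> f \<phi> * \<sigma> > 0 \<and> f (- \<phi>) * \<tau> > 0" for \<phi>1 \<sigma> \<tau> :: real
  proof (rule crossings_by_arcs[OF assms(1) *(1)])
    show "(+) A ` circle_arc v 1 \<phi>1 \<subseteq> (if \<sigma> > 0 then Bo else Wo)"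
    proof
      fix y assume "y \<in> (+) A ` circle_arc v 1 \<phi>1"
      then obtain \<phi> where p: "0 < \<phi>" "\<phi> < \<phi>1" "y = A + v * cis \<phi>" by (auto simp: circle_arc_def)
      then have "f \<phi> * \<sigma> > 0" using * by auto
      then show "y \<in> (if \<sigma> > 0 then Bo else Wo)" using col[of \<phi>] p *(2)
        by (auto simp: zero_less_mult_iff split: if_splits)
    qed
    show "(+) A ` circle_arc v (-1) \<phi>1 \<subseteq> (if \<tau> > 0 then Bo else Wo)"
    proof
      fix y assume "y \<in> (+) A ` circle_arc v (-1) \<phi>1"
      then obtain \<phi> where p: "0 < \<phi>" "\<phi> < \<phi>1" "y = A + v * cis (-\<phi>)" by (auto simp: circle_arc_def)
      then have "f (-\<phi>) * \<tau> > 0" using * by auto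
      then show "y \<in> (if \<tau> > 0 then Bo else Wo)" using col[of "-\<phi>"] p *(2)
        by (auto simp: zero_less_mult_iff split: if_splits)
    qed
  qed auto
  have BW: "Bo \<noteq> Wo" using disj E_Bo regular_E[OF assms(2)] closure_empty by force
  show ?thesis
  proof (cases "k = 0")
    case True
    have "l \<noteq> 0"
    proof
      assume "l = 0"
      have "l = Re v * Re m + Im v * Im m" "k = Re v * Im m - Im v * Re m"
        by (simp_all add: l_def k_def inner_complex_def)
      then have "l\<^sup>2 + k\<^sup>2 = (norm v)\<^sup>2 * (norm m)\<^sup>2" unfolding cmod_power2 by algebra
      then show False using True \<open>l = 0\<close> \<delta>(2) assms(1) r_pos by simp
    qed
    have "f \<phi> * (- l) > 0 \<and> f (-\<phi>) * (- l) > 0" if "0 < \<phi>" "\<phi> < \<phi>0" for \<phi>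
    proof -
      have "cos \<phi> < cos 0" using that \<phi>0(2) by (intro cos_monotone_0_pi) auto
      moreover have "f \<phi> * (- l) = (1 - cos \<phi>) * (l * l)" "f (-\<phi>) * (- l) = (1 - cos \<phi>) * (l * l)"
        by (simp_all add: f True algebra_simps)
      moreover have "l * l > 0" using \<open>l \<noteq> 0\<close> by (simp add: zero_less_mult_iff) linarith
      ultimately show ?thesis by simp
    qed
    from arcs[OF \<phi>0(1) order_refl this] show ?thesis using True by (simp add: k_def)
  next
    case False
    have D: "((\<lambda>\<phi>. f \<phi> * k) has_real_derivative k * k) (at 0)"
      unfolding f by (auto intro!: derivative_eq_intros)
    have kk: "k * k > 0" using False by (simp add: zero_less_mult_iff) linarith
    obtain a where a: "a > 0" "\<And>h. 0 < h \<Longrightarrow> h < a \<Longrightarrow> f 0 * k < f h * k"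
      using DERIV_pos_inc_right[OF D kk] by auto
    obtain b where b: "b > 0" "\<And>h. 0 < h \<Longrightarrow> h < b \<Longrightarrow> f (- h) * k < f 0 * k"
      using DERIV_pos_inc_left[OF D kk] by auto
    have "f 0 = 0" by (simp add: f)
    have "v \<in> crossings A \<longleftrightarrow> (if k > 0 then Bo else Wo) \<noteq> (if - k > 0 then Bo else Wo)"
      by (rule arcs[of "min \<phi>0 (min a b)"]) (use a b \<phi>0 \<open>f 0 = 0\<close> in auto)
    then show ?thesis using False BW by (auto simp: k_def)
  qed
qed

lemma crossings_near:
  assumes "P \<in> E" "norm v = r" "d \<in> ray_dirs P"
  shows "\<exists>\<delta>>0. \<forall>t. 0 < t \<and> t < \<delta> \<longrightarrow> P + of_real t * d \<in> E \<and> (v \<in> crossings (P + of_real t * d) \<longleftrightarrow> v \<in> crossings P)"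
proof -
  have nd: "norm d = 1" using assms(3) by (rule ray_dirs_norm)
  obtain e where e: "e > 0" "\<And>t. 0 < t \<Longrightarrow> t < e \<Longrightarrow> P + of_real t * d \<in> E" using assms(3) unfolding ray_dirs_def by auto
  obtain e' where e': "e' > 0" "\<And>A. A \<in> E \<Longrightarrow> dist A P < e' \<Longrightarrow> (v \<in> crossings A \<longleftrightarrow> v \<in> crossings P)"
    using crossings_locally_constant[OF assms(1,2)] by blast
  show ?thesis
    by (intro exI[of _ "min e e'"]) (use e e' nd in \<open>auto simp: dist_norm norm_mult\<close>)
qed

text \<open>The colour change persists along the ray, so translation by \<open>v\<close> copies the
  ray into the boundary; transversality inside the copied ray excludes
  \<open>d \<bullet> v = 0\<close>.\<close>

lemma crossings_dirs:
  assumes "P \<in> E" "v \<in> crossings P" "d \<in> ray_dirs P"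
  shows "d \<in> ray_dirs (P + v)" "d \<bullet> v \<noteq> 0"
proof -
  have nd: "norm d = 1" using assms(3) by (rule ray_dirs_norm)
  have nv: "norm v = r" using assms(2) by (rule crossings_norm)
  have U: "P + v \<in> E" using assms(2) by (rule crossings_E)
  obtain \<delta> where \<delta>: "\<delta> > 0" "\<And>t. 0 < t \<Longrightarrow> t < \<delta> \<Longrightarrow> P + of_real t * d \<in> E \<and> v \<in> crossings (P + of_real t * d)"
    using crossings_near[OF assms(1) nv assms(3)] assms(2) by blast
  have "P + v + of_real t * d \<in> E" if "0 < t" "t < \<delta>" for t
    using crossings_E[of v "P + of_real t * d"] \<delta>(2)[OF that] by (simp add: algebra_simps)
  then show d: "d \<in> ray_dirs (P + v)" unfolding ray_dirs_def using nd \<delta>(1) by auto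
  obtain \<delta>' where \<delta>': "\<delta>' > 0" "\<And>t. 0 < t \<Longrightarrow> t < \<delta>' \<Longrightarrow> \<exists>m. regular (P + v + of_real t * d) m \<and> d \<bullet> m = 0"
    using regular_ray[OF U d] by blast
  define t where "t = min \<delta> \<delta>' / 2"
  have t: "0 < t" "t < \<delta>" "t < \<delta>'" using \<delta> \<delta>' by (auto simp: t_def)
  then obtain m where m: "regular (P + v + of_real t * d) m" "d \<bullet> m = 0" using \<delta>'(2) by blast
  then have "regular (P + of_real t * d + v) m" by (simp add: algebra_simps)
  then have "(\<i> * v) \<bullet> m \<noteq> 0" using crossings_transversal[OF nv] \<delta>(2) t by blast
  then show "d \<bullet> v \<noteq> 0" using perp_inner[OF nd _ m(2)] m(1) by (auto simp: regular_def)
qed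

text \<open>A ray direction \<open>d\<close> is common to \<open>P\<close> and \<open>P + v\<close>,
  and \<open>d \<bullet> v \<noteq> 0\<close> expresses transversality from either end. So
  \<open>- v\<close> is a colour change at points of the copied ray, and by local constancy at
  \<open>P + v\<close>.\<close>

lemma crossings_back: "- v \<in> crossings (P + v)" if h: "P \<in> E" "v \<in> crossings P"
proof -
  obtain d where d: "d \<in> ray_dirs P" using ray_dirs_star(2)[OF h(1)] by blast
  have nd: "norm d = 1" using d by (rule ray_dirs_norm)
  have nv: "norm v = r" using h(2) by (rule crossings_norm)
  have U: "P + v \<in> E" using h(2) by (rule crossings_E)
  note dU = crossings_dirs[OF h d]
  obtain \<delta> where \<delta>: "\<delta> > 0" "\<And>t. 0 < t \<Longrightarrow> t < \<delta> \<Longrightarrow> (- v \<in> crossings (P + v + of_real t * d) \<longleftrightarrow> - v \<in> crossings (P + v))"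
    using crossings_near[OF U _ dU(1), of "- v"] nv by auto
  obtain \<delta>' where \<delta>': "\<delta>' > 0" "\<And>t. 0 < t \<Longrightarrow> t < \<delta>' \<Longrightarrow> \<exists>m. regular (P + of_real t * d) m \<and> d \<bullet> m = 0"
    using regular_ray[OF h(1) d] by blast
  define t where "t = min \<delta> \<delta>' / 2"
  have t: "0 < t" "t < \<delta>" "t < \<delta>'" using \<delta> \<delta>' by (auto simp: t_def)
  then obtain m where m: "regular (P + of_real t * d) m" "d \<bullet> m = 0" using \<delta>'(2) by blast
  then have "regular (P + v + of_real t * d + - v) m" by (simp add: algebra_simps)
  moreover have "(\<i> * - v) \<bullet> m \<noteq> 0" using perp_inner[OF nd _ m(2), of "- v"] m(1) dU(2) by (auto simp: regular_def)
  ultimately have "- v \<in> crossings (P + v + of_real t * d)" using crossings_transversal[of "- v"] nv by simp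
  then show ?thesis using \<delta>(2) t by blast
qed

text \<open>Of two rays on the same side, the second is copied to \<open>P + v\<close>. A point
  moving on the first and a point moving on the copy could then keep distance \<open>r\<close> while
  their difference changes, against local uniqueness.\<close>

lemma one_ray_per_side:
  assumes "P \<in> E" "v \<in> crossings P" "d1 \<in> ray_dirs P" "d2 \<in> ray_dirs P" "(d1 \<bullet> v) * (d2 \<bullet> v) > 0"
  shows "d1 = d2"
proof (rule ccontr)
  assume ne: "d1 \<noteq> d2"
  have nd: "norm d1 = 1" "norm d2 = 1" using assms ray_dirs_norm by auto
  have nv: "norm v = r" using assms(2) by (rule crossings_norm)
  obtain \<epsilon> where \<epsilon>: "\<epsilon> > 0"
    "\<And>A v'. A \<in> E \<Longrightarrow> dist A P < \<epsilon> \<Longrightarrow> norm v' = r \<Longrightarrow> dist v' v < \<epsilon> \<Longrightarrow> A + v' \<in> E \<Longrightarrow> v' = v"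
    using local_unique[OF assms(1) nv] by blast
  obtain a where a: "a > 0" and a0: "\<And>t. 0 < t \<Longrightarrow> t < a \<Longrightarrow> P + of_real t * d1 \<in> E"
    using assms(3) unfolding ray_dirs_def by auto
  obtain b where b: "b > 0" "\<And>t. 0 < t \<Longrightarrow> t < b \<Longrightarrow> P + v + of_real t * d2 \<in> E"
    using crossings_dirs(1)[OF assms(1,2,4)] unfolding ray_dirs_def by auto
  define p q where "p = d1 \<bullet> v" and "q = d2 \<bullet> v"
  have pq: "p * q > 0" "p \<noteq> 0" "q \<noteq> 0" using assms(5) by (auto simp: p_def q_def)
  define \<kappa> where "\<kappa> = 2 * q / p"
  have \<kappa>: "\<kappa> > 0" "\<kappa> * p = 2 * q" using pq by (auto simp: \<kappa>_def zero_less_mult_iff zero_less_divide_iff)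
  \<comment> \<open>Moving the ends by \<open>t\<close> along \<open>d1\<close> and by
    \<open>s\<close> along \<open>d2\<close> changes the squared distance by
    \<open>2 * (s * q - t * p)\<close> to first order. This is \<open>2 * s * q\<close> for
    \<open>t = 0\<close> and \<open>- 2 * s * q\<close> for \<open>t = \<kappa> * s\<close>, so some
    \<open>t\<close> between restores the distance; \<open>c\<close> measures the quadratic term at
    the upper end.\<close>
  define c where "c = (norm (d2 - \<kappa> *\<^sub>R d1))\<^sup>2"
  \<comment> \<open>The first bounds stay within the given neighbourhoods; the last one prevents the
    quadratic terms from changing the two signs.\<close>
  define s where "s = min (min (\<epsilon> / (2 * (1 + \<kappa>))) (min (a / (2 * \<kappa>)) (b / 2))) (\<bar>q\<bar> / (1 + c))"
  have c0: "c \<ge> 0" by (simp add: c_def)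
  have "s > 0" using \<epsilon> a b \<kappa> pq c0 by (simp add: s_def)
  have s: "s \<le> \<epsilon> / (2 * (1 + \<kappa>))" "s \<le> a / (2 * \<kappa>)" "s \<le> b / 2" "s \<le> \<bar>q\<bar> / (1 + c)" unfolding s_def by linarith+
  have s': "s * (1 + \<kappa>) < \<epsilon>" "s * \<kappa> < a" "s < b" "s * (1 + c) \<le> \<bar>q\<bar>"
  proof -
    have "s * (2 * (1 + \<kappa>)) \<le> \<epsilon>" using s(1) \<kappa> by (simp add: pos_le_divide_eq)
    then show "s * (1 + \<kappa>) < \<epsilon>" using \<open>\<epsilon> > 0\<close> by (simp add: algebra_simps)
    have "s * (2 * \<kappa>) \<le> a" using s(2) \<kappa> by (simp add: pos_le_divide_eq)
    then show "s * \<kappa> < a" using a by (simp add: algebra_simps)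
    show "s < b" using s(3) b(1) by simp
    show "s * (1 + c) \<le> \<bar>q\<bar>" using s(4) c0 by (simp add: pos_le_divide_eq)
  qed
  define f where "f t = 2 * (v \<bullet> (s *\<^sub>R d2 - t *\<^sub>R d1)) + (s *\<^sub>R d2 - t *\<^sub>R d1) \<bullet> (s *\<^sub>R d2 - t *\<^sub>R d1)" for t
  have f0: "f 0 = s * (2 * q + s)"
    using nd by (simp add: f_def q_def inner_commute dot_square_norm power2_eq_square algebra_simps)
  have "s *\<^sub>R d2 - (\<kappa> * s) *\<^sub>R d1 = s *\<^sub>R (d2 - \<kappa> *\<^sub>R d1)" by (simp add: algebra_simps)
  then have "f (\<kappa> * s) = s * (2 * (q - \<kappa> * p) + s * c)"
    by (simp add: f_def c_def p_def q_def inner_commute inner_diff_right power2_norm_eq_inner algebra_simps)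
  then have f1: "f (\<kappa> * s) = s * (- 2 * q + s * c)" using \<kappa>(2) by (simp add: algebra_simps)
  have "f 0 * f (\<kappa> * s) = s * s * ((2 * q + s) * (- 2 * q + s * c))" by (simp add: f0 f1)
  moreover have "(2 * q + s) * (- 2 * q + s * c) \<le> 0"
  proof -
    have "s \<le> \<bar>q\<bar>" "s * c \<le> \<bar>q\<bar>" using s'(4) c0 \<open>s > 0\<close> by (auto simp: algebra_simps intro: order_trans[rotated])
    then show ?thesis using \<open>s > 0\<close> c0 unfolding mult_le_0_iff by (smt (verit) mult_nonneg_nonneg)
  qed
  ultimately have "f 0 * f (\<kappa> * s) \<le> 0" using \<open>s > 0\<close> by (simp add: mult_nonneg_nonpos)
  moreover have "continuous_on {0..\<kappa> * s} f" unfolding f_def by (intro continuous_intros)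
  ultimately obtain t where t: "0 \<le> t" "t \<le> \<kappa> * s" "f t = 0" using IVT_sgn[of 0 "\<kappa> * s" f] \<kappa> \<open>s > 0\<close> by auto
  define v' where "v' = v + (s *\<^sub>R d2 - t *\<^sub>R d1)"
  have "norm v' = r" using t(3) chord_eq[of v "s *\<^sub>R d2 - t *\<^sub>R d1"] nv by (simp add: v'_def f_def)
  moreover have "dist v' v < \<epsilon>"
  proof -
    have "norm (s *\<^sub>R d2 - t *\<^sub>R d1) \<le> s + t" using norm_triangle_ineq4[of "s *\<^sub>R d2" "t *\<^sub>R d1"] nd t \<open>s > 0\<close> by simp
    then show ?thesis using t(2) s'(1) by (simp add: v'_def dist_norm algebra_simps)
  qed
  moreover have "dist (P + of_real t * d1) P < \<epsilon>"
  proof -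
    have "t < \<epsilon>" using t(2) s'(1) \<open>s > 0\<close> by (simp add: algebra_simps)
    then show ?thesis using t nd by (simp add: dist_norm norm_mult)
  qed
  moreover have "P + of_real t * d1 \<in> E" using a0[of t] assms(1) t s'(2) by (cases "t = 0") (auto simp: mult.commute)
  moreover have "P + of_real t * d1 + v' \<in> E"
    using b(2)[OF \<open>s > 0\<close> s'(3)] by (simp add: v'_def scaleR_conv_of_real algebra_simps)
  ultimately have "v' = v" using \<epsilon>(2) by blast
  then have "of_real s * d2 = of_real t * d1" by (simp add: v'_def scaleR_conv_of_real)
  then show False using unit_ray_unique[OF nd(2,1)] \<open>s > 0\<close> t(1) ne by blast
qed

lemma two_rays:
  assumes "P \<in> E" "v \<in> crossings P"
  shows "\<exists>d1 d2. ray_dirs P = {d1, d2} \<and> d1 \<bullet> v > 0 \<and> d2 \<bullet> v < 0"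
proof -
  obtain a where a: "a \<in> ray_dirs P" using ray_dirs_star(2)[OF assms(1)] by blast
  obtain b where b: "b \<in> ray_dirs P" "b \<noteq> a" using ray_dirs_two[OF assms(1) a] by blast
  have nz: "d \<bullet> v \<noteq> 0" if "d \<in> ray_dirs P" for d using crossings_dirs(2)[OF assms that] .
  have side: "x = y" if "x \<in> ray_dirs P" "y \<in> ray_dirs P" "x \<bullet> v > 0 \<longleftrightarrow> y \<bullet> v > 0" for x y
    using one_ray_per_side[OF assms that(1,2)] that(3) nz[OF that(1)] nz[OF that(2)]
    by (metis linorder_neqE_linordered_idom mult_neg_neg mult_pos_pos)
  have D: "ray_dirs P = {a, b}" using side a b by blast
  show ?thesis
  proof (cases "a \<bullet> v > 0")
    case True
    then have "b \<bullet> v < 0" using side[OF a b(1)] b nz[OF b(1)] by force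
    then show ?thesis using D True by blast
  next
    case False
    then have "b \<bullet> v > 0" "a \<bullet> v < 0" using side[OF a b(1)] b nz[OF a] by auto
    then show ?thesis using D by blast
  qed
qed

end

section \<open>Boundary curves\<close>

lemma interior_extremum:
  fixes f :: "real \<Rightarrow> real"
  assumes "continuous_on {0..1} f" "f 0 = f 1"
  shows "\<exists>u. 0 < u \<and> u < 1 \<and> ((\<forall>t\<in>{0..1}. f t \<le> f u) \<or> (\<forall>t\<in>{0..1}. f u \<le> f t))"
proof -
  obtain a where a: "a \<in> {0..1}" "\<forall>t\<in>{0..1}. f t \<le> f a"
    using continuous_attains_sup[of "{0..1}" f] assms(1) by auto
  obtain b where b: "b \<in> {0..1}" "\<forall>t\<in>{0..1}. f b \<le> f t"
    using continuous_attains_inf[of "{0..1}" f] assms(1) by auto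
  consider "0 < a \<and> a < 1" | "0 < b \<and> b < 1" | "a \<in> {0, 1}" "b \<in> {0, 1}" using a(1) b(1) by force
  then show ?thesis
  proof cases
    case 3
    then have "f a = f b" using assms(2) by auto
    then have "f t = f a" if "t \<in> {0..1}" for t using a(2) b(2) that by force
    then have "\<forall>t\<in>{0..1}. f t \<le> f (1/2)" by simp
    then show ?thesis by (intro exI[of _ "1/2"]) auto
  qed (use a b in blast)+
qed

text \<open>The vectors \<open>omega * v\<close> and \<open>cnj omega * v\<close> are
  \<open>v\<close> turned by \<open>pi/3\<close> either way, so the conditions say that
  \<open>x\<close> and \<open>y\<close> are within \<open>pi/6\<close> of \<open>v\<close>. Their
  angle is then below \<open>pi/3\<close>.\<close>

lemma cone_inner:
  fixes x y v :: complex
  assumes "x \<bullet> (omega * v) > 0" "x \<bullet> (cnj omega * v) > 0" "y \<bullet> (omega * v) > 0" "y \<bullet> (cnj omega * v) > 0"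
  shows "x \<bullet> y > 0"
proof -
  define p q where "p z = z \<bullet> v" and "q z = z \<bullet> (\<i> * v)" for z
  have pq: "sqrt 3 * \<bar>q z\<bar> < p z" if "z \<bullet> (omega * v) > 0" "z \<bullet> (cnj omega * v) > 0" for z
  proof -
    have "z \<bullet> (omega * v) = (p z + sqrt 3 * q z) / 2" "z \<bullet> (cnj omega * v) = (p z - sqrt 3 * q z) / 2"
      by (simp_all add: p_def q_def inner_complex_def field_simps)
    then show ?thesis using that by (simp add: abs_if)
  qed
  have X: "sqrt 3 * \<bar>q x\<bar> < p x" and Y: "sqrt 3 * \<bar>q y\<bar> < p y" using pq assms by auto
  have "(sqrt 3 * \<bar>q x\<bar>) * (sqrt 3 * \<bar>q y\<bar>) < p x * p y" using X Y by (intro mult_strict_mono') auto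
  then have "3 * (\<bar>q x\<bar> * \<bar>q y\<bar>) < p x * p y" by (simp add: algebra_simps)
  moreover have "- (\<bar>q x\<bar> * \<bar>q y\<bar>) \<le> q x * q y" by (metis abs_ge_minus_self abs_mult minus_le_iff)
  moreover have "\<bar>q x\<bar> * \<bar>q y\<bar> \<ge> 0" by simp
  ultimately have "p x * p y + q x * q y > 0" by linarith
  moreover have "p x * p y + q x * q y = (v \<bullet> v) * (x \<bullet> y)"
    by (simp add: p_def q_def inner_complex_def algebra_simps)
  ultimately show ?thesis by (simp add: zero_less_mult_iff) (metis inner_ge_zero not_less)
qed

context plane_coloring
begin

text \<open>Path components, because the arguments below run along injective arcs. As
  \<open>E\<close> is locally starlike, they are open in \<open>E\<close> and closed.\<close>

definition component :: "complex \<Rightarrow> complex set" where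
  "component P = path_component_set E P"

lemma comp_E: "component P \<subseteq> E"
  unfolding component_def by (rule path_component_subset)

lemma comp_self: "P \<in> E \<Longrightarrow> P \<in> component P"
  by (simp add: component_def path_component_refl)

lemma comp_eq: "Q \<in> component P \<Longrightarrow> component Q = component P"
  unfolding component_def by (metis mem_Collect_eq path_component_eq)

lemma comp_path_connected: "path_connected (component P)"
  unfolding component_def by (rule path_connected_path_component)

lemma comp_maximal: "Q \<in> S \<Longrightarrow> path_connected S \<Longrightarrow> S \<subseteq> E \<Longrightarrow> S \<subseteq> component Q"
  unfolding component_def by (rule path_component_maximal)

lemma comp_connected: "connected (component P)"
  by (intro path_connected_imp_connected comp_path_connected)

lemma comp_translate:
  assumes "P \<in> E" "\<And>q. q \<in> component P \<Longrightarrow> q + w \<in> E" "q \<in> component P"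
  shows "q + w \<in> component (P + w)"
proof -
  have "path_connected ((\<lambda>q. q + w) ` component P)"
    by (intro path_connected_continuous_image comp_path_connected continuous_intros)
  then have "(\<lambda>q. q + w) ` component P \<subseteq> component (P + w)"
    using assms comp_self by (intro comp_maximal) auto
  then show ?thesis using assms(3) by auto
qed

end

context plane_coloring_radius
begin

lemma comp_open:
  assumes "Q \<in> component P"
  shows "\<exists>\<delta>>0. E \<inter> ball Q \<delta> \<subseteq> component P"
proof -
  have "Q \<in> E" using assms comp_E by auto
  then obtain \<delta> where \<delta>: "\<delta> > 0" "starlike (E \<inter> ball Q \<delta>)" using star_near_connected by blast
  then have "E \<inter> ball Q \<delta> \<subseteq> component Q"
    using \<open>Q \<in> E\<close> by (intro comp_maximal starlike_imp_path_connected) auto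
  then show ?thesis using comp_eq[OF assms] \<delta>(1) by auto
qed

lemma comp_closed: "closed (component P)"
proof -
  have "Q \<in> component P" if Q: "Q \<in> closure (component P)" for Q
  proof -
    have "Q \<in> E" using Q closed_E comp_E closure_minimal by blast
    then obtain \<delta> where \<delta>: "\<delta> > 0" "E \<inter> ball Q \<delta> \<subseteq> component Q" using comp_open[OF comp_self] by blast
    then obtain R where "R \<in> component P" "dist R Q < \<delta>" using Q unfolding closure_approachable by blast
    then have "R \<in> E \<inter> ball Q \<delta>" using comp_E[of P] by (auto simp: dist_commute)
    then have "R \<in> component Q" using \<delta>(2) by blast
    then have "component Q = component P" using comp_eq \<open>R \<in> component P\<close> by metis
    then show ?thesis using comp_self[OF \<open>Q \<in> E\<close>] by simp
  qed
  then show ?thesis by (metis closure_subset_eq subsetI)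
qed

lemma comp_ray:
  assumes "Q \<in> component P" "d \<in> ray_dirs Q"
  shows "\<exists>\<delta>>0. \<forall>t. 0 < t \<and> t < \<delta> \<longrightarrow> Q + of_real t * d \<in> component P"
proof -
  obtain \<delta> where \<delta>: "\<delta> > 0" "E \<inter> ball Q \<delta> \<subseteq> component P" using comp_open[OF assms(1)] by blast
  obtain e where e: "e > 0" "\<And>t. 0 < t \<Longrightarrow> t < e \<Longrightarrow> Q + of_real t * d \<in> E" using assms(2) unfolding ray_dirs_def by auto
  have nd: "norm d = 1" using assms(2) by (rule ray_dirs_norm)
  have "Q + of_real t * d \<in> component P" if "0 < t" "t < min \<delta> e" for t
  proof -
    have "Q + of_real t * d \<in> E \<inter> ball Q \<delta>" using e that nd by (auto simp: dist_norm norm_mult)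
    then show ?thesis using \<delta>(2) by blast
  qed
  then show ?thesis using \<delta> e by (intro exI[of _ "min \<delta> e"]) auto
qed

lemma ray_dirs_translate:
  assumes "Q \<in> component P" "\<And>q. q \<in> component P \<Longrightarrow> q + w \<in> E"
  shows "ray_dirs Q \<subseteq> ray_dirs (Q + w)"
proof
  fix d assume d: "d \<in> ray_dirs Q"
  obtain \<delta> where \<delta>: "\<delta> > 0" "\<And>t. 0 < t \<Longrightarrow> t < \<delta> \<Longrightarrow> Q + of_real t * d \<in> component P"
    using comp_ray[OF assms(1) d] by blast
  have "Q + w + of_real t * d \<in> E" if "0 < t" "t < \<delta>" for t
    using assms(2)[OF \<delta>(2)[OF that]] by (simp add: algebra_simps)
  then show "d \<in> ray_dirs (Q + w)" using \<delta>(1) ray_dirs_norm[OF d] unfolding ray_dirs_def by blast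
qed

lemma crossings_comp: "v \<in> crossings P \<Longrightarrow> P \<in> E \<Longrightarrow> Q \<in> component P \<Longrightarrow> v \<in> crossings Q"
  by (rule crossings_connected[OF comp_connected comp_E comp_self])

lemma crossings_translate:
  assumes "P \<in> E" "v \<in> crossings P" "q \<in> component P"
  shows "q + v \<in> component (P + v)"
  using assms by (intro comp_translate crossings_E[OF crossings_comp[OF assms(2,1)]])

text \<open>A boundary path through \<open>A + v\<close> that leaves the disc around \<open>A\<close> also leaves the discs around
  the points of a ray at \<open>A\<close>. By local uniqueness this ray is copied to \<open>A + v\<close>, where
  it crosses the circle transversally.\<close>

lemma crossing:
  assumes "A \<in> E" "norm v = r" "A + v \<in> E" "d \<in> ray_dirs A" "d \<bullet> v \<noteq> 0"
    "d1 \<in> ray_dirs (A + v)" "d1 \<bullet> v > 0" "d2 \<in> ray_dirs (A + v)" "d2 \<bullet> v < 0"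
  shows "v \<in> crossings A"
proof -
  define Q where "Q = A + v"
  have nd: "norm d = 1" "norm d1 = 1" "norm d2 = 1" using assms ray_dirs_norm by auto
  obtain \<epsilon> where \<epsilon>: "\<epsilon> > 0"
    "\<And>A' v'. A' \<in> E \<Longrightarrow> dist A' A < \<epsilon> \<Longrightarrow> norm v' = r \<Longrightarrow> dist v' v < \<epsilon> \<Longrightarrow> A' + v' \<in> E \<Longrightarrow> v' = v"
    using local_unique[OF assms(1,2)] by blast
  obtain a where a: "a > 0" "\<And>t. 0 < t \<Longrightarrow> t < a \<Longrightarrow> A + of_real t * d \<in> E" using assms(4) unfolding ray_dirs_def by auto
  obtain b1 where b1: "b1 > 0" "\<And>t. 0 < t \<Longrightarrow> t < b1 \<Longrightarrow> Q + of_real t * d1 \<in> E"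
    using assms(6) unfolding ray_dirs_def Q_def by auto
  obtain b2 where b2: "b2 > 0" "\<And>t. 0 < t \<Longrightarrow> t < b2 \<Longrightarrow> Q + of_real t * d2 \<in> E"
    using assms(8) unfolding ray_dirs_def Q_def by auto
  \<comment> \<open>The bound by \<open>- (d2 \<bullet> v)\<close> puts
    \<open>Q + of_real s * d2\<close> inside the circle about \<open>A\<close>; the point
    \<open>Q + of_real s * d1\<close> lies outside for every positive \<open>s\<close>.\<close>
  define s where "s = min (min \<epsilon> b1) (min b2 (- (d2 \<bullet> v))) / 2"
  have s: "s > 0" "s \<le> \<epsilon> / 2" "s < b1" "s < b2" "s < - (2 * (d2 \<bullet> v))"
    using \<epsilon>(1) b1(1) b2(1) assms(9) unfolding s_def by linarith+
  have QE: "Q + of_real x * d1 \<in> E" "Q + of_real x * d2 \<in> E" if "0 \<le> x" "x \<le> s" for x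
    using b1(2)[of x] b2(2)[of x] s that assms(3) by (cases "x = 0"; simp add: Q_def)+
  have nrm: "(norm (v + of_real s * d'))\<^sup>2 = r\<^sup>2 + s * (2 * (d' \<bullet> v) + s)" if "norm d' = 1" for d'
  proof -
    have "d' \<bullet> d' = 1" "v \<bullet> v = r\<^sup>2" using that assms(2) by (simp_all add: dot_square_norm)
    then have "(v + s *\<^sub>R d') \<bullet> (v + s *\<^sub>R d') = r\<^sup>2 + s * (2 * (d' \<bullet> v) + s)"
      by (simp add: inner_add_left inner_add_right inner_commute algebra_simps)
    then show ?thesis by (simp add: power2_norm_eq_inner scaleR_conv_of_real)
  qed
  have "r\<^sup>2 < (norm (v + of_real s * d1))\<^sup>2" using nrm[OF nd(2)] s(1) assms(7) by (simp add: add_pos_pos)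
  then have r1: "r < norm (v + of_real s * d1)" using power2_less_imp_less by fastforce
  have "(norm (v + of_real s * d2))\<^sup>2 < r\<^sup>2" using nrm[OF nd(3)] s(1,5) by (simp add: mult_pos_neg)
  then have r2: "norm (v + of_real s * d2) < r" using power2_less_imp_less r_pos by fastforce
  \<comment> \<open>By these margins the end on \<open>d1\<close> stays outside and the end on
    \<open>d2\<close> inside the circle about \<open>A + of_real t * d\<close>. So this circle meets
    one of the two rays, and local uniqueness places the meeting point at
    \<open>A + of_real t * d + v\<close>.\<close>
  define \<eta> where "\<eta> = min (min (norm (v + of_real s * d1) - r) (r - norm (v + of_real s * d2))) (min (\<epsilon>/2) a)"
  have \<eta>: "\<eta> > 0" "\<eta> \<le> norm (v + of_real s * d1) - r" "\<eta> \<le> r - norm (v + of_real s * d2)" "\<eta> \<le> \<epsilon>/2" "\<eta> \<le> a"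
    using r1 r2 \<epsilon>(1) a(1) unfolding \<eta>_def by linarith+
  have dQ: "Q + of_real t * d \<in> E" if t: "0 < t" "t < \<eta>" for t
  proof -
    have nt: "norm (of_real t * d) = t" using nd t by (simp add: norm_mult)
    define f where "f d' x = norm (v + of_real x * d' - of_real t * d) - r" for d' x
    have cont: "continuous_on {0..s} (f d')" for d' unfolding f_def by (intro continuous_intros)
    have f1: "f d1 s > 0" using norm_triangle_ineq2[of "v + of_real s * d1" "of_real t * d"] nt t \<eta>(2) unfolding f_def by linarith
    have f2: "f d2 s < 0" using norm_triangle_ineq4[of "v + of_real s * d2" "of_real t * d"] nt t \<eta>(3) unfolding f_def by linarith
    have "f d1 0 = f d2 0" by (simp add: f_def)
    then have "f d1 0 * f d1 s \<le> 0 \<or> f d2 0 * f d2 s \<le> 0"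
      using f1 f2 by (cases "f d1 0 \<le> 0") (auto simp: mult_nonpos_nonneg mult_nonneg_nonpos)
    then obtain d' x where x: "d' = d1 \<or> d' = d2" "0 \<le> x" "x \<le> s" "f d' x = 0"
      using IVT_sgn[OF _ cont] s(1) by (metis less_imp_le)
    define v' where "v' = v + of_real x * d' - of_real t * d"
    have nx: "norm (of_real x * d') = x" using x nd by (auto simp: norm_mult)
    have "norm v' = r" using x(4) by (simp add: v'_def f_def)
    moreover have "dist v' v < \<epsilon>"
    proof -
      have "v' - v = of_real x * d' - of_real t * d" by (simp add: v'_def)
      then have "dist v' v \<le> x + t" using norm_triangle_ineq4[of "of_real x * d'" "of_real t * d"] nx nt by (simp add: dist_norm)
      then show ?thesis using x(3) s(2) t(2) \<eta>(4) by linarith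
    qed
    moreover have "A + of_real t * d \<in> E" "dist (A + of_real t * d) A < \<epsilon>" using a(2) t \<eta> nt \<epsilon>(1) by (auto simp: dist_norm)
    moreover have "A + of_real t * d + v' = Q + of_real x * d'" by (simp add: v'_def Q_def)
    then have "A + of_real t * d + v' \<in> E" using QE[OF x(2,3)] x(1) by auto
    ultimately have "v' = v" using \<epsilon>(2) by blast
    then have "of_real x * d' = of_real t * d" by (simp add: v'_def)
    then show ?thesis using QE[OF x(2,3)] x(1) by auto
  qed
  then have "d \<in> ray_dirs Q" using nd \<eta>(1) unfolding ray_dirs_def by auto
  then obtain \<delta>' where \<delta>': "\<delta>' > 0" "\<And>t. 0 < t \<Longrightarrow> t < \<delta>' \<Longrightarrow> \<exists>m. regular (Q + of_real t * d) m \<and> d \<bullet> m = 0"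
    using regular_ray[of Q d] assms(3) by (auto simp: Q_def)
  obtain \<delta> where \<delta>: "\<delta> > 0" "\<And>t. 0 < t \<Longrightarrow> t < \<delta> \<Longrightarrow> (v \<in> crossings (A + of_real t * d) \<longleftrightarrow> v \<in> crossings A)"
    using crossings_near[OF assms(1,2,4)] by blast
  define t where "t = min \<delta> \<delta>' / 2"
  have t: "0 < t" "t < \<delta>" "t < \<delta>'" using \<delta> \<delta>' by (auto simp: t_def)
  then obtain m where m: "regular (Q + of_real t * d) m" "d \<bullet> m = 0" using \<delta>'(2) by blast
  then have "regular (A + of_real t * d + v) m" by (simp add: Q_def algebra_simps)
  moreover have "(\<i> * v) \<bullet> m \<noteq> 0" using perp_inner[OF nd(1) _ m(2)] m(1) assms(5) by (auto simp: regular_def)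
  ultimately show ?thesis using crossings_transversal[OF assms(2)] \<delta>(2) t by blast
qed

text \<open>The ray with positive inner product leads above the maximum, so the path has to arrive
  and to leave on the other ray, which contradicts injectivity.\<close>

lemma no_interior_max:
  fixes g :: "real \<Rightarrow> complex"
  assumes "P \<in> E" "v \<in> crossings P" "g ` {0..1} \<subseteq> component P" "continuous_on {0..1} g" "inj_on g {0..1}"
    "0 < u" "u < 1" "\<And>t. t \<in> {0..1} \<Longrightarrow> g t \<bullet> v \<le> g u \<bullet> v"
  shows False
proof -
  define Q where "Q = g u"
  have "u \<in> {0..1}" using assms(6,7) by simp
  then have Q: "Q \<in> component P" using assms(3) by (auto simp: Q_def)
  then have QE: "Q \<in> E" using comp_E by auto
  have vQ: "v \<in> crossings Q" using crossings_comp[OF assms(2,1) Q] .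
  obtain d1 d2 where D: "ray_dirs Q = {d1, d2}" "d1 \<bullet> v > 0" "d2 \<bullet> v < 0" using two_rays[OF QE vQ] by blast
  have nd: "norm d2 = 1" using D ray_dirs_norm[of d2 Q] by auto
  obtain \<delta> where \<delta>: "\<delta> > 0" and E: "\<And>x. norm x < \<delta> \<Longrightarrow> (Q + x \<in> E \<longleftrightarrow> (\<exists>d\<in>ray_dirs Q. \<exists>t\<ge>0. x = of_real t * d))"
    using ray_dirs_star(3)[OF QE] by blast
  obtain \<eta> where \<eta>: "\<eta> > 0" "\<And>t. t \<in> {0..1} \<Longrightarrow> dist t u < \<eta> \<Longrightarrow> dist (g t) (g u) < \<delta>"
    using assms(4,6,7) \<delta> unfolding continuous_on_iff by (metis atLeastAtMost_iff less_imp_le)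
  have on_ray: "g t = Q + of_real (norm (g t - Q)) * d2" if t: "t \<in> {0..1}" "dist t u < \<eta>" for t
  proof -
    have "norm (g t - Q) < \<delta>" using \<eta>(2)[OF t] by (simp add: Q_def dist_norm)
    moreover have "g t \<in> component P" using t(1) assms(3) by blast
    then have "Q + (g t - Q) \<in> E" using comp_E by auto
    ultimately obtain d \<tau> where d: "d \<in> ray_dirs Q" "\<tau> \<ge> 0" "g t - Q = of_real \<tau> * d" using E by blast
    have "g t = Q + \<tau> *\<^sub>R d" using d(3) by (simp add: scaleR_conv_of_real algebra_simps)
    then have "g t \<bullet> v = Q \<bullet> v + \<tau> * (d \<bullet> v)" by (simp add: inner_add_left)
    then have le: "\<tau> * (d \<bullet> v) \<le> 0" using assms(8)[OF t(1)] by (simp add: Q_def)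
    have "\<tau> = 0 \<or> d = d2"
    proof (rule ccontr)
      assume "\<not> ?thesis"
      then have "d = d1" "\<tau> > 0" using d D(1) by auto
      then have "\<tau> * (d \<bullet> v) > 0" using D(2) by simp
      then show False using le by simp
    qed
    then have "g t - Q = of_real \<tau> * d2" using d(3) by auto
    moreover from this have "norm (g t - Q) = \<tau>" using d(2) nd by (simp add: norm_mult)
    ultimately show ?thesis by (simp add: algebra_simps)
  qed
  define \<epsilon> where "\<epsilon> = min (\<eta>/2) (min u (1 - u) / 2)"
  have \<epsilon>: "\<epsilon> > 0" "\<epsilon> < \<eta>" "\<epsilon> < u" "\<epsilon> < 1 - u"
    using \<eta>(1) assms(6,7) by (auto simp: \<epsilon>_def min_def)
  define \<tau> where "\<tau> t = norm (g t - Q)" for t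
  have cont: "continuous_on {0..1} \<tau>" unfolding \<tau>_def by (intro continuous_intros assms(4))
  have "\<tau> u = 0" by (simp add: \<tau>_def Q_def)
  have pos: "\<tau> t > 0" if "t \<in> {0..1}" "t \<noteq> u" for t
    using inj_onD[OF assms(5), of t u] that assms(6,7) by (auto simp: \<tau>_def Q_def)
  \<comment> \<open>A positive distance from \<open>Q\<close> attained both before and after
    \<open>u\<close>; since both points lie on the ray \<open>d2\<close>, they coincide.\<close>
  define y where "y = min (\<tau> (u - \<epsilon>)) (\<tau> (u + \<epsilon>))"
  have y: "y > 0" using pos[of "u - \<epsilon>"] pos[of "u + \<epsilon>"] \<epsilon> assms(6,7) by (auto simp: y_def)
  have "\<exists>x\<ge>u - \<epsilon>. x \<le> u \<and> \<tau> x = y"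
    by (rule IVT2') (use y \<open>\<tau> u = 0\<close> \<epsilon> assms(6,7) in \<open>auto simp: y_def intro: continuous_on_subset[OF cont]\<close>)
  then obtain x1 where x1: "u - \<epsilon> \<le> x1" "x1 \<le> u" "\<tau> x1 = y" by blast
  have "\<exists>x\<ge>u. x \<le> u + \<epsilon> \<and> \<tau> x = y"
    by (rule IVT') (use y \<open>\<tau> u = 0\<close> \<epsilon> assms(6,7) in \<open>auto simp: y_def intro: continuous_on_subset[OF cont]\<close>)
  then obtain x2 where x2: "u \<le> x2" "x2 \<le> u + \<epsilon>" "\<tau> x2 = y" by blast
  have "g x1 = g x2"
    using on_ray[of x1] on_ray[of x2] x1 x2 \<epsilon> assms(6,7) unfolding \<tau>_def by (auto simp: dist_real_def)
  moreover have "x1 \<in> {0..1}" "x2 \<in> {0..1}" using x1 x2 \<epsilon> assms(6,7) by auto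
  ultimately have "x1 = x2" using assms(5) by (meson inj_onD)
  then have "x1 = u" using x1 x2 by simp
  then show False using x1(3) y \<open>\<tau> u = 0\<close> by simp
qed

text \<open>An arc between two such points would have an interior extremum of the inner product with
  \<open>v\<close>; a minimum is a maximum for \<open>- v\<close>, also a colour change. Thus the
  curve is a graph over the direction of \<open>v\<close>.\<close>

lemma inner_inj_on_comp:
  assumes "P \<in> E" "v \<in> crossings P" "Q \<in> component P" "R \<in> component P" "Q \<bullet> v = R \<bullet> v"
  shows "Q = R"
proof (rule ccontr)
  assume "Q \<noteq> R"
  have "path_connected (component P)" by (rule comp_path_connected)
  then obtain g where g: "Path_Connected.arc g" "path_image g \<subseteq> component P" "pathstart g = Q" "pathfinish g = R"
    unfolding path_connected_arcwise using assms(3,4) \<open>Q \<noteq> R\<close> by blast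
  have c: "continuous_on {0..1} g" "inj_on g {0..1}" "g ` {0..1} \<subseteq> component P"
    using g(1,2) by (auto simp: Path_Connected.arc_def path_def path_image_def)
  have "\<exists>u. 0 < u \<and> u < 1 \<and> ((\<forall>t\<in>{0..1}. g t \<bullet> v \<le> g u \<bullet> v) \<or> (\<forall>t\<in>{0..1}. g u \<bullet> v \<le> g t \<bullet> v))"
    by (rule interior_extremum) (use g assms(5) c(1) in \<open>auto simp: pathstart_def pathfinish_def intro!: continuous_intros\<close>)
  then obtain u where u: "0 < u" "u < 1" "(\<forall>t\<in>{0..1}. g t \<bullet> v \<le> g u \<bullet> v) \<or> (\<forall>t\<in>{0..1}. g u \<bullet> v \<le> g t \<bullet> v)"
    by blast
  from u(3) show False
  proof
    assume "\<forall>t\<in>{0..1}. g t \<bullet> v \<le> g u \<bullet> v"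
    then show False using no_interior_max[OF assms(1,2) c(3,1,2) u(1,2)] by blast
  next
    assume "\<forall>t\<in>{0..1}. g u \<bullet> v \<le> g t \<bullet> v"
    then show False using no_interior_max[OF assms(1) crossings_minus[OF assms(1,2)] c(3,1,2) u(1,2)] by simp
  qed
qed

text \<open>Along an arc the inner products with \<open>v1\<close> and \<open>v2\<close> are
  injective, hence strictly monotone, and one comparison fixes the sense for both. An arc from the
  lowest to the highest of the four points, measured by \<open>v1\<close>, passes through all of
  them.\<close>

lemma comp_same_sign:
  assumes "P \<in> E" "v1 \<in> crossings P" "v2 \<in> crossings P"
    and "Q \<in> component P" "R \<in> component P" "(R - Q) \<bullet> v1 > 0" "(R - Q) \<bullet> v2 > 0"
    and "Q' \<in> component P" "R' \<in> component P" "(R' - Q') \<bullet> v1 > 0"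
  shows "(R' - Q') \<bullet> v2 > 0"
proof -
  define F where "F = {Q, R, Q', R'}"
  have F: "finite F" "F \<noteq> {}" "F \<subseteq> component P" using assms by (auto simp: F_def)
  define L where "L = arg_min_on (\<lambda>x. x \<bullet> v1) F"
  define H where "H = arg_min_on (\<lambda>x. - (x \<bullet> v1)) F"
  have L: "L \<in> F" "\<And>x. x \<in> F \<Longrightarrow> L \<bullet> v1 \<le> x \<bullet> v1"
    using arg_min_if_finite[OF F(1,2), of "\<lambda>x. x \<bullet> v1"] by (auto simp: L_def not_less)
  have H: "H \<in> F" "\<And>x. x \<in> F \<Longrightarrow> x \<bullet> v1 \<le> H \<bullet> v1"
    using arg_min_if_finite[OF F(1,2), of "\<lambda>x. - (x \<bullet> v1)"] by (auto simp: H_def not_less)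
  have LH: "L \<bullet> v1 < H \<bullet> v1"
    using L(2)[of Q] H(2)[of R] assms(6) by (simp add: F_def inner_diff_left)
  have "path_connected (component P)" by (rule comp_path_connected)
  then obtain g where g: "Path_Connected.arc g" "path_image g \<subseteq> component P" "pathstart g = L" "pathfinish g = H"
    unfolding path_connected_arcwise using L(1) H(1) F(3) LH by (metis less_irrefl subsetD)
  have c: "continuous_on {0..1} g" "inj_on g {0..1}" "g ` {0..1} \<subseteq> component P" "g 0 = L" "g 1 = H"
    using g by (auto simp: Path_Connected.arc_def path_def path_image_def pathstart_def pathfinish_def)
  have mono: "strict_mono_on {0..1} (\<lambda>t. g t \<bullet> v) \<or> strict_antimono_on {0..1} (\<lambda>t. g t \<bullet> v)"
    if "v \<in> crossings P" for v
  proof -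
    have "inj_on (\<lambda>t. g t \<bullet> v) {0..1}"
      using inner_inj_on_comp[OF assms(1) that] c(2,3) by (auto simp: inj_on_def image_subset_iff)
    moreover have "continuous_on {0..1} (\<lambda>t. g t \<bullet> v)" by (intro continuous_intros c(1))
    ultimately show ?thesis using injective_eq_monotone_map[of "{0..1::real}" "\<lambda>t. g t \<bullet> v"]
      by (simp add: is_interval_cc)
  qed
  have m1: "strict_mono_on {0..1} (\<lambda>t. g t \<bullet> v1)"
    using mono[OF assms(2)] LH c(4,5) monotone_onD[of "{0..1}" "(<)" "(>)" "\<lambda>t. g t \<bullet> v1" 0 1] by fastforce
  have onpath: "\<exists>t\<in>{0..1}. g t = x" if x: "x \<in> F" for x
  proof -
    have "\<exists>t\<ge>0. t \<le> 1 \<and> g t \<bullet> v1 = x \<bullet> v1"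
      by (rule IVT') (use L(2)[OF x] H(2)[OF x] c in \<open>auto intro!: continuous_intros\<close>)
    then obtain t where t: "0 \<le> t" "t \<le> 1" "g t \<bullet> v1 = x \<bullet> v1" by blast
    have "g t \<in> component P" "x \<in> component P" using c(3) F(3) x t(1,2) by (auto simp: image_subset_iff)
    then have "g t = x" using inner_inj_on_comp[OF assms(1,2) _ _ t(3)] by blast
    then show ?thesis using t by auto
  qed
  obtain a b a' b' where ab: "a \<in> {0..1}" "b \<in> {0..1}" "a' \<in> {0..1}" "b' \<in> {0..1}"
    "g a = Q" "g b = R" "g a' = Q'" "g b' = R'"
    using onpath[of Q] onpath[of R] onpath[of Q'] onpath[of R'] unfolding F_def by blast
  have "a < b" using m1 ab assms(6) strict_mono_on_less[OF m1, of a b] by (simp add: inner_diff_left)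
  have "a' < b'" using m1 ab assms(10) strict_mono_on_less[OF m1, of a' b'] by (simp add: inner_diff_left)
  have "strict_mono_on {0..1} (\<lambda>t. g t \<bullet> v2)"
    using mono[OF assms(3)] \<open>a < b\<close> ab assms(7) monotone_onD[of "{0..1}" "(<)" "(>)" "\<lambda>t. g t \<bullet> v2" a b]
    by (fastforce simp: inner_diff_left)
  then show ?thesis using \<open>a' < b'\<close> ab strict_mono_onD[of "{0..1}" "\<lambda>t. g t \<bullet> v2" a' b'] by (simp add: inner_diff_left)
qed

text \<open>The powers of \<open>omega\<close> turn one colour change into a regular hexagon of
  colour changes, none perpendicular to \<open>d\<close>. The perpendiculars bound six sectors with
  the hexagon vectors as bisectors, so \<open>d\<close> is within \<open>pi/6\<close> of one of
  them.\<close>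

lemma exists_axis:
  assumes "P \<in> E" "d \<in> ray_dirs P"
  shows "\<exists>v\<in>crossings P. d \<bullet> (omega * v) > 0 \<and> d \<bullet> (cnj omega * v) > 0"
proof -
  obtain v0 where v0: "v0 \<in> crossings P" using crossings_nonempty[OF assms(1)] by blast
  have "\<exists>v\<in>crossings P. d \<bullet> (omega * v) > 0"
  proof (cases "d \<bullet> (omega * v0) > 0")
    case False
    moreover have "d \<bullet> (omega * v0) \<noteq> 0" using crossings_dirs(2)[OF assms(1) crossings_om[OF assms(1) v0] assms(2)] .
    ultimately have "d \<bullet> (omega * - v0) > 0" by simp
    then show ?thesis using crossings_minus[OF assms(1) v0] by blast
  qed (use v0 in blast)
  then obtain v where v: "v \<in> crossings P" "d \<bullet> (omega * v) > 0" by blast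
  have T: "omega * v \<in> crossings P" "omega * (omega * v) \<in> crossings P" using crossings_om[OF assms(1)] v by auto
  have nz: "d \<bullet> v \<noteq> 0" "d \<bullet> (omega * (omega * v)) \<noteq> 0"
    using crossings_dirs(2)[OF assms(1) _ assms(2)] v T by auto
  have c1: "cnj omega * (omega * z) = z" for z using omega_cnj(1) by (simp add: mult.assoc[symmetric] mult.commute)
  have c2: "cnj omega * z = - (omega * (omega * z))" "omega * (omega * (omega * z)) = - z" for z
  proof -
    show "cnj omega * z = - (omega * (omega * z))"
      unfolding mult.assoc[symmetric] omega_cnj by (simp add: algebra_simps)
    have "omega * (omega * (omega * z)) = (omega * omega * omega) * z" by (simp only: mult.assoc)
    then show "omega * (omega * (omega * z)) = - z" by (simp add: omega_cube)
  qed
  have "omega * v = v + omega * (omega * v)" unfolding mult.assoc[symmetric] omega_cnj by (simp add: algebra_simps)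
  then have sum: "d \<bullet> (omega * v) = d \<bullet> v + d \<bullet> (omega * (omega * v))" by (metis inner_add_right)
  consider "d \<bullet> v > 0" "d \<bullet> (omega * (omega * v)) > 0" | "d \<bullet> (omega * (omega * v)) < 0" | "d \<bullet> v < 0"
    using nz by linarith
  then show ?thesis
  proof cases
    case 1 then show ?thesis using T(1) by (intro bexI[of _ "omega * v"]) (simp_all add: c1)
  next
    case 2 then show ?thesis using v by (intro bexI[of _ v]) (simp_all add: c2(1))
  next
    case 3 then show ?thesis using T(2) v(2) by (intro bexI[of _ "omega * (omega * v)"]) (simp_all add: c1 c2(2))
  qed
qed

text \<open>A boundary curve leaves the disc of radius \<open>r\<close> about each of its points \<open>P\<close>; the exit
  point is \<open>P + e\<close> for a translation \<open>e\<close> that maps the curve to itself.\<close>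

lemma exists_period:
  assumes "P \<in> E"
  shows "\<exists>e\<in>crossings P. P + e \<in> component P"
proof -
  obtain d where d: "d \<in> ray_dirs P" using ray_dirs_star(2)[OF assms] by blast
  obtain v where v: "v \<in> crossings P" "d \<bullet> (omega * v) > 0" "d \<bullet> (cnj omega * v) > 0" using exists_axis[OF assms d] by blast
  have PP: "P \<in> component P" using comp_self[OF assms] .
  obtain \<delta> where \<delta>: "\<delta> > 0" "\<And>t. 0 < t \<Longrightarrow> t < \<delta> \<Longrightarrow> P + of_real t * d \<in> component P" using comp_ray[OF PP d] by blast
  define R where "R = P + (\<delta>/2) *\<^sub>R d"
  have R: "R \<in> component P" using \<delta>(2)[of "\<delta>/2"] \<delta>(1) by (simp add: R_def scaleR_conv_of_real)
  have vsum: "omega * v + cnj omega * v = v" by (simp add: omega_cnj algebra_simps)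
  then have dv: "d \<bullet> v > 0" using v(2,3) by (metis add_pos_pos inner_add_right)
  have Rv: "(R - P) \<bullet> v > 0" "(R - P) \<bullet> (omega * v) > 0" "(R - P) \<bullet> (cnj omega * v) > 0"
    using v dv \<delta>(1) by (simp_all add: R_def)
  \<comment> \<open>The ray \<open>d\<close> fixes the signs once; \<open>comp_same_sign\<close>
    carries them to all forward chords, which therefore stay within \<open>pi/6\<close> of
    \<open>v\<close>.\<close>
  have cone: "(R' - Q') \<bullet> (omega * v) > 0 \<and> (R' - Q') \<bullet> (cnj omega * v) > 0"
    if "Q' \<in> component P" "R' \<in> component P" "(R' - Q') \<bullet> v > 0" for Q' R'
    using comp_same_sign[OF assms v(1) crossings_om[OF assms v(1)] PP R Rv(1,2) that]
      comp_same_sign[OF assms v(1) crossings_cnj[OF assms v(1)] PP R Rv(1,3) that] by blast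
  \<comment> \<open>The forward part of the curve in the closed disc. Its furthest point lies on the
    circle, since otherwise the ray \<open>d1\<close> would lead further within the disc.\<close>
  define F where "F = component P \<inter> {Q. (Q - P) \<bullet> v \<ge> 0} \<inter> cball P r"
  have "closed {Q. (Q - P) \<bullet> v \<ge> 0}" by (intro closed_Collect_le continuous_intros)
  then have "compact F" unfolding F_def
    by (intro closed_Int_compact closed_Int comp_closed) auto
  moreover have "P \<in> F" using PP r_pos by (simp add: F_def)
  moreover have "continuous_on F (\<lambda>x. x \<bullet> v)" by (intro continuous_intros)
  ultimately obtain Q where Q: "Q \<in> F" "\<And>x. x \<in> F \<Longrightarrow> x \<bullet> v \<le> Q \<bullet> v"
    using continuous_attains_sup[of F "\<lambda>x. x \<bullet> v"] by blast
  have QG: "Q \<in> component P" "(Q - P) \<bullet> v \<ge> 0" "norm (Q - P) \<le> r" using Q(1) by (auto simp: F_def dist_norm norm_minus_commute)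
  have QE: "Q \<in> E" using QG(1) comp_E by auto
  have vQ: "v \<in> crossings Q" using crossings_comp[OF v(1) assms QG(1)] .
  obtain d1 d2 where D: "ray_dirs Q = {d1, d2}" "d1 \<bullet> v > 0" "d2 \<bullet> v < 0" using two_rays[OF QE vQ] by blast
  obtain \<delta>1 where \<delta>1: "\<delta>1 > 0" "\<And>t. 0 < t \<Longrightarrow> t < \<delta>1 \<Longrightarrow> Q + of_real t * d1 \<in> component P"
    using comp_ray[OF QG(1), of d1] D(1) by auto
  obtain \<delta>2 where \<delta>2: "\<delta>2 > 0" "\<And>t. 0 < t \<Longrightarrow> t < \<delta>2 \<Longrightarrow> Q + of_real t * d2 \<in> component P"
    using comp_ray[OF QG(1), of d2] D(1) by auto
  define e where "e = Q - P"
  have ne: "norm e = r"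
  proof (rule ccontr)
    assume "norm e \<noteq> r"
    then have "norm e < r" using QG(3) by (simp add: e_def)
    define t where "t = min (\<delta>1/2) (r - norm e)"
    have t: "0 < t" "t < \<delta>1" "t \<le> r - norm e" using \<delta>1(1) \<open>norm e < r\<close> by (auto simp: t_def)
    define x where "x = Q + t *\<^sub>R d1"
    have "x \<in> component P" using \<delta>1(2) t by (simp add: x_def scaleR_conv_of_real)
    moreover have "(x - P) \<bullet> v = (Q - P) \<bullet> v + t * (d1 \<bullet> v)" by (simp add: x_def inner_diff_left inner_add_left)
    then have "(x - P) \<bullet> v > (Q - P) \<bullet> v" using D(2) t by simp
    moreover have "norm (x - P) \<le> norm e + t"
      using norm_triangle_ineq[of e "t *\<^sub>R d1"] t ray_dirs_norm[of d1 Q] D(1) by (simp add: x_def e_def algebra_simps)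
    ultimately have "x \<in> F" using QG(2) t(3) by (auto simp: F_def dist_norm norm_minus_commute)
    then show False using Q(2)[of x] \<open>(x - P) \<bullet> v > (Q - P) \<bullet> v\<close> by (simp add: inner_diff_left)
  qed
  then have "Q \<noteq> P" using r_pos by (auto simp: e_def)
  then have "e \<bullet> v \<noteq> 0" using inner_inj_on_comp[OF assms v(1) QG(1) PP] by (auto simp: e_def inner_diff_left)
  then have "(Q - P) \<bullet> v > 0" using QG(2) by (simp add: e_def)
  then have ec: "e \<bullet> (omega * v) > 0" "e \<bullet> (cnj omega * v) > 0" using cone[OF PP QG(1)] by (auto simp: e_def)
  \<comment> \<open>\<open>crossing\<close> needs rays on both sides of the circle about
    \<open>P\<close>. Vectors within \<open>pi/6\<close> of \<open>v\<close> make acute angles with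
    each other, so the signs relative to \<open>v\<close> pass to \<open>e\<close>.\<close>
  have "d1 \<bullet> e > 0"
  proof -
    have Q1: "Q + (\<delta>1/2) *\<^sub>R d1 \<in> component P" using \<delta>1(2)[of "\<delta>1/2"] \<delta>1(1) by (simp add: scaleR_conv_of_real)
    have "d1 \<bullet> (omega * v) > 0" "d1 \<bullet> (cnj omega * v) > 0"
      using cone[OF QG(1) Q1] D(2) \<delta>1(1) by (simp_all add: zero_less_mult_iff)
    then show ?thesis using cone_inner ec by blast
  qed
  moreover have "d2 \<bullet> e < 0"
  proof -
    have Q2: "Q + (\<delta>2/2) *\<^sub>R d2 \<in> component P" using \<delta>2(2)[of "\<delta>2/2"] \<delta>2(1) by (simp add: scaleR_conv_of_real)
    have "(- d2) \<bullet> (omega * v) > 0" "(- d2) \<bullet> (cnj omega * v) > 0"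
      using cone[OF Q2 QG(1)] D(3) \<delta>2(1) by (simp_all add: mult_less_0_iff)
    then have "(- d2) \<bullet> e > 0" using cone_inner ec by blast
    then show ?thesis by simp
  qed
  moreover have "d \<bullet> e \<noteq> 0" using cone_inner[OF v(2,3) ec] by simp
  ultimately have "e \<in> crossings P"
    using crossing[OF assms ne _ d, of d1 d2] D(1) QE by (simp add: e_def)
  then show ?thesis using QG(1) by (intro bexI[of _ e]) (auto simp: e_def)
qed

end

section \<open>Translates of a boundary curve\<close>

lemma inner_div:
  fixes z e :: complex
  assumes "norm e = r"
  shows "(z * e) \<bullet> (c * e) = r\<^sup>2 * (z \<bullet> c)"
proof -
  have "r\<^sup>2 = (Re e)\<^sup>2 + (Im e)\<^sup>2" using assms cmod_power2 by metis
  then show ?thesis by (simp add: inner_complex_def power2_eq_square algebra_simps)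
qed

lemma increment_unbounded:
  fixes h :: "real \<Rightarrow> real"
  assumes "\<And>x. h x + c \<le> h (x + a)" "c > 0" "\<And>x y. \<bar>h x - h y\<bar> \<le> B"
  shows False
proof -
  have it: "h 0 + real n * c \<le> h (real n * a)" for n
  proof (induction n)
    case (Suc n)
    then show ?case using assms(1)[of "real n * a"] by (simp add: algebra_simps)
  qed simp
  obtain n where "real n * c > B" using reals_Archimedean3[OF assms(2)] by blast
  then show False using it[of n] assms(3)[of "real n * a" 0] by linarith
qed

context plane_coloring_radius
begin

section \<open>The curve as the graph of a bounded function over its period\<close>

context
  fixes P e :: complex
  assumes P: "P \<in> E" and e: "e \<in> crossings P" and Pe: "P + e \<in> component P"
begin

lemma period_norm: "norm e = r" "e \<noteq> 0"
  using e crossings_norm crossings_nz by auto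

lemma comp_period: "Q \<in> component P \<Longrightarrow> Q + e \<in> component P" "Q \<in> component P \<Longrightarrow> Q - e \<in> component P"
proof -
  assume Q: "Q \<in> component P"
  have eq: "component (P + e) = component P" using comp_eq[OF Pe] .
  show "Q + e \<in> component P" using crossings_translate[OF P e Q] eq by simp
  have "P + e \<in> E" using Pe comp_E by auto
  then show "Q - e \<in> component P"
    using crossings_translate[OF _ crossings_back[OF P e], of Q] Q eq by simp
qed

lemma comp_period_int: "Q \<in> component P \<Longrightarrow> Q + of_int k * e \<in> component P"
proof (induction k rule: int_induct[where k = 0])
  case base then show ?case by simp
next
  case (step1 i)
  then show ?case using comp_period(1)[of "Q + of_int i * e"] by (simp add: algebra_simps)
next
  case (step2 i)
  then show ?case using comp_period(2)[of "Q + of_int i * e"] by (simp add: algebra_simps)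
qed

lemma comp_inj: "Q \<in> component P \<Longrightarrow> R \<in> component P \<Longrightarrow> Re (Q / e) = Re (R / e) \<Longrightarrow> Q = R"
proof (rule inner_inj_on_comp[OF P e])
  assume "Re (Q / e) = Re (R / e)"
  then have "(Q / e * e) \<bullet> (1 * e) = (R / e * e) \<bullet> (1 * e)"
    unfolding inner_div[OF period_norm(1)] by (simp add: inner_complex_def)
  then show "Q \<bullet> e = R \<bullet> e" using period_norm(2) by simp
qed

lemma comp_cone:
  assumes "Q \<in> component P" "R \<in> component P" "(R - Q) \<bullet> e > 0"
  shows "(R - Q) \<bullet> (omega * e) > 0" "(R - Q) \<bullet> (cnj omega * e) > 0"
proof -
  have "(1 * e) \<bullet> (1 * e) > 0" "(1 * e) \<bullet> (omega * e) > 0" "(1 * e) \<bullet> (cnj omega * e) > 0"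
    unfolding inner_div[OF period_norm(1)] using r_pos by (simp_all add: inner_complex_def)
  then show "(R - Q) \<bullet> (omega * e) > 0" "(R - Q) \<bullet> (cnj omega * e) > 0"
    using comp_same_sign[OF P e _ comp_self[OF P] Pe _ _ assms] crossings_om[OF P e] crossings_cnj[OF P e] by auto
qed

text \<open>In the frame of \<open>e\<close> the cone condition reads
  \<open>sqrt 3 * \<bar>Im z\<bar> < Re z\<close>; the constant 1 is a convenient weakening.\<close>

lemma comp_Lipschitz:
  assumes "Q \<in> component P" "R \<in> component P"
  shows "\<bar>Im (R / e) - Im (Q / e)\<bar> \<le> \<bar>Re (R / e) - Re (Q / e)\<bar>"
proof -
  have *: "\<bar>Im (R / e) - Im (Q / e)\<bar> \<le> Re (R / e) - Re (Q / e)"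
    if "Q \<in> component P" "R \<in> component P" "Re (R / e) > Re (Q / e)" for Q R
  proof -
    define z where "z = (R - Q) / e"
    have z: "R - Q = z * e" using period_norm(2) by (simp add: z_def)
    have zz: "Re z = Re (R / e) - Re (Q / e)" "Im z = Im (R / e) - Im (Q / e)"
      by (simp_all add: z_def diff_divide_distrib)
    have "(z * e) \<bullet> (1 * e) > 0" unfolding inner_div[OF period_norm(1)]
      using that(3) zz r_pos by (simp add: inner_complex_def)
    then have "(z * e) \<bullet> (omega * e) > 0" "(z * e) \<bullet> (cnj omega * e) > 0"
      using comp_cone[OF that(1,2)] z by simp_all
    then have "z \<bullet> omega > 0" "z \<bullet> cnj omega > 0"
      unfolding inner_div[OF period_norm(1)] using r_pos by (simp_all add: zero_less_mult_iff)
    then have "\<bar>Im z * sqrt 3\<bar> < Re z" by (simp add: inner_complex_def abs_less_iff)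
    then have "sqrt 3 * \<bar>Im z\<bar> < Re z" by (simp add: abs_mult mult.commute)
    moreover have "\<bar>Im z\<bar> \<le> sqrt 3 * \<bar>Im z\<bar>" by (simp add: mult_le_cancel_right1)
    ultimately show ?thesis using zz by simp
  qed
  consider "Re (R / e) > Re (Q / e)" | "Re (R / e) < Re (Q / e)" | "Re (R / e) = Re (Q / e)" by linarith
  then show ?thesis
    using *[OF assms] *[OF assms(2,1)] comp_inj[OF assms] by cases auto
qed

lemma comp_all_Re: "\<exists>Q\<in>component P. Re (Q / e) = x"
proof -
  define k where "k = \<lfloor>x - Re (P / e)\<rfloor>"
  define A B where "A = P + of_int k * e" and "B = P + of_int (k + 1) * e"
  have AB: "A \<in> component P" "B \<in> component P"
    unfolding A_def B_def by (intro comp_period_int comp_self[OF P])+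
  have "Re (A / e) = Re (P / e) + of_int k" "Re (B / e) = Re (P / e) + of_int (k + 1)"
    unfolding A_def B_def using period_norm(2) by (simp_all add: add_divide_distrib)
  then have x: "Re (A / e) \<le> x" "x \<le> Re (B / e)" unfolding k_def by linarith+
  have "connected ((\<lambda>Q. Re (Q / e)) ` component P)"
    using period_norm(2) by (intro connected_continuous_image continuous_intros comp_connected) auto
  then have "x \<in> (\<lambda>Q. Re (Q / e)) ` component P"
    by (rule connectedD_interval[of _ "Re (A / e)" "Re (B / e)" x]) (use AB x in auto)
  then show ?thesis by auto
qed

text \<open>Division by \<open>e\<close> makes the period the horizontal unit vector. By
  \<open>comp_inj\<close> and \<open>comp_all_Re\<close> every abscissa belongs to exactly one point
  of the curve, so \<open>component P\<close> is the graph of \<open>height\<close>, which has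
  period 1.\<close>

definition height :: "real \<Rightarrow> real" where
  "height x = Im ((THE Q. Q \<in> component P \<and> Re (Q / e) = x) / e)"

lemma height_Im: "Q \<in> component P \<Longrightarrow> height (Re (Q / e)) = Im (Q / e)"
  unfolding height_def by (subst the_equality[of _ Q]) (auto intro: comp_inj)

lemma comp_ht: "Q \<in> component P \<longleftrightarrow> Im (Q / e) = height (Re (Q / e))"
proof
  assume "Im (Q / e) = height (Re (Q / e))"
  obtain R where R: "R \<in> component P" "Re (R / e) = Re (Q / e)" using comp_all_Re by blast
  then have "Im (R / e) = Im (Q / e)" using height_Im[OF R(1)] \<open>Im (Q / e) = _\<close> by simp
  then have "R / e = Q / e" using R(2) by (simp add: complex_eq_iff)
  then show "Q \<in> component P" using R(1) period_norm(2) by simp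
qed (simp add: height_Im)

lemma height_Lipschitz: "\<bar>height x - height y\<bar> \<le> \<bar>x - y\<bar>"
proof -
  obtain Q where Q: "Q \<in> component P" "Re (Q / e) = x" using comp_all_Re by blast
  obtain R where R: "R \<in> component P" "Re (R / e) = y" using comp_all_Re by blast
  show ?thesis using comp_Lipschitz[OF R(1) Q(1)] height_Im[OF Q(1)] height_Im[OF R(1)] Q R by simp
qed

lemma height_cont: "continuous_on S height"
proof (rule lipschitz_on_continuous_on)
  show "1-lipschitz_on S height" unfolding lipschitz_on_def using height_Lipschitz by (simp add: dist_real_def)
qed

lemma height_bound: "\<bar>height x - height y\<bar> \<le> 1"
proof -
  obtain Q where Q: "Q \<in> component P" "Re (Q / e) = x" using comp_all_Re by blast
  define k where "k = \<lfloor>y - x\<rfloor>"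
  have "Q + of_int k * e \<in> component P" using comp_period_int Q by blast
  moreover have "(Q + of_int k * e) / e = Q / e + of_int k" using period_norm(2) by (simp add: add_divide_distrib)
  ultimately have "height (x + of_int k) = Im (Q / e)" using height_Im Q(2) by fastforce
  then have "height (x + of_int k) = height x" using height_Im[OF Q(1)] Q(2) by simp
  moreover have "\<bar>(x + of_int k) - y\<bar> \<le> 1" unfolding k_def by linarith
  ultimately show ?thesis using height_Lipschitz[of "x + of_int k" y] by simp
qed

text \<open>Such a translation adds \<open>Im (w / e)\<close> to the bounded function
  \<open>height\<close> at each repetition. For \<open>w\<close> a period of another length, this
  makes the two periods parallel.\<close>

lemma height_zero:
  assumes "\<And>q. q \<in> component P \<Longrightarrow> q + w \<in> component P"
  shows "Im (w / e) = 0"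
proof -
  have *: "height (x + Re (w / e)) = height x + Im (w / e)" for x
  proof -
    obtain Q where Q: "Q \<in> component P" "Re (Q / e) = x" using comp_all_Re by blast
    then have "height (Re ((Q + w) / e)) = Im ((Q + w) / e)" using height_Im assms by blast
    then show ?thesis using Q height_Im[OF Q(1)] by (simp add: add_divide_distrib)
  qed
  have "\<not> Im (w / e) > 0"
    using increment_unbounded[of height "Im (w / e)" "Re (w / e)" 1] * height_bound by force
  moreover have "\<not> - Im (w / e) > 0"
  proof
    assume a: "- Im (w / e) > 0"
    have "height x + - Im (w / e) \<le> height (x + - Re (w / e))" for x
      using *[of "x - Re (w / e)"] by simp
    from increment_unbounded[where h = height, OF this a height_bound] show False .
  qed
  ultimately show ?thesis by linarith
qed

section \<open>Translations of the curve into the boundary\<close>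

definition shifts :: "complex set" where
  "shifts = {w. \<forall>q\<in>component P. q + w \<in> E}"

lemma shifts_closed: "closed shifts"
proof -
  have "shifts = (\<Inter>q\<in>component P. (\<lambda>w. q + w) -` E)" by (auto simp: shifts_def)
  moreover have "closed ((\<lambda>w. q + w) -` E)" for q
    by (intro closed_vimage closed_E continuous_intros)
  ultimately show ?thesis by auto
qed

lemma shifts_period: "w \<in> shifts \<Longrightarrow> w + of_int k * e \<in> shifts"
proof -
  assume w: "w \<in> shifts"
  have "q + (w + of_int k * e) \<in> E" if "q \<in> component P" for q
  proof -
    have "(q + of_int k * e) + w \<in> E" using w comp_period_int[OF that] unfolding shifts_def by blast
    then show ?thesis by (simp add: algebra_simps)
  qed
  then show "w + of_int k * e \<in> shifts" by (simp add: shifts_def)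
qed

text \<open>Translation by \<open>w\<close> copies the rays at \<open>P\<close> and
  \<open>P + e\<close> to \<open>P + w\<close> and \<open>P + w + e\<close>, which supplies the rays
  that \<open>crossing\<close> asks for.\<close>

lemma shifts_Th:
  assumes "w \<in> shifts"
  shows "e \<in> crossings (P + w)" "P + w + e \<in> component (P + w)"
proof -
  have tr: "\<And>q. q \<in> component P \<Longrightarrow> q + w \<in> E" using assms by (auto simp: shifts_def)
  have PP: "P \<in> component P" using comp_self[OF P] .
  show comp: "P + w + e \<in> component (P + w)"
    using comp_translate[OF P tr Pe] by (simp add: algebra_simps)
  obtain d where d: "d \<in> ray_dirs P" using ray_dirs_star(2)[OF P] by blast
  have PeE: "P + e \<in> E" using Pe comp_E by auto
  have "e \<in> crossings (P + e)" using crossings_comp[OF e P Pe] .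
  then obtain d1 d2 where D: "ray_dirs (P + e) = {d1, d2}" "d1 \<bullet> e > 0" "d2 \<bullet> e < 0" using two_rays[OF PeE] by blast
  have sub: "ray_dirs P \<subseteq> ray_dirs (P + w)" "ray_dirs (P + e) \<subseteq> ray_dirs (P + w + e)"
    using ray_dirs_translate[OF PP tr] ray_dirs_translate[OF Pe tr] by (auto simp: algebra_simps)
  show "e \<in> crossings (P + w)"
  proof (rule crossing[where d = d and ?d1.0 = d1 and ?d2.0 = d2])
    show "P + w \<in> E" using tr PP by auto
    show "P + w + e \<in> E" using tr[OF Pe] by (simp add: algebra_simps)
    show "d \<bullet> e \<noteq> 0" using crossings_dirs(2)[OF P e d] .
  qed (use sub d D period_norm in auto)
qed

text \<open>The translated curve lies in the component through \<open>P + w\<close> and reaches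
  every level of the inner product with \<open>e\<close>. Since \<open>e\<close> is a colour change
  on that component too, each level holds one point and no room is left.\<close>

lemma shifts_comp:
  assumes "w \<in> shifts"
  shows "q \<in> component (P + w) \<longleftrightarrow> q - w \<in> component P"
proof
  have tr: "\<And>q. q \<in> component P \<Longrightarrow> q + w \<in> E" using assms by (auto simp: shifts_def)
  have PwE: "P + w \<in> E" using tr comp_self[OF P] by auto
  have sub: "R + w \<in> component (P + w)" if "R \<in> component P" for R
    using comp_translate[OF P tr that] by simp
  then show "q - w \<in> component P \<Longrightarrow> q \<in> component (P + w)" by fastforce
  assume q: "q \<in> component (P + w)"
  obtain R where R: "R \<in> component P" "Re (R / e) = Re ((q - w) / e)" using comp_all_Re by blast
  have "((R + w) / e * e) \<bullet> (1 * e) = (q / e * e) \<bullet> (1 * e)"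
    unfolding inner_div[OF period_norm(1)] using R(2) by (simp add: inner_complex_def add_divide_distrib diff_divide_distrib)
  then have "(R + w) \<bullet> e = q \<bullet> e" using period_norm(2) by simp
  then have "R + w = q" using inner_inj_on_comp[OF PwE shifts_Th(1)[OF assms] sub[OF R(1)] q] by simp
  then show "q - w \<in> component P" using R(1) by auto
qed

lemma shifts_add_Th:
  assumes "w \<in> shifts" "u \<in> crossings (P + w)"
  shows "w + u \<in> shifts"
  unfolding shifts_def
proof (safe)
  fix q assume q: "q \<in> component P"
  have PwE: "P + w \<in> E" using assms comp_self[OF P] by (auto simp: shifts_def)
  have "q + w \<in> component (P + w)" using shifts_comp[OF assms(1), of "q + w"] q by simp
  then have "u \<in> crossings (q + w)" using crossings_comp[OF assms(2) PwE] by blast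
  then show "q + (w + u) \<in> E" using crossings_E by (metis add.assoc)
qed

lemma shifts_zero: "0 \<in> shifts"
  using comp_E by (auto simp: shifts_def)

text \<open>Copies that meet are the same component, so the difference of the translations preserves
  the curve and is horizontal by \<open>height_zero\<close>.\<close>

lemma shifts_meet:
  assumes "w1 \<in> shifts" "w2 \<in> shifts" "q1 \<in> component P" "q2 \<in> component P" "q1 + w1 = q2 + w2"
  shows "Im (w1 / e) = Im (w2 / e)"
proof -
  have "q1 + w1 \<in> component (P + w1)"
    using shifts_comp[OF assms(1), of "q1 + w1"] assms(3) by simp
  moreover have "q1 + w1 \<in> component (P + w2)"
    using shifts_comp[OF assms(2), of "q2 + w2"] assms(4,5) by simp
  ultimately have eq: "component (P + w1) = component (P + w2)" using comp_eq by metis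
  have "Im ((w1 - w2) / e) = 0"
  proof (rule height_zero)
    fix q assume "q \<in> component P"
    then have "q + w1 \<in> component (P + w2)" using shifts_comp[OF assms(1), of "q + w1"] eq by simp
    then show "q + (w1 - w2) \<in> component P" using shifts_comp[OF assms(2), of "q + w1"] by (simp add: algebra_simps)
  qed
  then show ?thesis by (simp add: diff_divide_distrib)
qed

lemma shifts_discrete:
  assumes "w0 \<in> shifts"
  shows "\<exists>\<epsilon>>0. \<forall>w\<in>shifts. dist w w0 < \<epsilon> \<longrightarrow> Im (w / e) = Im (w0 / e)"
proof -
  have "P + w0 \<in> E" using assms comp_self[OF P] by (auto simp: shifts_def)
  then obtain \<delta> where \<delta>: "\<delta> > 0" "E \<inter> ball (P + w0) \<delta> \<subseteq> component (P + w0)" using comp_open[OF comp_self] by blast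
  have "Im (w / e) = Im (w0 / e)" if w: "w \<in> shifts" "dist w w0 < \<delta>" for w
  proof -
    have "P + w \<in> E" using w(1) comp_self[OF P] by (auto simp: shifts_def)
    then have "P + w \<in> component (P + w0)" using \<delta>(2) w(2) by (auto simp: dist_commute)
    then have "P + w - w0 \<in> component P" using shifts_comp[OF assms] by blast
    then show ?thesis using shifts_meet[OF w(1) assms comp_self[OF P], of "P + w - w0"] by simp
  qed
  then show ?thesis using \<delta>(1) by blast
qed

text \<open>The difference of the two sides never vanishes, because the translate avoids the curve,
  so it has constant sign. The wrong sign would let the bounded \<open>height\<close> grow without
  limit.\<close>

lemma translate_above:
  assumes "Im (u / e) > 0" "\<And>q. q \<in> component P \<Longrightarrow> q + u \<notin> component P"
  shows "height (x + Re (u / e)) < height x + Im (u / e)"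
proof (rule ccontr)
  assume neg: "\<not> ?thesis"
  define D where "D x = height (x + Re (u / e)) - (height x + Im (u / e))" for x
  have nz: "D x \<noteq> 0" for x
  proof
    assume "D x = 0"
    obtain Q where Q: "Q \<in> component P" "Re (Q / e) = x" using comp_all_Re by blast
    have "Im ((Q + u) / e) = height (Re ((Q + u) / e))"
      using \<open>D x = 0\<close> height_Im[OF Q(1)] Q(2) by (simp add: D_def add_divide_distrib)
    then show False using comp_ht assms(2) Q(1) by blast
  qed
  have cont: "continuous_on S D" for S
    unfolding D_def
    by (intro continuous_intros continuous_on_compose2[OF height_cont[of UNIV]] height_cont) auto
  have "D y > 0" for y
  proof (rule ccontr)
    assume "\<not> D y > 0"
    then have "D x > 0" "D y < 0" using neg nz[of y] nz[of x] by (auto simp: D_def)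
    then have "\<exists>t. min x y \<le> t \<and> t \<le> max x y \<and> D t = 0"
      by (intro IVT_sgn cont) (auto simp: min_def max_def mult_pos_neg mult_neg_pos less_imp_le)
    then show False using nz by blast
  qed
  then have "height x + Im (u / e) \<le> height (x + Re (u / e))" for x by (simp add: D_def less_imp_le)
  from increment_unbounded[where h = height, OF this assms(1) height_bound] show False .
qed

text \<open>If \<open>P + v\<close> lies on a copy of the curve between the curve through \<open>P\<close> and its copy
  through \<open>P + \<omega>e\<close>, then \<open>\<omega>(v - e)\<close> translates the curve to a copy that lies strictly lower.\<close>

lemma lower_translate:
  assumes w: "w \<in> shifts" "0 < Im (w / e)" "Im (w / e) < sqrt 3 / 2"
  shows "\<exists>w'\<in>shifts. 0 < Im (w' / e) \<and> Im (w' / e) < Im (w / e)"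
proof -
  define xw yw x0 where "xw = Re (w / e)" and "yw = Im (w / e)" and "x0 = Re (P / e)"
  have omM: "omega * e \<in> shifts" using shifts_add_Th[OF shifts_zero, of "omega * e"] crossings_om[OF P e] by simp
  have ome: "omega * e / e = omega" using period_norm(2) by simp
  have h1: "height (x + xw) < height x + yw" for x
    unfolding xw_def yw_def
  proof (rule translate_above)
    fix q assume "q \<in> component P"
    then show "q + w \<notin> component P" using shifts_meet[OF w(1) shifts_zero, of q "q + w"] w(2) by auto
  qed (use w in auto)
  have h2: "height (x + (1/2 - xw)) < height x + (sqrt 3 / 2 - yw)" for x
  proof -
    have "height (x + Re ((omega * e - w) / e)) < height x + Im ((omega * e - w) / e)"
    proof (rule translate_above)
      show "Im ((omega * e - w) / e) > 0" using w(3) by (simp add: diff_divide_distrib ome)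
      fix q assume q: "q \<in> component P"
      show "q + (omega * e - w) \<notin> component P"
      proof
        assume "q + (omega * e - w) \<in> component P"
        then have "Im (omega * e / e) = Im (w / e)" using shifts_meet[OF omM w(1) q, of "q + (omega * e - w)"] by simp
        then show False using w(3) ome by simp
      qed
    qed
    then show ?thesis by (simp add: diff_divide_distrib ome xw_def yw_def)
  qed
  \<comment> \<open>The height of \<open>P + cis \<theta> * e\<close> above the copy shifted by
    \<open>w\<close>, in the frame of \<open>e\<close>. At angle 0 this point is
    \<open>P + e\<close> on the original curve, below the copy; at \<open>pi/3\<close> it is
    \<open>P + omega * e\<close>, above it.\<close>
  define F where "F \<theta> = height x0 + sin \<theta> - (height (x0 + cos \<theta> - xw) + yw)" for \<theta>
  have "F 0 < 0"
  proof -
    have "height (x0 + 1 - xw) = height (x0 - xw)"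
    proof -
      obtain Q where Q: "Q \<in> component P" "Re (Q / e) = x0 - xw" using comp_all_Re by blast
      have "Q + e \<in> component P" using comp_period(1)[OF Q(1)] .
      then have "height (Re ((Q + e) / e)) = Im ((Q + e) / e)" by (rule height_Im)
      then show ?thesis using height_Im[OF Q(1)] Q(2) period_norm(2) by (simp add: add_divide_distrib algebra_simps)
    qed
    then show ?thesis using h1[of "x0 - xw"] by (simp add: F_def)
  qed
  moreover have "F (pi/3) > 0" using h2[of x0] by (simp add: F_def cos_60 sin_60 algebra_simps)
  moreover have "continuous_on {0..pi/3} F" unfolding F_def
    by (intro continuous_intros continuous_on_compose2[OF height_cont[of UNIV]]) auto
  ultimately obtain \<theta> where \<theta>: "0 \<le> \<theta>" "\<theta> \<le> pi/3" "F \<theta> = 0"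
    using IVT_sgn[of 0 "pi/3" F] by (auto simp: mult_neg_pos less_imp_le)
  have \<theta>s: "0 < \<theta>" "\<theta> < pi/3"
    using \<theta> \<open>F 0 < 0\<close> \<open>F (pi/3) > 0\<close> by (metis less_le less_irrefl)+
  define v where "v = cis \<theta> * e"
  have vr: "norm v = r" using period_norm by (simp add: v_def norm_mult)
  have ve: "v / e = cis \<theta>" using period_norm(2) by (simp add: v_def)
  have Qw: "P + v - w \<in> component P"
    unfolding comp_ht using \<theta>(3) height_Im[OF comp_self[OF P]]
    by (simp add: F_def x0_def xw_def yw_def add_divide_distrib diff_divide_distrib ve algebra_simps)
  \<comment> \<open>Coordinates of \<open>cis \<theta>\<close> in the basis \<open>1\<close>,
    \<open>omega\<close>, positive because \<open>0 < \<theta> < pi/3\<close>. So a ray whose inner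
    products with \<open>e\<close> and \<open>omega * e\<close> share a sign has the same sign
    relative to \<open>v\<close>.\<close>
  define \<alpha> \<beta> where "\<alpha> = 2 / sqrt 3 * sin (pi/3 - \<theta>)" and "\<beta> = 2 / sqrt 3 * sin \<theta>"
  have "sin (pi/3 - \<theta>) > 0" "sin \<theta> > 0" using \<theta>s by (intro sin_gt_zero; linarith)+
  then have ab: "\<alpha> > 0" "\<beta> > 0" by (simp_all add: \<alpha>_def \<beta>_def)
  have "sin (pi/3 - \<theta>) = sqrt 3 / 2 * cos \<theta> - sin \<theta> / 2"
    unfolding sin_diff by (simp add: cos_60 sin_60)
  then have "cis \<theta> = of_real \<alpha> + of_real \<beta> * omega"
    unfolding \<alpha>_def \<beta>_def by (simp add: complex_eq_iff field_simps)
  then have vab: "v = \<alpha> *\<^sub>R e + \<beta> *\<^sub>R (omega * e)" by (simp add: v_def scaleR_conv_of_real algebra_simps)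
  have ray: "\<sigma> * (d \<bullet> v) > 0" if Qd: "Q \<in> component P" "d \<in> ray_dirs Q" "\<sigma> * (d \<bullet> e) > 0" "\<sigma> = 1 \<or> \<sigma> = -1" for Q d \<sigma>
  proof -
    obtain \<delta> where \<delta>: "\<delta> > 0" "\<And>t. 0 < t \<Longrightarrow> t < \<delta> \<Longrightarrow> Q + of_real t * d \<in> component P" using comp_ray[OF Qd(1,2)] by blast
    define t where "t = \<delta>/2"
    have R: "Q + t *\<^sub>R d \<in> component P" "t > 0" using \<delta>(2)[of t] \<delta>(1) by (simp_all add: t_def scaleR_conv_of_real)
    have "\<sigma> * (d \<bullet> (omega * e)) > 0" using Qd(4)
    proof
      assume s: "\<sigma> = 1"
      show ?thesis using comp_cone(1)[OF Qd(1) R(1)] Qd(3) R(2) s by (simp add: zero_less_mult_iff)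
    next
      assume s: "\<sigma> = -1"
      show ?thesis using comp_cone(1)[OF R(1) Qd(1)] Qd(3) R(2) s by (simp add: mult_less_0_iff)
    qed
    moreover have "\<sigma> * (d \<bullet> v) = \<alpha> * (\<sigma> * (d \<bullet> e)) + \<beta> * (\<sigma> * (d \<bullet> (omega * e)))"
      by (simp add: vab inner_add_right algebra_simps)
    ultimately show ?thesis using ab Qd(3) by (simp add: add_pos_pos)
  qed
  have vT: "v \<in> crossings P"
  proof -
    define Q where "Q = P + v - w"
    have QG: "Q \<in> component P" using Qw by (simp add: Q_def)
    have QE: "Q \<in> E" using QG comp_E by auto
    have tr: "\<And>q. q \<in> component P \<Longrightarrow> q + w \<in> E" using w(1) by (auto simp: shifts_def)
    obtain d1 d2 where D: "ray_dirs Q = {d1, d2}" "d1 \<bullet> e > 0" "d2 \<bullet> e < 0" using two_rays[OF QE crossings_comp[OF e P QG]] by blast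
    obtain d where d: "d \<in> ray_dirs P" using ray_dirs_star(2)[OF P] by blast
    have sub: "ray_dirs Q \<subseteq> ray_dirs (P + v)" using ray_dirs_translate[OF QG tr] by (simp add: Q_def)
    show ?thesis
    proof (rule crossing[where d = d and ?d1.0 = d1 and ?d2.0 = d2])
      show "P + v \<in> E" using tr[OF QG] by (simp add: Q_def)
      have "d \<bullet> e \<noteq> 0" using crossings_dirs(2)[OF P e d] .
      then show "d \<bullet> v \<noteq> 0" using ray[OF comp_self[OF P] d, of 1] ray[OF comp_self[OF P] d, of "-1"] by force
      show "d1 \<bullet> v > 0" using ray[OF QG, of d1 1] D by simp
      show "d2 \<bullet> v < 0" using ray[OF QG, of d2 "-1"] D by simp
    qed (use P vr d sub D in auto)
  qed
  have vM: "v \<in> shifts" using shifts_add_Th[OF shifts_zero, of v] vT by simp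
  \<comment> \<open>\<open>v\<close> and \<open>w\<close> both carry the curve onto the copy through
    \<open>P + v\<close>, so they have the same height.\<close>
  have sy: "sin \<theta> = yw"
    using shifts_meet[OF vM w(1) comp_self[OF P] Qw] by (simp add: ve yw_def)
  have omv: "omega * v \<in> shifts" using shifts_add_Th[OF shifts_zero, of "omega * v"] crossings_om[OF P vT] by simp
  have PomvE: "P + omega * v \<in> E" using omv comp_self[OF P] by (auto simp: shifts_def)
  have "- (omega * e) \<in> crossings (P + omega * v)" by (intro crossings_minus crossings_om shifts_Th omv PomvE)
  then have "omega * v + - (omega * e) \<in> shifts" by (rule shifts_add_Th[OF omv])
  moreover have q: "(omega * v + - (omega * e)) / e = omega * cis \<theta> - omega"
    using period_norm(2) by (simp add: v_def field_simps)
  have im: "Im ((omega * v + - (omega * e)) / e) = sin \<theta> / 2 + sqrt 3 / 2 * (cos \<theta> - 1)"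
    unfolding q by (simp add: field_simps)
  moreover have "cos \<theta> < 1" using cos_monotone_0_pi[of 0 \<theta>] \<theta>s pi_gt_zero by simp
  then have "sqrt 3 / 2 * (cos \<theta> - 1) < 0" by (simp add: mult_pos_neg)
  moreover have "sin \<theta> > 0" using \<theta>s by (intro sin_gt_zero) auto
  \<comment> \<open>The height of the new translation is
    \<open>cos (\<theta> - pi/6) - cos (pi/6)\<close>, which is positive strictly between the angles
    0 and \<open>pi/3\<close>.\<close>
  moreover have "sin \<theta> / 2 + sqrt 3 / 2 * (cos \<theta> - 1) > 0"
  proof -
    have "\<bar>\<theta> - pi/6\<bar> < pi/6" using \<theta>s by linarith
    then have "cos (pi/6) < cos \<bar>\<theta> - pi/6\<bar>" by (intro cos_monotone_0_pi) (use pi_gt_zero in auto)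
    then have "cos (pi/6) < cos (\<theta> - pi/6)" by simp
    moreover have "cos (\<theta> - pi/6) = sqrt 3 / 2 * cos \<theta> + sin \<theta> / 2"
      unfolding cos_diff by (simp add: cos_30 sin_30)
    ultimately show ?thesis unfolding right_diff_distrib cos_30 by linarith
  qed
  ultimately show ?thesis using sy by (intro bexI[of _ "omega * v + - (omega * e)"]) (auto simp: yw_def)
qed

text \<open>Modulo the period, the translations with heights from 0 to \<open>sqrt 3 / 2\<close>
  form a compact set on which the height is locally constant. So only finitely many heights occur,
  and a least one strictly inside this range contradicts \<open>lower_translate\<close>.\<close>

lemma shifts_gap:
  assumes "w \<in> shifts" "0 < Im (w / e)" "Im (w / e) < sqrt 3 / 2"
  shows False
proof -
  define K where "K = shifts \<inter> {w. 0 \<le> Re (w / e)} \<inter> {w. Re (w / e) \<le> 1} \<inter> {w. 0 \<le> Im (w / e)} \<inter> {w. Im (w / e) \<le> sqrt 3 / 2}"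
  have "closed K" unfolding K_def
    by (intro closed_Int shifts_closed closed_Collect_le continuous_intros) (use period_norm in auto)
  moreover have "bounded K"
  proof -
    have "norm w \<le> r * (1 + sqrt 3 / 2)" if "w \<in> K" for w
    proof -
      have "norm (w / e) \<le> \<bar>Re (w / e)\<bar> + \<bar>Im (w / e)\<bar>" by (rule cmod_le)
      also have "\<dots> \<le> 1 + sqrt 3 / 2" using that by (auto simp: K_def)
      finally show ?thesis using period_norm r_pos by (simp add: norm_divide field_simps)
    qed
    then show ?thesis by (auto simp: bounded_iff)
  qed
  ultimately have "compact K" by (simp add: compact_eq_bounded_closed)
  have "\<forall>w0\<in>K. \<exists>\<epsilon>>0. \<forall>w\<in>shifts. dist w w0 < \<epsilon> \<longrightarrow> Im (w / e) = Im (w0 / e)"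
    using shifts_discrete by (auto simp: K_def)
  then obtain \<epsilon> where \<epsilon>: "\<And>w0. w0 \<in> K \<Longrightarrow> \<epsilon> w0 > 0"
    "\<And>w0 w. w0 \<in> K \<Longrightarrow> w \<in> shifts \<Longrightarrow> dist w w0 < \<epsilon> w0 \<Longrightarrow> Im (w / e) = Im (w0 / e)" by metis
  obtain T where T: "T \<subseteq> K" "finite T" "K \<subseteq> (\<Union>w0\<in>T. ball w0 (\<epsilon> w0))"
  proof (rule compactE_image[OF \<open>compact K\<close>, of K "\<lambda>w0. ball w0 (\<epsilon> w0)"])
    show "K \<subseteq> (\<Union>w0\<in>K. ball w0 (\<epsilon> w0))" using \<epsilon>(1) centre_in_ball by blast
  qed auto
  define S where "S = {y. 0 < y \<and> y < sqrt 3 / 2 \<and> (\<exists>w\<in>shifts. Im (w / e) = y)}"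
  have "S \<subseteq> (\<lambda>w. Im (w / e)) ` T"
  proof
    fix y assume "y \<in> S"
    then obtain w where w: "w \<in> shifts" "Im (w / e) = y" "0 < y" "y < sqrt 3 / 2" by (auto simp: S_def)
    define w' where "w' = w + of_int (- \<lfloor>Re (w / e)\<rfloor>) * e"
    have "w' / e = w / e - of_int \<lfloor>Re (w / e)\<rfloor>" using period_norm(2) by (simp add: w'_def diff_divide_distrib add_divide_distrib)
    then have "Re (w' / e) = Re (w / e) - of_int \<lfloor>Re (w / e)\<rfloor>" "Im (w' / e) = y" using w(2) by simp_all
    moreover have "w' \<in> shifts" unfolding w'_def using shifts_period[OF w(1)] .
    moreover have "0 \<le> Re (w / e) - of_int \<lfloor>Re (w / e)\<rfloor>" "Re (w / e) - of_int \<lfloor>Re (w / e)\<rfloor> \<le> 1" by linarith+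
    ultimately have "w' \<in> K" using w by (simp add: K_def)
    then obtain w0 where "w0 \<in> T" "dist w' w0 < \<epsilon> w0" using T(3) by (auto simp: dist_commute)
    then have "Im (w' / e) = Im (w0 / e)" using \<epsilon>(2) T(1) \<open>w' \<in> shifts\<close> by blast
    then show "y \<in> (\<lambda>w. Im (w / e)) ` T" using \<open>w0 \<in> T\<close> \<open>Im (w' / e) = y\<close> by auto
  qed
  then have "finite S" using T(2) finite_subset by blast
  moreover have "S \<noteq> {}" using assms by (auto simp: S_def)
  ultimately have "Min S \<in> S" "\<And>y. y \<in> S \<Longrightarrow> Min S \<le> y" by auto
  moreover from this(1) obtain w where "w \<in> shifts" "Im (w / e) = Min S" "0 < Min S" "Min S < sqrt 3 / 2" by (auto simp: S_def)
  then obtain w' where "w' \<in> shifts" "0 < Im (w' / e)" "Im (w' / e) < Min S" using lower_translate[of w] by auto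
  then have "Im (w' / e) \<in> S" using \<open>Min S < sqrt 3 / 2\<close> by (auto simp: S_def)
  ultimately show False using \<open>Im (w' / e) < Min S\<close> by fastforce
qed

end

end

text \<open>\<open>component\<close> and \<open>shifts\<close> refer to \<open>E\<close> and
  \<open>P\<close> but not to the radius, so the periods of both lengths act on the same
  curve.\<close>

lemma two_radii:
  assumes "plane_coloring_radius Bo Wo E a" "plane_coloring_radius Bo Wo E b" "a < b" "E \<noteq> {}"
  shows False
proof -
  interpret A: plane_coloring_radius Bo Wo E a by fact
  interpret B: plane_coloring_radius Bo Wo E b by fact
  obtain P where P: "P \<in> E" using assms(4) by blast
  obtain ea where ea: "ea \<in> A.crossings P" "P + ea \<in> A.component P" using A.exists_period[OF P] by blast
  obtain eb where eb: "eb \<in> B.crossings P" "P + eb \<in> A.component P" using B.exists_period[OF P] by blast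
  have nz: "eb \<noteq> 0" and n: "norm ea = a" "norm eb = b" using B.crossings_nz[OF eb(1)] A.crossings_norm[OF ea(1)] B.crossings_norm[OF eb(1)] by auto
  define \<kappa> where "\<kappa> = Re (ea / eb)"
  have "Im (ea / eb) = 0"
    using A.comp_period(1)[OF P ea] B.height_zero[OF P eb, of ea] by blast
  then have "ea / eb = of_real \<kappa>" by (simp add: \<kappa>_def complex_eq_iff)
  then have eq: "ea = of_real \<kappa> * eb" using nz by (simp add: field_simps)
  then have "a = \<bar>\<kappa>\<bar> * b" using n by (simp add: norm_mult)
  then have k: "0 < \<bar>\<kappa>\<bar>" "\<bar>\<kappa>\<bar> < 1" using A.r_pos B.r_pos assms(3) by (auto simp: zero_less_mult_iff)
  \<comment> \<open>The period of length \<open>a\<close> or its negative, oriented like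
    \<open>eb\<close>, so that its rotation by \<open>omega\<close> has positive height.\<close>
  define u where "u = of_real \<bar>\<kappa>\<bar> * eb"
  have "u = ea \<or> u = - ea" by (auto simp: u_def eq abs_if)
  then have "u \<in> A.crossings P" using ea(1) A.crossings_minus[OF P ea(1)] by auto
  then have "omega * u \<in> A.crossings P" by (rule A.crossings_om[OF P])
  then have "q + omega * u \<in> E" if "q \<in> A.component P" for q
    using A.crossings_E[OF A.crossings_comp[OF _ P that]] by blast
  then have "omega * u \<in> B.shifts P" by (simp add: B.shifts_def[OF P eb])
  moreover have "Im (omega * u / eb) = \<bar>\<kappa>\<bar> * (sqrt 3 / 2)" using nz by (simp add: u_def)
  moreover have "0 < \<bar>\<kappa>\<bar> * (sqrt 3 / 2)" "\<bar>\<kappa>\<bar> * (sqrt 3 / 2) < 1 * (sqrt 3 / 2)"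
    using k by (simp, intro mult_strict_right_mono) auto
  ultimately show False using B.shifts_gap[OF P eb, of "omega * u"] by simp
qed

section \<open>Equilateral triangles and transfer from the plane\<close>

text \<open>The colours are forced one after another, each by a copy of the triangle
  \<open>0\<close>, \<open>u\<close>, \<open>w\<close> with two vertices of one known colour, until
  one copy becomes monochromatic. The rotations used are the six sixth roots of unity.\<close>

lemma eight_points:
  fixes u w x :: complex and Bl Wh :: "complex set"
  assumes B: "\<And>p \<zeta>. norm \<zeta> = 1 \<Longrightarrow> \<not> (p \<in> Bl \<and> p + \<zeta> * u \<in> Bl \<and> p + \<zeta> * w \<in> Bl)"
    and W: "\<And>p \<zeta>. norm \<zeta> = 1 \<Longrightarrow> \<not> (p \<in> Wh \<and> p + \<zeta> * u \<in> Wh \<and> p + \<zeta> * w \<in> Wh)"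
    and col: "\<And>f. f \<in> {w, omega * w, u - w + omega * w, u + omega * w, u - omega * u + omega * w} \<Longrightarrow> x + f \<in> Bl \<union> Wh"
    and black: "x \<in> Bl" "x + u \<in> Bl" "x + omega * u \<in> Bl"
  shows False
proof -
  have n: "norm (- 1 :: complex) = 1" "norm (omega * omega) = 1" "norm (1 - omega) = 1" "norm (- omega) = 1"
    using omega_cnj(2) norm_om by (simp_all add: norm_mult) (metis complex_mod_cnj norm_om)
  have 1: "x + w \<in> Wh" using B[of 1 x] col[of w] black by auto
  have 2: "x + omega * w \<in> Wh" using B[of omega x] col[of "omega * w"] black by auto
  have "x + u + omega * omega * u = x + omega * u" "x + u + omega * omega * w = x + (u - w + omega * w)"
    unfolding omega_cnj by (simp_all add: algebra_simps)
  then have "x + (u - w + omega * w) \<notin> Bl" using B[OF n(2), of "x + u"] black(2,3) by metis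
  then have 3: "x + (u - w + omega * w) \<in> Wh" using col[of "u - w + omega * w"] by auto
  have "x + (u + omega * w) + - 1 * u = x + omega * w" "x + (u + omega * w) + - 1 * w = x + (u - w + omega * w)" by simp_all
  then have "x + (u + omega * w) \<notin> Wh" using W[OF n(1), of "x + (u + omega * w)"] 2 3 by metis
  then have 4: "x + (u + omega * w) \<in> Bl" using col[of "u + omega * w"] by auto
  have "x + omega * w + (1 - omega) * u = x + (u - omega * u + omega * w)" "x + omega * w + (1 - omega) * w = x + w"
    by (simp_all add: algebra_simps)
  then have "x + (u - omega * u + omega * w) \<notin> Wh" using W[OF n(3), of "x + omega * w"] 1 2 by metis
  then have 5: "x + (u - omega * u + omega * w) \<in> Bl" using col[of "u - omega * u + omega * w"] by auto
  have "x + (u + omega * w) + - omega * u = x + (u - omega * u + omega * w)" "x + (u + omega * w) + - omega * w = x + u" by simp_all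
  then show False using B[OF n(4), of "x + (u + omega * w)"] 4 5 black(2) by metis
qed

context plane_coloring
begin

text \<open>\<open>E\<close> has empty interior, since its points are limits of black points. So
  each condition leaves a nonempty open set, and finitely many can be imposed in turn.\<close>

lemma generic_translate:
  assumes "finite F" "open U" "U \<noteq> {}"
  shows "\<exists>V. open V \<and> V \<noteq> {} \<and> V \<subseteq> U \<and> (\<forall>x\<in>V. \<forall>f\<in>F. x + f \<notin> E)"
  using assms(1)
proof (induction F)
  case empty
  then show ?case using assms by blast
next
  case (insert f F)
  then obtain V where V: "open V" "V \<noteq> {}" "V \<subseteq> U" "\<forall>x\<in>V. \<forall>f\<in>F. x + f \<notin> E" by blast
  define V' where "V' = V \<inter> (\<lambda>x. x + f) -` (- E)"
  have "open V'" unfolding V'_def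
    using V(1) closed_E by (intro open_Int open_vimage continuous_intros) auto
  moreover have "V' \<noteq> {}"
  proof
    assume "V' = {}"
    then have sub: "(\<lambda>x. x + f) ` V \<subseteq> E" by (auto simp: V'_def)
    have op: "open ((\<lambda>x. x + f) ` V)" using open_translation[OF V(1), of f] by (simp add: add.commute)
    obtain y where y: "y \<in> (\<lambda>x. x + f) ` V" using V(2) by auto
    then have "y \<in> closure Bo" using sub E_Bo by auto
    then obtain z where "z \<in> Bo" "z \<in> (\<lambda>x. x + f) ` V" using op y closure_iff_nhds_not_empty by blast
    then show False using sub E_eq by auto
  qed
  ultimately show ?case using V by (intro exI[of _ V']) (auto simp: V'_def)
qed

text \<open>A triangle with vertices in an open colour class can be moved slightly without changing
  its colour, until the five further points of \<open>eight_points\<close> are off the boundary and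
  so have a colour as well.\<close>

lemma no_equilateral:
  assumes T: "\<And>p \<zeta>. norm \<zeta> = 1 \<Longrightarrow> \<not> (p \<in> Bo \<and> p + \<zeta> * u \<in> Bo \<and> p + \<zeta> * w \<in> Bo) \<and>
      \<not> (p \<in> Wo \<and> p + \<zeta> * u \<in> Wo \<and> p + \<zeta> * w \<in> Wo)"
    and "u \<noteq> 0"
  shows "plane_coloring_radius Bo Wo E (norm u)"
proof
  show "norm u > 0" using assms(2) by simp
  have main: False
    if C: "C = Bo \<and> C' = Wo \<or> C = Wo \<and> C' = Bo" and v: "norm v = norm u" and m: "p \<in> C" "p + v \<in> C" "p + omega * v \<in> C" for p v C C'
  proof -
    define \<zeta> where "\<zeta> = v / u"
    have z: "norm \<zeta> = 1" "v = \<zeta> * u" using v assms(2) by (auto simp: \<zeta>_def norm_divide)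
    define y where "y = \<zeta> * w"
    have T': "\<not> (q \<in> X \<and> q + \<eta> * v \<in> X \<and> q + \<eta> * y \<in> X)" if "X = Bo \<or> X = Wo" "norm \<eta> = 1" for X q \<eta>
      using T[of "\<eta> * \<zeta>" q] that z by (auto simp: y_def norm_mult mult.assoc)
    define U where "U = C \<inter> (\<lambda>x. x + v) -` C \<inter> (\<lambda>x. x + omega * v) -` C"
    have "open C" using C open_Bo open_Wo by auto
    then have "open U" unfolding U_def by (intro open_Int open_vimage continuous_intros)
    moreover have "p \<in> U" using m by (simp add: U_def)
    ultimately obtain V where V: "V \<noteq> {}" "V \<subseteq> U"
      "\<forall>x\<in>V. \<forall>f\<in>{y, omega * y, v - y + omega * y, v + omega * y, v - omega * v + omega * y}. x + f \<notin> E"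
      using generic_translate[of "{y, omega * y, v - y + omega * y, v + omega * y, v - omega * v + omega * y}" U] by auto
    then obtain x where x: "x \<in> V" by auto
    have CC: "- E = C \<union> C'" using C E_eq by auto
    show False
    proof (rule eight_points[of C v y C' x])
      show "x + f \<in> C \<union> C'" if "f \<in> {y, omega * y, v - y + omega * y, v + omega * y, v - omega * v + omega * y}" for f
        using V(3) x that CC by blast
      show "x \<in> C" "x + v \<in> C" "x + omega * v \<in> C" using V(2) x by (auto simp: U_def)
    qed (use T' C in blast)+
  qed
  show "\<not> (p \<in> Bo \<and> p + v \<in> Bo \<and> p + omega * v \<in> Bo)" if "norm v = norm u" for p v
    using main[of Bo Wo v p] that by blast
  show "\<not> (p \<in> Wo \<and> p + v \<in> Wo \<and> p + omega * v \<in> Wo)" if "norm v = norm u" for p v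
    using main[of Wo Bo v p] that by blast
qed

end

lemma (in plane_coloring_radius) E_nonempty: "E \<noteq> {}"
proof
  assume "E = {}"
  then have "UNIV \<subseteq> Bo \<or> UNIV \<subseteq> Wo" using connected_one_color[of UNIV] by auto
  moreover have "norm (of_real r :: complex) = r" using r_pos by simp
  ultimately show False using no_Bo[of "of_real r" 0] no_Wo[of "of_real r" 0] by blast
qed

section \<open>Transfer from the real plane to the complex numbers\<close>

definition cpx :: "plane \<Rightarrow> complex" where "cpx p = Complex (p $ 1) (p $ 2)"
definition vec2 :: "complex \<Rightarrow> plane" where "vec2 z = vector [Re z, Im z]"

lemma cpx_vec2 [simp]: "cpx (vec2 z) = z" "vec2 (cpx p) = p"
  by (simp_all add: cpx_def vec2_def vec_eq_iff forall_2)

lemma cpx_linear: "linear cpx"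
  by (rule linearI) (simp_all add: cpx_def complex_eq_iff)

lemma vec2_linear: "linear vec2"
  by (rule linearI) (simp_all add: vec2_def vec_eq_iff forall_2)

lemma norm_cpx [simp]: "norm (cpx p) = norm p"
  by (simp add: cpx_def cmod_def norm_vec_def L2_set_def sum_2)

lemma cpx_image: "cpx ` S = vec2 -` S"
  by (force simp: image_iff)

lemma open_cpx: "open S \<Longrightarrow> open (cpx ` S)"
  unfolding cpx_image using vec2_linear by (intro open_vimage linear_continuous_on linear_conv_bounded_linear[THEN iffD1])

lemma closure_cpx: "cpx ` closure S \<subseteq> closure (cpx ` S)"
  using cpx_linear by (intro image_closure_subset linear_continuous_on linear_conv_bounded_linear[THEN iffD1]) (auto simp: closure_subset)

text \<open>\<open>P\<close> and \<open>N\<close> record whether the parameter interval continues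
  forwards and backwards from \<open>t0\<close>. Inner points and endpoints of segments, half-lines
  and lines are thus treated together.\<close>

lemma ray_star:
  fixes a d :: "'a::real_normed_vector"
  assumes "d \<noteq> 0" "\<eta> > 0" "P \<or> N"
    and I: "\<And>s. \<bar>s\<bar> < \<eta> \<Longrightarrow> t0 + s \<in> I \<longleftrightarrow> (s \<ge> 0 \<and> P) \<or> (s \<le> 0 \<and> N)"
  shows "\<exists>\<delta> D. \<delta> > 0 \<and> finite D \<and> D \<noteq> {} \<and> (\<forall>d\<in>D. norm d = 1) \<and>
    (\<forall>x. norm x < \<delta> \<longrightarrow> (a + t0 *\<^sub>R d + x \<in> {a + t *\<^sub>R d | t. t \<in> I} \<longleftrightarrow> (\<exists>d\<in>D. \<exists>t\<ge>0. x = t *\<^sub>R d)))"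
proof -
  define n where "n = d /\<^sub>R norm d"
  have n: "norm n = 1" "d = norm d *\<^sub>R n" using assms(1) by (simp_all add: n_def)
  define D where "D = (if P then {n} else {}) \<union> (if N then {- n} else {})"
  have "a + t0 *\<^sub>R d + x \<in> {a + t *\<^sub>R d | t. t \<in> I} \<longleftrightarrow> (\<exists>d\<in>D. \<exists>t\<ge>0. x = t *\<^sub>R d)"
    if x: "norm x < \<eta> * norm d" for x
  proof
    assume "a + t0 *\<^sub>R d + x \<in> {a + t *\<^sub>R d | t. t \<in> I}"
    then obtain t where t: "t \<in> I" "t0 *\<^sub>R d + x = t *\<^sub>R d" by (auto simp: add.assoc)
    define s where "s = t - t0"
    have xs: "x = s *\<^sub>R d" using t(2) by (simp add: s_def algebra_simps)
    have "\<bar>s\<bar> < \<eta>" using x assms(1) by (simp add: xs)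
    then have "(s \<ge> 0 \<and> P) \<or> (s \<le> 0 \<and> N)" using I[of s] t(1) by (simp add: s_def)
    then show "\<exists>d\<in>D. \<exists>t\<ge>0. x = t *\<^sub>R d"
    proof
      assume "s \<ge> 0 \<and> P"
      then show ?thesis using n(2) xs unfolding D_def
        by (intro bexI[of _ n] exI[of _ "s * norm d"]) (auto simp: n_def)
    next
      assume "s \<le> 0 \<and> N"
      then show ?thesis using n(2) xs unfolding D_def
        by (intro bexI[of _ "- n"] exI[of _ "- s * norm d"]) (auto simp: n_def mult_nonpos_nonneg)
    qed
  next
    assume "\<exists>d\<in>D. \<exists>t\<ge>0. x = t *\<^sub>R d"
    then obtain d' t where t: "d' \<in> D" "t \<ge> 0" "x = t *\<^sub>R d'" by blast
    define \<sigma> where "\<sigma> = (if d' = n \<and> P then 1 else - 1 :: real)"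
    have d': "d' = \<sigma> *\<^sub>R n" "\<sigma> = 1 \<and> P \<or> \<sigma> = - 1 \<and> N" using t(1) by (auto simp: D_def \<sigma>_def split: if_splits)
    define s where "s = \<sigma> * t / norm d"
    have xs: "x = s *\<^sub>R d" using t d' assms(1) by (simp add: s_def n_def divide_inverse mult_ac)
    have "\<bar>s\<bar> < \<eta>" using x assms(1) by (simp add: xs)
    moreover have "(s \<ge> 0 \<and> P) \<or> (s \<le> 0 \<and> N)" using d'(2) t(2) by (auto simp: s_def)
    ultimately have "t0 + s \<in> I" using I by blast
    then show "a + t0 *\<^sub>R d + x \<in> {a + t *\<^sub>R d | t. t \<in> I}"
      by (auto simp: xs algebra_simps intro!: exI[of _ "t0 + s"])
  qed
  moreover have "finite D" "D \<noteq> {}" "\<forall>d\<in>D. norm d = 1" using n assms(3) by (auto simp: D_def)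
  moreover have "\<eta> * norm d > 0" using assms(1,2) by simp
  ultimately show ?thesis by blast
qed

lemma segment_interval:
  assumes "straight_segment S"
  shows "\<exists>a d I. d \<noteq> 0 \<and> S = {a + t *\<^sub>R d | t. t \<in> I} \<and> (I = {0..1} \<or> I = {0..} \<or> I = UNIV)"
proof -
  have seg: "closed_segment a b = {a + t *\<^sub>R (b - a) | t. t \<in> {0..1}}" for a b :: plane
    by (auto simp: closed_segment_def algebra_simps)
  show ?thesis using assms unfolding straight_segment_def half_line_def full_line_def
  proof (elim disjE exE conjE)
    fix a b assume "a \<noteq> b" "S = closed_segment a b"
    then show ?thesis using seg by (intro exI[of _ a] exI[of _ "b - a"] exI[of _ "{0..1}"]) auto
  next
    fix a d :: plane assume "d \<noteq> 0" "S = {a + t *\<^sub>R d | t. 0 \<le> t}"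
    then show ?thesis by (intro exI[of _ a] exI[of _ d] exI[of _ "{0..}"]) auto
  next
    fix a d :: plane assume "d \<noteq> 0" "S = {a + t *\<^sub>R d | t. True}"
    then show ?thesis by (intro exI[of _ a] exI[of _ d] exI[of _ UNIV]) auto
  qed
qed

lemma segment_closed:
  assumes "straight_segment S"
  shows "closed S"
proof -
  obtain a d I where d: "d \<noteq> 0" and S: "S = {a + t *\<^sub>R d | t. t \<in> I}" and I: "I = {0..1} \<or> I = {0..} \<or> I = UNIV"
    using segment_interval[OF assms] by blast
  have "closed ((\<lambda>t. t *\<^sub>R d) ` I)"
    using I d by (intro closed_injective_linear_image) (auto simp: inj_on_def intro!: linearI algebra_simps)
  then have "closed ((+) a ` ((\<lambda>t. t *\<^sub>R d) ` I))" by (rule closed_translation)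
  moreover have "(+) a ` ((\<lambda>t. t *\<^sub>R d) ` I) = S" by (auto simp: S)
  ultimately show ?thesis by simp
qed

lemma segment_star:
  assumes "straight_segment S" "v \<in> S"
  shows "\<exists>\<delta> D. \<delta> > 0 \<and> finite D \<and> D \<noteq> {} \<and> (\<forall>d\<in>D. norm d = 1) \<and>
    (\<forall>x. norm x < \<delta> \<longrightarrow> (v + x \<in> S \<longleftrightarrow> (\<exists>d\<in>D. \<exists>t\<ge>0. x = t *\<^sub>R d)))"
proof -
  obtain a d I where d: "d \<noteq> 0" and S: "S = {a + t *\<^sub>R d | t. t \<in> I}" and I: "I = {0..1} \<or> I = {0..} \<or> I = UNIV"
    using segment_interval[OF assms(1)] by blast
  obtain t0 where t0: "t0 \<in> I" "v = a + t0 *\<^sub>R d" using assms(2) S by auto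
  define N P where "N \<longleftrightarrow> I = UNIV \<or> t0 > 0" and "P \<longleftrightarrow> I \<noteq> {0..1} \<or> t0 < 1"
  \<comment> \<open>A step shorter than \<open>\<eta>\<close> reaches neither 0 from the right nor 1
    from the left; 1 is the default where no such bound applies.\<close>
  define \<eta> where "\<eta> = min (if t0 > 0 then t0 else 1) (if t0 < 1 then 1 - t0 else 1)"
  have ne: "{0..1} \<noteq> (UNIV :: real set)" "{0..} \<noteq> (UNIV :: real set)" "{0..1} \<noteq> {0 :: real..}"
  proof -
    have "(2::real) \<notin> {0..1}" "(2::real) \<in> {0..}" "(- 1::real) \<notin> {0..}" by auto
    then show "{0..1} \<noteq> (UNIV :: real set)" "{0..} \<noteq> (UNIV :: real set)" "{0..1} \<noteq> {0 :: real..}" by blast+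
  qed
  show ?thesis unfolding S t0(2)
  proof (rule ray_star[OF d])
    show "\<eta> > 0" by (simp add: \<eta>_def)
    show "P \<or> N" by (auto simp: P_def N_def)
    show "t0 + s \<in> I \<longleftrightarrow> (s \<ge> 0 \<and> P) \<or> (s \<le> 0 \<and> N)" if "\<bar>s\<bar> < \<eta>" for s
      using I that t0(1) ne by (auto simp: P_def N_def \<eta>_def split: if_splits)
  qed
qed

text \<open>By local finiteness only finitely many segments come within distance 1 of
  \<open>v\<close>. Those through \<open>v\<close> contribute their rays; the others are closed and
  keep a positive distance.\<close>

lemma union_star:
  assumes seg: "boundary_segments \<S> C" and v: "v \<in> C"
  shows "\<exists>D \<delta>. finite D \<and> D \<noteq> {} \<and> \<delta> > 0 \<and> (\<forall>d\<in>D. norm d = 1) \<and>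
    (\<forall>x. norm x < \<delta> \<longrightarrow> (v + x \<in> C \<longleftrightarrow> (\<exists>d\<in>D. \<exists>t\<ge>0. x = t *\<^sub>R d)))"
proof -
  have S: "\<And>S. S \<in> \<S> \<Longrightarrow> straight_segment S" "\<Union>\<S> = C" "finite {S\<in>\<S>. S \<inter> ball v 1 \<noteq> {}}"
    using seg unfolding boundary_segments_def by auto
  define T where "T = {S\<in>\<S>. S \<inter> ball v 1 \<noteq> {}}"
  \<comment> \<open>\<open>D\<close> may be empty here, which covers the segments near
    \<open>v\<close> that miss it.\<close>
  define star where "star R \<delta> D \<longleftrightarrow> \<delta> > 0 \<and> finite D \<and> (v \<in> R \<longrightarrow> D \<noteq> {}) \<and> (\<forall>d\<in>D. norm d = 1) \<and>
    (\<forall>x. norm x < \<delta> \<longrightarrow> (v + x \<in> R \<longleftrightarrow> (\<exists>d\<in>D. \<exists>t\<ge>0. x = t *\<^sub>R d)))" for R \<delta> D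
  have "\<forall>R\<in>T. \<exists>\<delta> D. star R \<delta> D"
  proof
    fix R assume "R \<in> T"
    then have R: "straight_segment R" using S(1) by (simp add: T_def)
    show "\<exists>\<delta> D. star R \<delta> D"
    proof (cases "v \<in> R")
      case True
      obtain \<delta> D where "\<delta> > 0" "finite D" "D \<noteq> {}" "\<forall>d\<in>D. norm d = 1"
        "\<forall>x. norm x < \<delta> \<longrightarrow> (v + x \<in> R \<longleftrightarrow> (\<exists>d\<in>D. \<exists>t\<ge>0. x = t *\<^sub>R d))"
        using segment_star[OF R True] by blast
      then show ?thesis unfolding star_def by (intro exI[of _ \<delta>] exI[of _ D] conjI impI)
    next
      case False
      have "open (- R)" using segment_closed[OF R] by (simp add: open_Compl)
      then obtain e where e: "e > 0" "ball v e \<subseteq> - R" using False openE by blast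
      have "v + x \<notin> R" if "norm x < e" for x
      proof -
        have "v + x \<in> ball v e" using that by (simp add: dist_norm)
        then show ?thesis using e(2) by blast
      qed
      then show ?thesis unfolding star_def using e(1) False by (intro exI[of _ e] exI[of _ "{}"]) auto
    qed
  qed
  then obtain \<delta> D where "\<And>R. R \<in> T \<Longrightarrow> star R (\<delta> R) (D R)" by metis
  then have D: "\<And>R. R \<in> T \<Longrightarrow> \<delta> R > 0 \<and> finite (D R) \<and> (v \<in> R \<longrightarrow> D R \<noteq> {}) \<and> (\<forall>d\<in>D R. norm d = 1)"
    "\<And>R x. R \<in> T \<Longrightarrow> norm x < \<delta> R \<Longrightarrow> v + x \<in> R \<longleftrightarrow> (\<exists>d\<in>D R. \<exists>t\<ge>0. x = t *\<^sub>R d)"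
    unfolding star_def by blast+
  define \<epsilon> where "\<epsilon> = Min (insert 1 (\<delta> ` T))"
  have fin: "finite T" using S(3) by (simp add: T_def)
  have \<epsilon>: "\<epsilon> > 0" unfolding \<epsilon>_def using fin D(1) by (subst Min_gr_iff) auto
  have le: "\<epsilon> \<le> 1" "\<And>R. R \<in> T \<Longrightarrow> \<epsilon> \<le> \<delta> R" unfolding \<epsilon>_def using fin by (auto intro: Min_le)
  show ?thesis
  proof (intro exI[of _ "\<Union>R\<in>T. D R"] exI[of _ \<epsilon>] conjI allI impI)
    show "finite (\<Union>R\<in>T. D R)" using fin D(1) by auto
    obtain R where "R \<in> \<S>" "v \<in> R" using v S(2) by blast
    moreover from this have "v \<in> R \<inter> ball v 1" by simp
    ultimately have "R \<in> T" unfolding T_def by blast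
    then show "(\<Union>R\<in>T. D R) \<noteq> {}" using D(1)[of R] \<open>v \<in> R\<close> by blast
    show "\<forall>d\<in>\<Union>R\<in>T. D R. norm d = 1" using D(1) by blast
    fix x :: plane assume x: "norm x < \<epsilon>"
    have "v + x \<in> ball v 1" using x le(1) by (simp add: dist_norm)
    then have "v + x \<in> C \<longleftrightarrow> (\<exists>R\<in>T. v + x \<in> R)" unfolding T_def S(2)[symmetric] by blast
    also have "\<dots> \<longleftrightarrow> (\<exists>R\<in>T. \<exists>d\<in>D R. \<exists>t\<ge>0. x = t *\<^sub>R d)"
      using D(2) le(2) x by (meson less_le_trans)
    finally show "v + x \<in> C \<longleftrightarrow> (\<exists>d\<in>\<Union>R\<in>T. D R. \<exists>t\<ge>0. x = t *\<^sub>R d)" by blast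
  qed fact
qed

lemma polygonal_plane_coloring:
  assumes "polygonal_coloring B W"
  shows "plane_coloring (cpx ` interior B) (cpx ` interior W) (cpx ` coloring_boundary B W)"
proof
  have col: "coloring B W" and B: "B \<subseteq> closure (interior B)" and W: "W \<subseteq> closure (interior W)"
    using assms by (auto simp: polygonal_coloring_def)
  obtain \<S> where \<S>: "boundary_segments \<S> (coloring_boundary B W)"
    using assms by (auto simp: polygonal_coloring_def)
  have WB: "W = - B" using col by (auto simp: coloring_def)
  have bd: "coloring_boundary B W = frontier B" "coloring_boundary B W = frontier W"
    using coloring_boundary_commute[OF col] by auto
  show "open (cpx ` interior B)" "open (cpx ` interior W)" by (auto intro: open_cpx)
  show "cpx ` interior B \<inter> cpx ` interior W = {}"
    using interior_subset[of B] interior_subset[of W] WB unfolding cpx_image by auto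
  have "interior W = - closure B" by (simp add: WB interior_complement)
  then have "coloring_boundary B W = - (interior B \<union> interior W)"
    unfolding bd(1) frontier_def by auto
  then show "cpx ` coloring_boundary B W = - (cpx ` interior B \<union> cpx ` interior W)"
    unfolding cpx_image by auto
  have "coloring_boundary B W \<subseteq> closure (interior B)"
    using closure_mono[OF B] unfolding bd(1) frontier_def by auto
  then show "cpx ` coloring_boundary B W \<subseteq> closure (cpx ` interior B)" using closure_cpx by blast
  have "coloring_boundary B W \<subseteq> closure (interior W)"
    using closure_mono[OF W] unfolding bd(2) frontier_def by auto
  then show "cpx ` coloring_boundary B W \<subseteq> closure (cpx ` interior W)" using closure_cpx by blast
  fix P assume "P \<in> cpx ` coloring_boundary B W"
  then obtain v where v: "v \<in> coloring_boundary B W" "P = cpx v" by auto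
  obtain D \<delta> where D: "finite D" "D \<noteq> {}" "\<delta> > 0" "\<forall>d\<in>D. norm d = 1"
    "\<And>x. norm x < \<delta> \<Longrightarrow> (v + x \<in> coloring_boundary B W \<longleftrightarrow> (\<exists>d\<in>D. \<exists>t\<ge>0. x = t *\<^sub>R d))"
    using union_star[OF \<S> v(1)] by blast
  have sc: "cpx (t *\<^sub>R d) = of_real t * cpx d" for t d
    using linear_scale[OF cpx_linear] by (simp add: scaleR_conv_of_real)
  have "P + x \<in> cpx ` coloring_boundary B W \<longleftrightarrow> (\<exists>d\<in>cpx ` D. \<exists>t\<ge>0. x = of_real t * d)"
    if x: "norm x < \<delta>" for x
  proof -
    define y where "y = vec2 x"
    have xy: "x = cpx y" by (simp add: y_def)
    have "P + x = cpx (v + y)" using linear_add[OF cpx_linear] by (simp add: v(2) xy)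
    then have "P + x \<in> cpx ` coloring_boundary B W \<longleftrightarrow> v + y \<in> coloring_boundary B W" by (simp add: cpx_image)
    also have "\<dots> \<longleftrightarrow> (\<exists>d\<in>D. \<exists>t\<ge>0. y = t *\<^sub>R d)" using D(5)[of y] x by (simp add: xy)
    also have "\<dots> \<longleftrightarrow> (\<exists>d\<in>D. \<exists>t\<ge>0. x = of_real t * cpx d)"
      unfolding xy sc[symmetric] by (metis cpx_vec2(2))
    finally show ?thesis by simp
  qed
  then show "\<exists>D \<delta>. finite D \<and> D \<noteq> {} \<and> \<delta> > 0 \<and> (\<forall>d\<in>D. norm d = 1) \<and>
    (\<forall>x. norm x < \<delta> \<longrightarrow> (P + x \<in> cpx ` coloring_boundary B W \<longleftrightarrow> (\<exists>d\<in>D. \<exists>t\<ge>0. x = of_real t * d)))"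
    using D(1-4) by (intro exI[of _ "cpx ` D"] exI[of _ \<delta>]) auto
qed

text \<open>\<open>Q\<close> is the matrix of multiplication by \<open>\<zeta>\<close>, and the
  translation is chosen to send \<open>X\<close> to \<open>vec2 p\<close>.\<close>

lemma copy_of_triple:
  assumes "norm \<zeta> = 1"
  shows "copy_of {X, Y, Z} {vec2 p, vec2 (p + \<zeta> * cpx (Y - X)), vec2 (p + \<zeta> * cpx (Z - X))}"
proof -
  define Q :: "real^2^2" where "Q = vector [vector [Re \<zeta>, - Im \<zeta>], vector [Im \<zeta>, Re \<zeta>]]"
  have z: "Re \<zeta> * Re \<zeta> + Im \<zeta> * Im \<zeta> = 1" using assms by (metis cmod_power2 one_power2 power2_eq_square)
  have "orthogonal_matrix Q"
    using z by (simp add: orthogonal_matrix vec_eq_iff forall_2 matrix_matrix_mult_def sum_2 transpose_def mat_def Q_def algebra_simps)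
  moreover have "det Q = 1" using z by (simp add: det_2 Q_def)
  ultimately have "rotation_matrix Q" by (simp add: rotation_matrix_def)
  have Q: "Q *v x = vec2 (\<zeta> * cpx x)" for x
    by (simp add: vec_eq_iff forall_2 matrix_vector_mult_def sum_2 Q_def vec2_def cpx_def)
  have im: "Q *v x + (vec2 p - Q *v X) = vec2 (p + \<zeta> * cpx (x - X))" for x
    unfolding Q linear_diff[OF cpx_linear] right_diff_distrib linear_add[OF vec2_linear] linear_diff[OF vec2_linear]
    by simp
  have "cpx 0 = 0" by (rule linear_0[OF cpx_linear])
  then have "{vec2 p, vec2 (p + \<zeta> * cpx (Y - X)), vec2 (p + \<zeta> * cpx (Z - X))} =
      (\<lambda>x. Q *v x + (vec2 p - Q *v X)) ` {X, Y, Z}"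
    unfolding im by simp
  then show ?thesis unfolding copy_of_def using \<open>rotation_matrix Q\<close> by blast
qed

theorem theorem4:
  fixes X Y Z :: plane and B W :: "plane set"
  assumes "is_triangle X Y Z" and "\<not> equilateral X Y Z"
    and "polygonal_coloring B W"
  shows "\<exists>X' Y' Z'. copy_of {X, Y, Z} {X', Y', Z'} \<and>
           monochromatic B W {X', Y', Z'} \<and>
           X' \<notin> coloring_boundary B W \<and>
           Y' \<notin> coloring_boundary B W \<and>
           Z' \<notin> coloring_boundary B W"
proof (rule ccontr)
  assume neg: "\<not> ?thesis"
  define Bo Wo E where "Bo = cpx ` interior B" and "Wo = cpx ` interior W" and "E = cpx ` coloring_boundary B W"
  interpret plane_coloring Bo Wo E
    unfolding Bo_def Wo_def E_def by (rule polygonal_plane_coloring[OF assms(3)])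
  have no_copy: False if "copy_of {X, Y, Z} {vec2 p, vec2 q, vec2 s}" "{p, q, s} \<subseteq> Bo \<or> {p, q, s} \<subseteq> Wo" for p q s
  proof -
    have "{vec2 p, vec2 q, vec2 s} \<subseteq> interior B \<or> {vec2 p, vec2 q, vec2 s} \<subseteq> interior W"
      using that(2) by (auto simp: Bo_def Wo_def cpx_image)
    then have "monochromatic B W {vec2 p, vec2 q, vec2 s}"
      using interior_subset unfolding monochromatic_def by blast
    moreover have "p \<notin> E" "q \<notin> E" "s \<notin> E" using that(2) E_eq by auto
    then have "vec2 p \<notin> coloring_boundary B W" "vec2 q \<notin> coloring_boundary B W" "vec2 s \<notin> coloring_boundary B W"
      by (auto simp: E_def cpx_image)
    ultimately show False using neg that(1) by blast
  qed
  \<comment> \<open>A copy is a copy of the vertex set, so each side in turn can take the role of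
    \<open>u\<close> in \<open>no_equilateral\<close>.\<close>
  have radius: "plane_coloring_radius Bo Wo E (dist Q R)"
    if "{P, Q, R} = {X, Y, Z}" "Q \<noteq> R" for P Q R
  proof -
    have "plane_coloring_radius Bo Wo E (norm (cpx (R - Q)))"
    proof (rule no_equilateral[where w = "cpx (P - Q)"])
      fix p \<zeta> :: complex assume "norm \<zeta> = 1"
      have "{Q, R, P} = {X, Y, Z}" using that(1) by auto
      then have "copy_of {X, Y, Z} {vec2 p, vec2 (p + \<zeta> * cpx (R - Q)), vec2 (p + \<zeta> * cpx (P - Q))}"
        using copy_of_triple[OF \<open>norm \<zeta> = 1\<close>, of Q R P p] by simp
      from no_copy[OF this] show "\<not> (p \<in> Bo \<and> p + \<zeta> * cpx (R - Q) \<in> Bo \<and> p + \<zeta> * cpx (P - Q) \<in> Bo) \<and>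
        \<not> (p \<in> Wo \<and> p + \<zeta> * cpx (R - Q) \<in> Wo \<and> p + \<zeta> * cpx (P - Q) \<in> Wo)" by auto
    next
      show "cpx (R - Q) \<noteq> 0" using that(2) by (metis norm_cpx norm_eq_zero right_minus_eq)
    qed
    then show ?thesis by (simp add: dist_norm norm_minus_commute)
  qed
  have sides: "plane_coloring_radius Bo Wo E (dist X Y)" "plane_coloring_radius Bo Wo E (dist Y Z)"
    "plane_coloring_radius Bo Wo E (dist Z X)"
    using assms(1) radius[of Z X Y] radius[of X Y Z] radius[of Y Z X] by (auto simp: is_triangle_def insert_commute)
  have "E \<noteq> {}" using sides(1) by (rule plane_coloring_radius.E_nonempty)
  have eq: "a = b" if "plane_coloring_radius Bo Wo E a" "plane_coloring_radius Bo Wo E b" for a b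
    using two_radii[OF that _ \<open>E \<noteq> {}\<close>] two_radii[OF that(2,1) _ \<open>E \<noteq> {}\<close>] by (metis linorder_neqE_linordered_idom)
  have "equilateral X Y Z"
    unfolding equilateral_def using eq[OF sides(1,2)] eq[OF sides(2,3)] by blast
  then show False using assms(2) by simp
qed

end
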